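(* Let $d=4$. There is a constant $c\in(0,\infty)$ such that the following holds. Let $\varepsilon>0$ and, for $r\in(0,1)$, let $t=t(r)=\varepsilon\sqrt{|\log r|}$. There exist $j_0\in(0,\infty)$ and $r_0\in(0,1)$ such that for all $j\geq j_0$ and $0<r\leq r_0$, $$\mathrm{P}\Big(\mathrm{cap}(W^{0,r}_{[0,t]})\geq j\,\frac{t}{|\log r|}\Big)\leq t^{-cj}.$$
   Context: $B^0$ is a standard Brownian motion in $\mathbb{R}^4$ started at $0$ under $\mathrm{P}$, and $W^{0,r}_{[0,t]}=\bigcup_{0\le s\le t}\mathcal{B}(B^0_s,r)$ is the Wiener sausage of radius $r$, where $\mathcal{B}(z,r)$ is the open Euclidean ball. For a bounded Borel set $A\subseteq\mathbb{R}^4$, the Newtonian capacity is $\mathrm{cap}(A)=\big[\inf_\nu\int_A\int_A G(x,y)\,\nu(\mathrm{d}x)\,\nu(\mathrm{d}y)\big]^{-1}$, the infimum being over all probability measures $\nu$ on $A$, with $G(x,y)=\frac{1}{2\pi^{2}\|x-y\|^{2}}$. *)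

theory Defs
  imports "HOL-Probability.Probability"
begin

text \<open>Time is the half-line \<open>{0..}\<close>; the values of \<open>B\<close> at negative times are unconstrained.
  All paths, rather than almost all, start at the origin and are continuous, so that path functionals
  such as the capacity of the sausage are random variables without completing \<open>M\<close>.\<close>

locale standard_brownian_motion = prob_space M
  for M :: "'w measure" and B :: "real \<Rightarrow> 'w \<Rightarrow> real ^ 'n::finite" +
  assumes measurable_at: "\<And>t. 0 \<le> t \<Longrightarrow> B t \<in> borel_measurable M"
    and start: "\<And>\<omega>. \<omega> \<in> space M \<Longrightarrow> B 0 \<omega> = 0"
    and indep_increments:
      "\<And>(u :: nat \<Rightarrow> real) n. 0 \<le> u 0 \<Longrightarrow> (\<And>i. i < n \<Longrightarrow> u i \<le> u (Suc i)) \<Longrightarrow>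
         indep_vars (\<lambda>_. borel) (\<lambda>i \<omega>. B (u (Suc i)) \<omega> - B (u i) \<omega>) {..<n}"
    and gaussian_increments:
      "\<And>s t. 0 \<le> s \<Longrightarrow> s < t \<Longrightarrow>
         distributed M lborel (\<lambda>\<omega>. B t \<omega> - B s \<omega>)
           (\<lambda>x. ennreal (\<Prod>k\<in>UNIV. normal_density 0 (sqrt (t - s)) (x $ k)))"
    and continuous_paths: "\<And>\<omega>. \<omega> \<in> space M \<Longrightarrow> continuous_on {0..} (\<lambda>t. B t \<omega>)"

definition wiener_sausage :: "(real \<Rightarrow> 'w \<Rightarrow> real ^ 'n) \<Rightarrow> real \<Rightarrow> real \<Rightarrow> 'w \<Rightarrow> (real ^ 'n::finite) set"
  where "wiener_sausage B r t \<omega> = (\<Union>s\<in>{0..t}. ball (B s \<omega>) r)"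

text \<open>The inverse is taken in \<^typ>\<open>ennreal\<close>, where \<open>inverse 0 = \<infinity>\<close>. Hence the kernel is infinite on the
  diagonal, and measures with atoms have infinite energy.\<close>

definition newton_kernel :: "real ^ 4 \<Rightarrow> real ^ 4 \<Rightarrow> ennreal"
  where "newton_kernel x y = inverse (ennreal (2 * pi\<^sup>2 * (norm (x - y))\<^sup>2))"

text \<open>A probability measure on \<open>A\<close> is represented by a Borel probability measure on the whole space
  that gives full mass to \<open>A\<close>.\<close>

definition prob_measures_on :: "(real ^ 4) set \<Rightarrow> (real ^ 4) measure set"
  where "prob_measures_on A = {\<nu>. prob_space \<nu> \<and> sets \<nu> = sets borel \<and> emeasure \<nu> A = 1}"

definition newton_cap :: "(real ^ 4) set \<Rightarrow> ennreal"
  where "newton_cap A =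
    inverse (INF \<nu>\<in>prob_measures_on A. \<integral>\<^sup>+x\<in>A. (\<integral>\<^sup>+y\<in>A. newton_kernel x y \<partial>\<nu>) \<partial>\<nu>)"

end

theory Submission
  imports Defs "HOL-Real_Asymp.Real_Asymp"
begin

text \<open>
  Capacity is subadditive, so the sausage up to time \<open>t\<close> is cut into pieces of the path of duration
  \<open>h\<close>, a power of \<open>r\<close>, whose capacities are dominated by independent functionals \<open>Z\<close> of the
  increments with \<open>E exp (\<bar>ln r\<bar> * Z) \<le> 1 + C * h\<close>. Chernoff's bound then gives
  \<open>exp (2 * C * t - j * t)\<close>, which is much smaller than the required power of \<open>t\<close>.

  The kernel \<open>1 / (\<rho>\<^sup>2 + \<bar>x - y\<bar>\<^sup>2)\<close> is positive definite, being a mixture of Gaussians, and is dominated by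
  the Newtonian one. By Cauchy--Schwarz, if a discretised occupation measure of the path has potential
  at least \<open>P\<close> on a set, the capacity of this set is at most its energy over \<open>P\<^sup>2\<close> (up to a constant).
  Along a piece of path the energy has expectation of order \<open>h * \<bar>ln r\<bar>\<close>, while the potential is of order
  \<open>\<bar>ln r\<bar>\<close> everywhere on the sausage outside an event whose probability is a high power of \<open>r\<close>;
  this follows from an explicit exponential supermartingale. On the exceptional event the
  capacity is bounded by the square of the diameter.
\<close>

section \<open>Gaussian integrals\<close>

text \<open>The kernel is cut off at distance \<open>\<rho> = sqrt (m * \<eta>)\<close>, the typical
  displacement over \<open>m\<close> pieces of duration \<open>\<eta>\<close>, and a block consists
  of \<open>2 * m^2\<close> pieces. With \<open>m\<close> close to \<open>r powr (-1/3)\<close> and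
  \<open>\<eta> = 1 / m^6\<close>, the cut-off is of order m^(-5/2), hence eventually above
  \<open>4 * r\<close>, while block and cut-off differ in time scale by a factor of order
  \<open>m\<close>. So \<open>ln m\<close>, comparable to \<bar>ln r\<bar>, enters once in the
  energy per unit time and once in the potential, and energy over squared potential is of order h /
  \<bar>ln r\<bar>. The obstacle is the exceptional event: it has to contribute only O(h) =
  O(m^(-4)) to the exponential moment, after a union bound over all pieces of the block. A variance
  bound for the potential is too weak for this, whereas the exponential moment gives any power of
  \<open>m\<close>. The number \<open>p\<close> of samples per piece does not enter the estimates.
  It is sent to infinity only at the end, because the mesh that resolves a path depends on the
  path.\<close>

definition gauss :: "real \<Rightarrow> (real ^ 4) measure" where
  "gauss \<tau> = density lborel (\<lambda>x. ennreal (\<Prod>k\<in>UNIV. normal_density 0 (sqrt \<tau>) (x $ k)))"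

lemma sets_gauss [simp, measurable_cong]: "sets (gauss \<tau>) = sets borel"
  by (simp add: gauss_def)

lemma space_gauss [simp]: "space (gauss \<tau>) = UNIV"
  by (simp add: gauss_def)

text \<open>Completing the square turns the integrand into a constant times the normal density with
  mean \<open>\<mu>\<close> and standard deviation \<open>s\<close>. The second assumption says that
  the new variance is positive, which is the condition for the integral to be finite.\<close>

lemma nn_integral_exp_square_normal:
  fixes b \<sigma> x :: real
  assumes "\<sigma> > 0" "2 * b * \<sigma>\<^sup>2 < 1"
  shows "(\<integral>\<^sup>+y. ennreal (exp (b * (x + y)\<^sup>2) * normal_density 0 \<sigma> y) \<partial>lborel)
    = ennreal (exp (b * x\<^sup>2 / (1 - 2 * b * \<sigma>\<^sup>2)) / sqrt (1 - 2 * b * \<sigma>\<^sup>2))"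
proof -
  define q where "q = 1 - 2 * b * \<sigma>\<^sup>2"
  define s where "s = \<sigma> / sqrt q"
  define \<mu> where "\<mu> = 2 * b * \<sigma>\<^sup>2 * x / q"
  have q: "q > 0" using assms by (simp add: q_def)
  have s: "s > 0" using q assms by (simp add: s_def)
  have s2: "s\<^sup>2 = \<sigma>\<^sup>2 / q" using q by (simp add: s_def power_divide)
  have b: "b = (1 - q) / (2 * \<sigma>\<^sup>2)" using assms by (simp add: q_def)
  have pw: "exp (b * (x + y)\<^sup>2) * normal_density 0 \<sigma> y
      = exp (b * x\<^sup>2 / q) / sqrt q * normal_density \<mu> s y" for y
  proof -
    have "b * (x + y)\<^sup>2 + - y\<^sup>2 / (2 * \<sigma>\<^sup>2) = b * x\<^sup>2 / q + - (y - \<mu>)\<^sup>2 / (2 * s\<^sup>2)"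
      using q assms(1) unfolding s2 \<mu>_def b
      by (simp add: field_simps power2_eq_square)
    hence "exp (b * (x + y)\<^sup>2) * exp (- y\<^sup>2 / (2 * \<sigma>\<^sup>2)) = exp (b * x\<^sup>2 / q) * exp (- (y - \<mu>)\<^sup>2 / (2 * s\<^sup>2))"
      by (simp flip: exp_add)
    moreover have "sqrt (2 * pi * s\<^sup>2) = sqrt (2 * pi * \<sigma>\<^sup>2) / sqrt q"
      by (simp add: s2 real_sqrt_divide real_sqrt_mult)
    ultimately show ?thesis using q
      by (simp add: normal_density_def field_simps)
  qed
  have "(\<integral>\<^sup>+y. ennreal (exp (b * (x + y)\<^sup>2) * normal_density 0 \<sigma> y) \<partial>lborel)
     = (\<integral>\<^sup>+y. ennreal (exp (b * x\<^sup>2 / q) / sqrt q) * ennreal (normal_density \<mu> s y) \<partial>lborel)"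
    using q by (intro nn_integral_cong) (simp add: pw flip: ennreal_mult)
  also have "\<dots> = ennreal (exp (b * x\<^sup>2 / q) / sqrt q) * (\<integral>\<^sup>+y. ennreal (normal_density \<mu> s y) \<partial>lborel)"
    by (rule nn_integral_cmult) auto
  also have "(\<integral>\<^sup>+y. ennreal (normal_density \<mu> s y) \<partial>lborel) = 1"
    using prob_space.emeasure_space_1[OF prob_space_normal_density[OF s, of \<mu>]]
    by (simp add: emeasure_density)
  finally show ?thesis by (simp add: q_def)
qed

text \<open>Tonelli for coordinates. The product formula for \<open>lborel\<close> is indexed by
  \<open>Basis\<close>, so factors are transported along the bijection from \<open>k\<close> to
  \<open>axis k 1\<close>.\<close>

lemma nn_integral_lborel_prod_vec:
  fixes f :: "'n::finite \<Rightarrow> real \<Rightarrow> ennreal"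
  assumes [measurable]: "\<And>k. f k \<in> borel_measurable borel"
  shows "(\<integral>\<^sup>+x. (\<Prod>k\<in>UNIV. f k (x $ k)) \<partial>lborel) = (\<Prod>k\<in>UNIV. \<integral>\<^sup>+x. f k x \<partial>lborel)"
proof -
  define g where "g b = f (THE k. b = axis k (1::real))" for b
  have Basis: "(Basis :: (real ^ 'n) set) = (\<lambda>k. axis k 1) ` UNIV"
    by (auto simp: Basis_vec_def)
  have inj: "inj (\<lambda>k::'n. axis k (1::real))"
    by (auto simp: inj_on_def axis_eq_axis)
  have g: "g (axis k 1) = f k" for k
    by (simp add: g_def axis_eq_axis)
  have "(\<integral>\<^sup>+x. (\<Prod>b\<in>Basis. g b (x \<bullet> b)) \<partial>lborel) = (\<Prod>b\<in>Basis. (\<integral>\<^sup>+x. g b x \<partial>lborel))"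
    by (rule nn_integral_lborel_prod) (auto simp: g_def)
  thus ?thesis
    unfolding Basis using inj by (simp add: prod.reindex g inner_axis)
qed

lemma norm_sq_vec: "(norm (x :: real ^ 'n::finite))\<^sup>2 = (\<Sum>k\<in>UNIV. (x $ k)\<^sup>2)"
  by (simp add: norm_vec_def L2_set_def sum_nonneg)

lemma exp_norm_sq: "exp (c * (norm (x :: real ^ 'n::finite))\<^sup>2) = (\<Prod>k\<in>UNIV. exp (c * (x $ k)\<^sup>2))"
  by (simp add: norm_sq_vec sum_distrib_left exp_sum)

text \<open>Four coordinates contribute a factor (1 - 2 b \<tau>)^(-1/2) each. Positive
  \<open>b\<close> serves the exponential supermartingales, negative \<open>b\<close> the mean of
  the kernel, and \<open>b = 0\<close> the total mass.\<close>

lemma nn_integral_exp_square_gauss: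
  assumes "\<tau> > 0" "2 * b * \<tau> < 1"
  shows "(\<integral>\<^sup>+y. ennreal (exp (b * (norm (x + y))\<^sup>2)) \<partial>gauss \<tau>)
    = ennreal (exp (b * (norm x)\<^sup>2 / (1 - 2 * b * \<tau>)) / (1 - 2 * b * \<tau>)\<^sup>2)"
proof -
  define q where "q = 1 - 2 * b * \<tau>"
  have q: "q > 0" using assms by (simp add: q_def)
  have 1: "ennreal (\<Prod>k\<in>UNIV. normal_density 0 (sqrt \<tau>) (y $ k)) * ennreal (exp (b * (norm (x + y))\<^sup>2))
     = (\<Prod>k\<in>UNIV. ennreal (exp (b * (x $ k + y $ k)\<^sup>2) * normal_density 0 (sqrt \<tau>) (y $ k)))" for y :: "real ^ 4"
    by (simp add: norm_sq_vec sum_distrib_left exp_sum prod_ennreal prod_nonneg flip: ennreal_mult prod.distrib)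
       (simp add: mult.commute)
  have "(\<integral>\<^sup>+y. ennreal (exp (b * (norm (x + y))\<^sup>2)) \<partial>gauss \<tau>)
     = (\<integral>\<^sup>+y. (\<Prod>k\<in>UNIV. ennreal (exp (b * (x $ k + y $ k)\<^sup>2) * normal_density 0 (sqrt \<tau>) (y $ k))) \<partial>lborel)"
    unfolding gauss_def by (subst nn_integral_density) (auto simp: 1)
  also have "\<dots> = (\<Prod>k\<in>UNIV. \<integral>\<^sup>+y. ennreal (exp (b * (x $ k + y)\<^sup>2) * normal_density 0 (sqrt \<tau>) y) \<partial>lborel)"
    by (rule nn_integral_lborel_prod_vec) auto
  also have "\<dots> = (\<Prod>k\<in>UNIV. ennreal (exp (b * (x $ k)\<^sup>2 / q) / sqrt q))"
    using assms by (intro prod.cong refl) (subst nn_integral_exp_square_normal, auto simp: q_def)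
  also have "\<dots> = ennreal (\<Prod>k\<in>UNIV. exp (b * (x $ k)\<^sup>2 / q) / sqrt q)"
    using q by (simp add: prod_ennreal)
  also have "(\<Prod>k\<in>UNIV. exp (b * (x $ k)\<^sup>2 / q) / sqrt q) = exp (b * (norm x)\<^sup>2 / q) / q\<^sup>2"
  proof -
    have "sqrt q ^ 4 = q\<^sup>2" using q by (simp add: power4_eq_xxxx power2_eq_square)
    thus ?thesis using exp_norm_sq[of "b / q" x] by (simp add: prod_dividef)
  qed
  finally show ?thesis by (simp add: q_def)
qed

lemma prob_space_gauss:
  assumes "\<tau> > 0" shows "prob_space (gauss \<tau>)"
proof
  show "emeasure (gauss \<tau>) (space (gauss \<tau>)) = 1"
    using nn_integral_exp_square_gauss[OF assms, of 0 0] by simp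
qed

text \<open>Read off from the total mass of \<open>gauss (1 / (2 * a))\<close>, whose density is (a
  / pi)^2 times the integrand.\<close>

lemma nn_integral_exp_neg_square:
  assumes "a > 0"
  shows "(\<integral>\<^sup>+z. ennreal (exp (- a * (norm (z :: real ^ 4))\<^sup>2)) \<partial>lborel) = ennreal ((pi / a)\<^sup>2)"
proof -
  define \<tau> where "\<tau> = 1 / (2 * a)"
  have \<tau>: "\<tau> > 0" using assms by (simp add: \<tau>_def)
  have d: "(\<Prod>k\<in>UNIV. normal_density 0 (sqrt \<tau>) (z $ k)) = (a / pi)\<^sup>2 * exp (- a * (norm z)\<^sup>2)" for z :: "real ^ 4"
  proof -
    have "(\<Prod>k\<in>UNIV. normal_density 0 (sqrt \<tau>) (z $ k))
        = (\<Prod>k\<in>(UNIV::4 set). 1 / sqrt (pi / a) * exp (- a * (z $ k)\<^sup>2))"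
      using assms by (intro prod.cong) (auto simp: normal_density_def \<tau>_def field_simps)
    also have "\<dots> = (1 / sqrt (pi / a)) ^ 4 * exp (- a * (norm z)\<^sup>2)"
      using exp_norm_sq[of "-a" z] by (simp only: prod.distrib) (simp add: prod_constant)
    also have "(1 / sqrt (pi / a)) ^ 4 = (a / pi)\<^sup>2"
      using assms by (simp add: power4_eq_xxxx power2_eq_square field_simps)
    finally show ?thesis .
  qed
  have "1 = (\<integral>\<^sup>+z. ennreal (\<Prod>k\<in>UNIV. normal_density 0 (sqrt \<tau>) (z $ k)) \<partial>(lborel :: (real^4) measure))"
    using prob_space.emeasure_space_1[OF prob_space_gauss[OF \<tau>]]
    by (simp add: gauss_def emeasure_density)
  also have "\<dots> = ennreal ((a / pi)\<^sup>2) * (\<integral>\<^sup>+z. ennreal (exp (- a * (norm (z :: real ^ 4))\<^sup>2)) \<partial>lborel)"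
    by (simp add: d ennreal_mult nn_integral_cmult)
  finally have "ennreal ((pi / a)\<^sup>2) * 1 = ennreal ((pi / a)\<^sup>2) * ennreal ((a / pi)\<^sup>2) * (\<integral>\<^sup>+z. ennreal (exp (- a * (norm (z :: real ^ 4))\<^sup>2)) \<partial>lborel)"
    by (simp add: mult.assoc)
  also have "ennreal ((pi / a)\<^sup>2) * ennreal ((a / pi)\<^sup>2) = 1"
    using assms by (simp flip: ennreal_mult power_mult_distrib)
  finally show ?thesis by simp
qed

section \<open>Upper bounds for the Newtonian capacity\<close>

lemma ennreal_two_mult_le_squares: "2 * (a * b) \<le> a\<^sup>2 + b\<^sup>2" for a b :: ennreal
proof (cases "a = \<infinity> \<or> b = \<infinity>")
  case True thus ?thesis by (auto simp: power2_eq_square)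
next
  case False
  then obtain x y where "a = ennreal x" "b = ennreal y" "x \<ge> 0" "y \<ge> 0"
    by (metis ennreal_cases infinity_ennreal_def)
  moreover have "2 * (x * y) \<le> x\<^sup>2 + y\<^sup>2" using sum_squares_bound[of x y] by simp
  ultimately have "ennreal (2 * (x * y)) \<le> ennreal (x\<^sup>2 + y\<^sup>2)" by (intro ennreal_leI)
  thus ?thesis using \<open>a = _\<close> \<open>b = _\<close> \<open>x \<ge> 0\<close> \<open>y \<ge> 0\<close>
    by (simp add: ennreal_power ennreal_mult)
qed

text \<open>By the parallelogram law the two exponents separate into one centred at the midpoint
  \<open>m\<close> and one in \<open>x - y\<close>. This exhibits the Gaussian kernel as a Gram
  kernel in L^2, which is the source of positive definiteness.\<close>

lemma gauss_convolution:
  fixes x y :: "real ^ 4"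
  assumes "\<beta> > 0"
  shows "(\<integral>\<^sup>+z. ennreal (exp (- 2 * \<beta> * (norm (x - z))\<^sup>2)) * ennreal (exp (- 2 * \<beta> * (norm (y - z))\<^sup>2)) \<partial>lborel)
     = ennreal ((pi / (4 * \<beta>))\<^sup>2) * ennreal (exp (- \<beta> * (norm (x - y))\<^sup>2))"
proof -
  define m where "m = (1/2) *\<^sub>R (x + y)"
  have eq: "2 * (norm (x - z))\<^sup>2 + 2 * (norm (y - z))\<^sup>2 = 4 * (norm (z - m))\<^sup>2 + (norm (x - y))\<^sup>2" for z
    unfolding m_def power2_norm_eq_inner by (simp add: algebra_simps inner_commute)
  have "- 2 * \<beta> * (norm (x - z))\<^sup>2 + - 2 * \<beta> * (norm (y - z))\<^sup>2
      = - (4 * \<beta>) * (norm (z - m))\<^sup>2 + - \<beta> * (norm (x - y))\<^sup>2" for z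
    using arg_cong[OF eq[of z], of "\<lambda>u. - \<beta> * u"] by (simp add: algebra_simps)
  hence "exp (- 2 * \<beta> * (norm (x - z))\<^sup>2) * exp (- 2 * \<beta> * (norm (y - z))\<^sup>2)
      = exp (- (4 * \<beta>) * (norm (z - m))\<^sup>2) * exp (- \<beta> * (norm (x - y))\<^sup>2)" for z
    by (simp flip: exp_add)
  hence "(\<integral>\<^sup>+z. ennreal (exp (- 2 * \<beta> * (norm (x - z))\<^sup>2)) * ennreal (exp (- 2 * \<beta> * (norm (y - z))\<^sup>2)) \<partial>lborel)
     = (\<integral>\<^sup>+z. ennreal (exp (- (4 * \<beta>) * (norm (z - m))\<^sup>2)) * ennreal (exp (- \<beta> * (norm (x - y))\<^sup>2)) \<partial>lborel)"
    by (simp flip: ennreal_mult)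
  also have "\<dots> = (\<integral>\<^sup>+z. ennreal (exp (- (4 * \<beta>) * (norm (z - m))\<^sup>2)) \<partial>lborel) * ennreal (exp (- \<beta> * (norm (x - y))\<^sup>2))"
    by (rule nn_integral_multc) auto
  also have "(\<integral>\<^sup>+z. ennreal (exp (- (4 * \<beta>) * (norm (z - m))\<^sup>2)) \<partial>lborel)
     = (\<integral>\<^sup>+z. ennreal (exp (- (4 * \<beta>) * (norm z)\<^sup>2)) \<partial>distr lborel borel ((+) (-m)))"
    by (subst nn_integral_distr) auto
  also have "\<dots> = ennreal ((pi / (4 * \<beta>))\<^sup>2)"
    using assms nn_integral_exp_neg_square[of "4 * \<beta>"] by (simp add: lborel_distr_plus)
  finally show ?thesis .
qed

text \<open>Through the Gram representation this is the integral of 2 f h \<le> f^2 + h^2, where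
  \<open>f\<close> and \<open>h\<close> are the Gaussian transforms of \<open>\<nu>\<close> and of
  the weighted point masses. Unlike the product form of Cauchy-Schwarz, this form is linear in the
  kernel, so it survives mixing over \<open>\<beta>\<close>; the lost scaling is recovered later by
  optimising the weights.\<close>

lemma gauss_kernel_cross_energy:
  fixes \<nu> :: "(real ^ 4) measure" and x :: "'i \<Rightarrow> real ^ 4"
  assumes "finite_measure \<nu>" and [measurable_cong]: "sets \<nu> = sets borel"
    and "\<beta> > 0" "finite L" and w: "\<And>l. l \<in> L \<Longrightarrow> 0 \<le> w l"
  defines "e \<equiv> \<lambda>a b. ennreal (exp (- \<beta> * (norm (a - b))\<^sup>2))"
  shows "2 * (\<Sum>l\<in>L. ennreal (w l) * (\<integral>\<^sup>+a. e a (x l) \<partial>\<nu>))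
    \<le> (\<integral>\<^sup>+a. \<integral>\<^sup>+b. e a b \<partial>\<nu> \<partial>\<nu>) + (\<Sum>k\<in>L. \<Sum>l\<in>L. ennreal (w k) * ennreal (w l) * e (x k) (x l))"
proof -
  interpret \<nu>: finite_measure \<nu> by fact
  interpret P: pair_sigma_finite lborel \<nu>
    by (simp add: \<nu>.sigma_finite_measure_axioms lborel.sigma_finite_measure_axioms pair_sigma_finite.intro)
  define C where "C = ennreal ((pi / (4 * \<beta>))\<^sup>2)"
  define g where "g a z = ennreal (exp (- 2 * \<beta> * (norm (a - z))\<^sup>2))" for a z :: "real ^ 4"
  have [measurable]: "case_prod g \<in> borel_measurable (borel \<Otimes>\<^sub>M borel)"
    unfolding g_def by measurable
  have [measurable]: "case_prod e \<in> borel_measurable (borel \<Otimes>\<^sub>M borel)"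
    unfolding e_def by measurable
  have conv: "(\<integral>\<^sup>+z. g a z * g b z \<partial>lborel) = C * e a b" for a b
    unfolding g_def C_def e_def by (rule gauss_convolution) fact
  define f where "f z = (\<integral>\<^sup>+a. g a z \<partial>\<nu>)" for z
  define h where "h z = (\<Sum>l\<in>L. ennreal (w l) * g (x l) z)" for z
  have [measurable]: "f \<in> borel_measurable borel" unfolding f_def by measurable
  have [measurable]: "h \<in> borel_measurable borel" unfolding h_def by measurable
  have 1: "(\<integral>\<^sup>+z. f z * h z \<partial>lborel) = C * (\<Sum>l\<in>L. ennreal (w l) * (\<integral>\<^sup>+a. e a (x l) \<partial>\<nu>))"
  proof -
    have "(\<integral>\<^sup>+z. f z * h z \<partial>lborel) = (\<integral>\<^sup>+z. (\<Sum>l\<in>L. ennreal (w l) * (\<integral>\<^sup>+a. g a z * g (x l) z \<partial>\<nu>)) \<partial>lborel)"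
      unfolding f_def h_def by (simp add: sum_distrib_left nn_integral_multc mult_ac)
    also have "\<dots> = (\<Sum>l\<in>L. ennreal (w l) * (\<integral>\<^sup>+z. \<integral>\<^sup>+a. g a z * g (x l) z \<partial>\<nu> \<partial>lborel))"
      by (subst nn_integral_sum) (auto simp: nn_integral_cmult)
    also have "\<dots> = (\<Sum>l\<in>L. ennreal (w l) * (\<integral>\<^sup>+a. \<integral>\<^sup>+z. g a z * g (x l) z \<partial>lborel \<partial>\<nu>))"
      by (intro sum.cong refl arg_cong2[where f="(*)"] P.Fubini'[symmetric]) measurable
    finally show ?thesis by (simp add: conv sum_distrib_left nn_integral_cmult mult_ac)
  qed
  have 2: "(\<integral>\<^sup>+z. (f z)\<^sup>2 \<partial>lborel) = C * (\<integral>\<^sup>+a. \<integral>\<^sup>+b. e a b \<partial>\<nu> \<partial>\<nu>)"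
  proof -
    have "(\<integral>\<^sup>+z. (f z)\<^sup>2 \<partial>lborel) = (\<integral>\<^sup>+z. \<integral>\<^sup>+a. g a z * f z \<partial>\<nu> \<partial>lborel)"
      unfolding power2_eq_square by (subst (1) f_def) (simp add: nn_integral_multc)
    also have "\<dots> = (\<integral>\<^sup>+a. \<integral>\<^sup>+z. g a z * f z \<partial>lborel \<partial>\<nu>)"
      by (rule P.Fubini'[symmetric]) measurable
    also have "\<dots> = (\<integral>\<^sup>+a. \<integral>\<^sup>+z. \<integral>\<^sup>+b. g a z * g b z \<partial>\<nu> \<partial>lborel \<partial>\<nu>)"
      unfolding f_def by (simp add: nn_integral_cmult)
    also have "\<dots> = (\<integral>\<^sup>+a. \<integral>\<^sup>+b. \<integral>\<^sup>+z. g a z * g b z \<partial>lborel \<partial>\<nu> \<partial>\<nu>)"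
      by (intro nn_integral_cong P.Fubini'[symmetric]) measurable
    finally show ?thesis by (simp add: conv nn_integral_cmult)
  qed
  have 3: "(\<integral>\<^sup>+z. (h z)\<^sup>2 \<partial>lborel) = C * (\<Sum>k\<in>L. \<Sum>l\<in>L. ennreal (w k) * ennreal (w l) * e (x k) (x l))"
  proof -
    have "(\<integral>\<^sup>+z. (h z)\<^sup>2 \<partial>lborel) = (\<integral>\<^sup>+z. (\<Sum>k\<in>L. \<Sum>l\<in>L. ennreal (w k) * ennreal (w l) * (g (x k) z * g (x l) z)) \<partial>lborel)"
      unfolding h_def power2_eq_square sum_product by (simp add: mult_ac)
    also have "\<dots> = (\<Sum>k\<in>L. \<Sum>l\<in>L. ennreal (w k) * ennreal (w l) * (\<integral>\<^sup>+z. g (x k) z * g (x l) z \<partial>lborel))"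
      by (simp add: nn_integral_sum nn_integral_cmult)
    finally show ?thesis by (simp add: conv sum_distrib_left mult_ac)
  qed
  have "(\<integral>\<^sup>+z. 2 * (f z * h z) \<partial>lborel) \<le> (\<integral>\<^sup>+z. (f z)\<^sup>2 + (h z)\<^sup>2 \<partial>lborel)"
    by (intro nn_integral_mono ennreal_two_mult_le_squares)
  hence "C * (2 * (\<Sum>l\<in>L. ennreal (w l) * (\<integral>\<^sup>+a. e a (x l) \<partial>\<nu>)))
    \<le> C * ((\<integral>\<^sup>+a. \<integral>\<^sup>+b. e a b \<partial>\<nu> \<partial>\<nu>) + (\<Sum>k\<in>L. \<Sum>l\<in>L. ennreal (w k) * ennreal (w l) * e (x k) (x l)))"
    by (simp add: nn_integral_cmult nn_integral_add 1 2 3 distrib_left mult.left_commute[of C 2])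
  moreover have "0 < C" "C < top" using \<open>\<beta> > 0\<close> by (auto simp: C_def)
  ultimately show ?thesis by (simp add: ennreal_mult_le_mult_iff)
qed

text \<open>Up to the factor 1 / (2 pi^2), the Newtonian kernel made finite on the diagonal, so that
  sums of point masses have finite energy.\<close>

definition cut_kernel :: "real \<Rightarrow> real ^ 4 \<Rightarrow> real ^ 4 \<Rightarrow> real" where
  "cut_kernel \<rho> x y = 1 / (\<rho>\<^sup>2 + (norm (x - y))\<^sup>2)"

lemma nn_integral_exp_neg:
  assumes "a > (0::real)"
  shows "(\<integral>\<^sup>+\<beta>. ennreal (exp (- \<beta> * a)) * indicator {0<..} \<beta> \<partial>lborel) = ennreal (1 / a)"
proof -
  have "(\<integral>\<^sup>+\<beta>. ennreal (exp (- \<beta> * a)) * indicator {0<..} \<beta> \<partial>lborel) = (\<integral>\<^sup>+\<beta>. ennreal (exp (- \<beta> * a)) * indicator {0..} \<beta> \<partial>lborel)"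
    by (rule nn_integral_cong_AE, rule eventually_mono, rule AE_lborel_singleton[of 0]) (auto simp: indicator_def)
  also have "\<dots> = ennreal (0 - (- exp (- 0 * a) / a))"
  proof (rule nn_integral_FTC_atLeast)
    show "((\<lambda>\<beta>. - exp (- \<beta> * a) / a) \<longlongrightarrow> 0) at_top" using assms by real_asymp
    show "((\<lambda>\<beta>. - exp (- \<beta> * a) / a) has_real_derivative exp (- x * a)) (at x)" for x
      using assms by (auto intro!: derivative_eq_intros)
  qed auto
  finally show ?thesis by simp
qed

text \<open>The Laplace representation 1 / A = integral of exp (- \<beta> A). The half-line is open
  because the Gaussian inequality is available for strictly positive \<open>\<beta>\<close>.\<close>

lemma cut_kernel_integral:
  assumes "\<rho> > 0"
  shows "ennreal (cut_kernel \<rho> x y)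
    = (\<integral>\<^sup>+\<beta>. (ennreal (exp (- \<beta> * \<rho>\<^sup>2)) * indicator {0<..} \<beta>) * ennreal (exp (- \<beta> * (norm (x - y))\<^sup>2)) \<partial>lborel)"
proof -
  have "\<rho>\<^sup>2 + (norm (x - y))\<^sup>2 > 0" using assms by (simp add: add_pos_nonneg)
  hence "ennreal (cut_kernel \<rho> x y) = (\<integral>\<^sup>+\<beta>. ennreal (exp (- \<beta> * (\<rho>\<^sup>2 + (norm (x - y))\<^sup>2))) * indicator {0<..} \<beta> \<partial>lborel)"
    unfolding cut_kernel_def by (rule nn_integral_exp_neg[symmetric])
  also have "\<dots> = (\<integral>\<^sup>+\<beta>. (ennreal (exp (- \<beta> * \<rho>\<^sup>2)) * indicator {0<..} \<beta>) * ennreal (exp (- \<beta> * (norm (x - y))\<^sup>2)) \<partial>lborel)"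
    by (intro nn_integral_cong) (auto simp: indicator_def algebra_simps exp_diff exp_minus field_simps simp flip: ennreal_mult exp_add)
  finally show ?thesis .
qed

text \<open>Each term is linear in the kernel, so Tonelli reduces the claim to the Gaussian case,
  integrated against the non-negative weight \<open>\<phi>\<close>.\<close>

lemma cut_kernel_cross_energy:
  fixes \<nu> :: "(real ^ 4) measure" and x :: "'i \<Rightarrow> real ^ 4"
  assumes "finite_measure \<nu>" and [measurable_cong]: "sets \<nu> = sets borel"
    and "\<rho> > 0" "finite L" and w: "\<And>l. l \<in> L \<Longrightarrow> 0 \<le> w l"
  defines "e \<equiv> \<lambda>a b. ennreal (cut_kernel \<rho> a b)"
  shows "2 * (\<Sum>l\<in>L. ennreal (w l) * (\<integral>\<^sup>+a. e a (x l) \<partial>\<nu>))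
    \<le> (\<integral>\<^sup>+a. \<integral>\<^sup>+b. e a b \<partial>\<nu> \<partial>\<nu>) + (\<Sum>k\<in>L. \<Sum>l\<in>L. ennreal (w k) * ennreal (w l) * e (x k) (x l))"
proof -
  interpret \<nu>: finite_measure \<nu> by fact
  interpret P: pair_sigma_finite lborel \<nu>
    by (simp add: \<nu>.sigma_finite_measure_axioms lborel.sigma_finite_measure_axioms pair_sigma_finite.intro)
  define \<phi> where "\<phi> \<beta> = ennreal (exp (- \<beta> * \<rho>\<^sup>2)) * indicator {0<..} \<beta>" for \<beta> :: real
  define g where "g \<beta> a b = ennreal (exp (- \<beta> * (norm (a - b))\<^sup>2))" for \<beta> and a b :: "real ^ 4"
  have [measurable]: "\<phi> \<in> borel_measurable borel" unfolding \<phi>_def by measurable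
  have [measurable]: "(\<lambda>\<omega>. g (p \<omega>) (q \<omega>) (r \<omega>)) \<in> borel_measurable N"
    if [measurable]: "p \<in> borel_measurable N" "q \<in> borel_measurable N" "r \<in> borel_measurable N"
    for p q r and N :: "'z measure" unfolding g_def by measurable
  have e: "e a b = (\<integral>\<^sup>+\<beta>. \<phi> \<beta> * g \<beta> a b \<partial>lborel)" for a b
    unfolding e_def \<phi>_def g_def by (rule cut_kernel_integral) fact
  have 1: "(\<Sum>l\<in>L. ennreal (w l) * (\<integral>\<^sup>+a. e a (x l) \<partial>\<nu>)) = (\<integral>\<^sup>+\<beta>. \<phi> \<beta> * (\<Sum>l\<in>L. ennreal (w l) * (\<integral>\<^sup>+a. g \<beta> a (x l) \<partial>\<nu>)) \<partial>lborel)"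
  proof -
    have "(\<integral>\<^sup>+a. e a y \<partial>\<nu>) = (\<integral>\<^sup>+\<beta>. \<phi> \<beta> * (\<integral>\<^sup>+a. g \<beta> a y \<partial>\<nu>) \<partial>lborel)" for y
      unfolding e by (subst P.Fubini') (auto simp: nn_integral_cmult)
    thus ?thesis
      by (simp add: sum_distrib_left nn_integral_sum mult.left_commute[of "\<phi> _"] nn_integral_cmult)
  qed
  have 2: "(\<integral>\<^sup>+a. \<integral>\<^sup>+b. e a b \<partial>\<nu> \<partial>\<nu>) = (\<integral>\<^sup>+\<beta>. \<phi> \<beta> * (\<integral>\<^sup>+a. \<integral>\<^sup>+b. g \<beta> a b \<partial>\<nu> \<partial>\<nu>) \<partial>lborel)"
  proof -
    have "(\<integral>\<^sup>+a. \<integral>\<^sup>+b. e a b \<partial>\<nu> \<partial>\<nu>) = (\<integral>\<^sup>+a. \<integral>\<^sup>+\<beta>. \<integral>\<^sup>+b. \<phi> \<beta> * g \<beta> a b \<partial>\<nu> \<partial>lborel \<partial>\<nu>)"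
      unfolding e by (intro nn_integral_cong P.Fubini') measurable
    also have "\<dots> = (\<integral>\<^sup>+\<beta>. \<integral>\<^sup>+a. \<integral>\<^sup>+b. \<phi> \<beta> * g \<beta> a b \<partial>\<nu> \<partial>\<nu> \<partial>lborel)"
      by (intro P.Fubini') measurable
    finally show ?thesis by (simp add: nn_integral_cmult)
  qed
  have 3: "(\<Sum>k\<in>L. \<Sum>l\<in>L. ennreal (w k) * ennreal (w l) * e (x k) (x l))
    = (\<integral>\<^sup>+\<beta>. \<phi> \<beta> * (\<Sum>k\<in>L. \<Sum>l\<in>L. ennreal (w k) * ennreal (w l) * g \<beta> (x k) (x l)) \<partial>lborel)"
    unfolding e by (simp add: sum_distrib_left nn_integral_sum mult.left_commute[of "\<phi> _"] nn_integral_cmult)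
  have "(\<integral>\<^sup>+\<beta>. \<phi> \<beta> * (2 * (\<Sum>l\<in>L. ennreal (w l) * (\<integral>\<^sup>+a. g \<beta> a (x l) \<partial>\<nu>))) \<partial>lborel)
     \<le> (\<integral>\<^sup>+\<beta>. \<phi> \<beta> * ((\<integral>\<^sup>+a. \<integral>\<^sup>+b. g \<beta> a b \<partial>\<nu> \<partial>\<nu>) + (\<Sum>k\<in>L. \<Sum>l\<in>L. ennreal (w k) * ennreal (w l) * g \<beta> (x k) (x l))) \<partial>lborel)"
  proof (intro nn_integral_mono)
    fix \<beta> :: real
    show "\<phi> \<beta> * (2 * (\<Sum>l\<in>L. ennreal (w l) * (\<integral>\<^sup>+a. g \<beta> a (x l) \<partial>\<nu>)))
     \<le> \<phi> \<beta> * ((\<integral>\<^sup>+a. \<integral>\<^sup>+b. g \<beta> a b \<partial>\<nu> \<partial>\<nu>) + (\<Sum>k\<in>L. \<Sum>l\<in>L. ennreal (w k) * ennreal (w l) * g \<beta> (x k) (x l)))"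
    proof (cases "\<beta> > 0")
      case True
      from gauss_kernel_cross_energy[OF assms(1,2) this assms(4) w]
      show ?thesis by (intro mult_left_mono) (auto simp: g_def)
    qed (simp add: \<phi>_def)
  qed
  thus ?thesis
    by (simp add: 1 2 3 distrib_left nn_integral_add mult.left_commute[of _ 2] nn_integral_cmult)
qed

section \<open>Capacity bounds in the form of energy inequalities\<close>

lemma ennreal_inverse_antimono: "a \<le> b \<Longrightarrow> inverse b \<le> inverse a" for a b :: ennreal
  by (simp add: less_eq_ennreal.rep_eq inverse_ennreal.rep_eq ereal_inverse_antimono)

text \<open>Homogeneous form of \<open>newton_cap D \<le> c\<close>, stated for all finite measures so that it passes to
  restrictions of a measure to subsets of \<open>D\<close>.\<close>

definition energy_bound :: "(real ^ 4) set \<Rightarrow> real \<Rightarrow> bool" where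
  "energy_bound D c \<longleftrightarrow> 0 < c \<and> D \<in> sets borel \<and>
     (\<forall>\<nu>. finite_measure \<nu> \<longrightarrow> sets \<nu> = sets borel \<longrightarrow> emeasure \<nu> (- D) = 0 \<longrightarrow>
        (emeasure \<nu> UNIV)\<^sup>2 \<le> ennreal c * (\<integral>\<^sup>+x. \<integral>\<^sup>+y. newton_kernel x y \<partial>\<nu> \<partial>\<nu>))"

lemma measurable_newton_kernel [measurable]:
  "(\<lambda>\<omega>. newton_kernel (f \<omega>) (g \<omega>)) \<in> borel_measurable N"
  if [measurable]: "f \<in> borel_measurable N" "g \<in> borel_measurable N"
  unfolding newton_kernel_def by measurable

lemma energy_bound_newton_cap:
  assumes "energy_bound D c" "A \<subseteq> D"
  shows "newton_cap A \<le> ennreal c"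
proof -
  have c: "c > 0" and D[measurable]: "D \<in> sets borel" using assms(1) by (auto simp: energy_bound_def)
  have "inverse (ennreal c) \<le> (INF \<nu>\<in>prob_measures_on A. \<integral>\<^sup>+x\<in>A. (\<integral>\<^sup>+y\<in>A. newton_kernel x y \<partial>\<nu>) \<partial>\<nu>)"
  proof (rule INF_greatest)
    fix \<nu> assume "\<nu> \<in> prob_measures_on A"
    hence \<nu>: "prob_space \<nu>" and s[measurable_cong]: "sets \<nu> = sets borel" and A: "emeasure \<nu> A = 1"
      by (auto simp: prob_measures_on_def)
    interpret prob_space \<nu> by fact
    \<comment> \<open>\<open>emeasure\<close> vanishes off the sigma-algebra, so mass 1 forces
      \<open>A\<close> to be measurable. A non-Borel \<open>A\<close> admits no competitor at all
      and has capacity 0.\<close>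
    have Am: "A \<in> sets \<nu>" using A emeasure_notin_sets by fastforce
    have sp: "space \<nu> = UNIV" using sets_eq_imp_space_eq[OF s] by simp
    have AE: "AE x in \<nu>. x \<in> A" using A by (intro AE_prob_1) (simp add: measure_def)
    have eq: "(\<integral>\<^sup>+x\<in>A. f x \<partial>\<nu>) = (\<integral>\<^sup>+x. f x \<partial>\<nu>)" for f
      using AE by (intro nn_integral_cong_AE) auto
    have "AE x in \<nu>. x \<in> D" using AE assms(2) by auto
    hence "emeasure \<nu> (- D) = 0"
      by (subst AE_iff_null_sets[THEN iffD2, THEN null_setsD1]) (auto simp: s)
    hence "(emeasure \<nu> UNIV)\<^sup>2 \<le> ennreal c * (\<integral>\<^sup>+x. \<integral>\<^sup>+y. newton_kernel x y \<partial>\<nu> \<partial>\<nu>)"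
      using assms(1) s finite_measure_axioms unfolding energy_bound_def by blast
    hence "1 \<le> ennreal c * (\<integral>\<^sup>+x. \<integral>\<^sup>+y. newton_kernel x y \<partial>\<nu> \<partial>\<nu>)"
      using emeasure_space_1 by (simp add: sp)
    hence "1 / ennreal c \<le> (\<integral>\<^sup>+x. \<integral>\<^sup>+y. newton_kernel x y \<partial>\<nu> \<partial>\<nu>)"
      using c by (subst divide_le_posI_ennreal) (auto simp: mult.commute)
    thus "inverse (ennreal c) \<le> (\<integral>\<^sup>+x\<in>A. (\<integral>\<^sup>+y\<in>A. newton_kernel x y \<partial>\<nu>) \<partial>\<nu>)"
      by (simp add: eq divide_ennreal_def)
  qed
  hence "newton_cap A \<le> inverse (inverse (ennreal c))"
    unfolding newton_cap_def by (simp add: ennreal_inverse_antimono)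
  thus ?thesis using c by (simp add: inverse_ennreal)
qed

text \<open>Subadditivity of capacity. The measure is split into its restrictions to
  \<open>D\<close> and to the complement of \<open>D\<close>, so an overlap with \<open>D'\<close>
  is counted once. The masses \<open>a\<close> and \<open>b\<close> are then recombined by
  Cauchy-Schwarz in the form (a + b)^2 \<le> (c + c') (a^2 / c + b^2 / c').\<close>

lemma energy_bound_Un:
  assumes "energy_bound D c" "energy_bound D' c'"
  shows "energy_bound (D \<union> D') (c + c')"
  unfolding energy_bound_def
proof (intro conjI allI impI)
  show "0 < c + c'" "D \<union> D' \<in> sets borel" using assms by (auto simp: energy_bound_def)
  have c: "c > 0" "c' > 0" and [measurable]: "D \<in> sets borel" "D' \<in> sets borel"
    using assms by (auto simp: energy_bound_def)
  fix \<nu> :: "(real ^ 4) measure"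
  assume fin: "finite_measure \<nu>" and s[measurable_cong]: "sets \<nu> = sets borel" and null: "emeasure \<nu> (- (D \<union> D')) = 0"
  interpret finite_measure \<nu> by fact
  define \<nu>1 where "\<nu>1 = density \<nu> (indicator D)"
  define \<nu>2 where "\<nu>2 = density \<nu> (indicator (- D))"
  have sp: "space \<nu> = UNIV" using sets_eq_imp_space_eq[OF s] by simp
  have s1[measurable_cong]: "sets \<nu>1 = sets borel" and s2[measurable_cong]: "sets \<nu>2 = sets borel" by (auto simp: \<nu>1_def \<nu>2_def s)
  have em1: "emeasure \<nu>1 S = emeasure \<nu> (S \<inter> D)" if [measurable]: "S \<in> sets borel" for S
    by (simp add: \<nu>1_def emeasure_density Int_commute flip: indicator_inter_arith)
  have em2: "emeasure \<nu>2 S = emeasure \<nu> (S \<inter> - D)" if [measurable]: "S \<in> sets borel" for S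
    by (simp add: \<nu>2_def emeasure_density Int_commute flip: indicator_inter_arith)
  have f1: "finite_measure \<nu>1" "finite_measure \<nu>2"
    by (auto intro!: finite_measureI simp: em1 em2 \<nu>1_def[THEN arg_cong[where f=space]] \<nu>2_def[THEN arg_cong[where f=space]] sp)
  interpret n1: finite_measure \<nu>1 by fact
  interpret n2: finite_measure \<nu>2 by fact
  have split: "(\<integral>\<^sup>+x. f x \<partial>\<nu>) = (\<integral>\<^sup>+x. f x \<partial>\<nu>1) + (\<integral>\<^sup>+x. f x \<partial>\<nu>2)"
    if [measurable]: "f \<in> borel_measurable borel" for f
    unfolding \<nu>1_def \<nu>2_def
    by (simp add: nn_integral_density flip: nn_integral_add)
       (auto intro!: nn_integral_cong simp: indicator_def)
  define E1 E2 where "E1 = (\<integral>\<^sup>+x. \<integral>\<^sup>+y. newton_kernel x y \<partial>\<nu>1 \<partial>\<nu>1)" and "E2 = (\<integral>\<^sup>+x. \<integral>\<^sup>+y. newton_kernel x y \<partial>\<nu>2 \<partial>\<nu>2)"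
  define E where "E = (\<integral>\<^sup>+x. \<integral>\<^sup>+y. newton_kernel x y \<partial>\<nu> \<partial>\<nu>)"
  have "E = (\<integral>\<^sup>+x. (\<integral>\<^sup>+y. newton_kernel x y \<partial>\<nu>1) + (\<integral>\<^sup>+y. newton_kernel x y \<partial>\<nu>2) \<partial>\<nu>1)
          + (\<integral>\<^sup>+x. (\<integral>\<^sup>+y. newton_kernel x y \<partial>\<nu>1) + (\<integral>\<^sup>+y. newton_kernel x y \<partial>\<nu>2) \<partial>\<nu>2)"
    unfolding E_def by (simp add: split)
  \<comment> \<open>The two mixed energies are non-negative and are discarded.\<close>
  hence E: "E1 + E2 \<le> E" unfolding E1_def E2_def
    by (auto intro!: add_mono nn_integral_mono)
  have 1: "(emeasure \<nu>1 UNIV)\<^sup>2 \<le> ennreal c * E1"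
  proof -
    have "emeasure \<nu>1 (- D) = 0" by (simp add: em1)
    thus ?thesis using assms(1) f1(1) s1 unfolding energy_bound_def E1_def by blast
  qed
  have 2: "(emeasure \<nu>2 UNIV)\<^sup>2 \<le> ennreal c' * E2"
  proof -
    have "emeasure \<nu>2 (- D') = 0" using null by (simp add: em2 Int_commute)
    thus ?thesis using assms(2) f1(2) s2 unfolding energy_bound_def E2_def by blast
  qed
  have tot: "emeasure \<nu> UNIV = emeasure \<nu>1 UNIV + emeasure \<nu>2 UNIV"
    by (simp add: em1 em2 plus_emeasure)
  obtain a where a: "emeasure \<nu>1 UNIV = ennreal a" "a \<ge> 0"
    by (metis ennreal_cases n1.emeasure_finite infinity_ennreal_def)
  obtain b where b: "emeasure \<nu>2 UNIV = ennreal b" "b \<ge> 0"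
    by (metis ennreal_cases n2.emeasure_finite infinity_ennreal_def)
  show "(emeasure \<nu> UNIV)\<^sup>2 \<le> ennreal (c + c') * (\<integral>\<^sup>+x. \<integral>\<^sup>+y. newton_kernel x y \<partial>\<nu> \<partial>\<nu>)"
  proof (cases "E = top")
    case True thus ?thesis using c by (simp add: E_def[symmetric] ennreal_mult_top)
  next
    case False
    hence "E1 \<noteq> top" "E2 \<noteq> top" using E by (auto simp: top_unique)
    then obtain e1 e2 where e: "E1 = ennreal e1" "e1 \<ge> 0" "E2 = ennreal e2" "e2 \<ge> 0"
      by (metis ennreal_cases)
    have "a\<^sup>2 \<le> c * e1" using 1 e c a by (simp add: ennreal_power ennreal_le_iff flip: ennreal_mult)
    moreover have "b\<^sup>2 \<le> c' * e2" using 2 e c b by (simp add: ennreal_power ennreal_le_iff flip: ennreal_mult)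
    moreover have "(a + b)\<^sup>2 \<le> (c + c') * (a\<^sup>2 / c + b\<^sup>2 / c')"
    proof -
      have "(c + c') * (a\<^sup>2 / c + b\<^sup>2 / c') - (a + b)\<^sup>2 = (c' * a - c * b)\<^sup>2 / (c * c')"
        using c by (simp add: field_simps power2_eq_square)
      moreover have "\<dots> \<ge> 0" using c by simp
      ultimately show ?thesis by linarith
    qed
    moreover have "(c + c') * (a\<^sup>2 / c + b\<^sup>2 / c') \<le> (c + c') * (e1 + e2)"
      using c calculation(1,2) by (intro mult_left_mono add_mono) (auto simp: field_simps)
    ultimately have "(a + b)\<^sup>2 \<le> (c + c') * (e1 + e2)" by linarith
    hence "(emeasure \<nu> UNIV)\<^sup>2 \<le> ennreal (c + c') * (E1 + E2)"
      unfolding tot a b e using a b e c by (simp add: ennreal_power ennreal_leI flip: ennreal_plus ennreal_mult)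
    also have "\<dots> \<le> ennreal (c + c') * E" by (intro mult_left_mono E) auto
    finally show ?thesis unfolding E_def .
  qed
qed

lemma energy_bound_UN:
  assumes "finite I" "I \<noteq> {}" "\<And>i. i \<in> I \<Longrightarrow> energy_bound (D i) (c i)"
  shows "energy_bound (\<Union>i\<in>I. D i) (\<Sum>i\<in>I. c i)"
  using assms by (induction rule: finite_ne_induct) (auto intro: energy_bound_Un)

text \<open>Two points of the ball are at distance at most 2 R, so the kernel is at least 1 / (2
  pi^2 (2 R)^2) on it.\<close>

lemma energy_bound_ball:
  assumes "R > 0" "D \<in> sets borel" "D \<subseteq> ball x0 R"
  shows "energy_bound D (8 * pi\<^sup>2 * R\<^sup>2)"
  unfolding energy_bound_def
proof (intro conjI allI impI)
  show "0 < 8 * pi\<^sup>2 * R\<^sup>2" using assms by simp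
  show "D \<in> sets borel" by fact
  have [measurable]: "D \<in> sets borel" by fact
  fix \<nu> :: "(real ^ 4) measure"
  assume fin: "finite_measure \<nu>" and s[measurable_cong]: "sets \<nu> = sets borel" and null: "emeasure \<nu> (- D) = 0"
  have sp: "space \<nu> = UNIV" using sets_eq_imp_space_eq[OF s] by simp
  let ?c = "8 * pi\<^sup>2 * R\<^sup>2"
  have AE: "AE x in \<nu>. x \<in> D" by (rule AE_I[OF _ null]) (auto simp: s)
  have k: "ennreal (1 / ?c) \<le> newton_kernel x y" if "x \<in> D" "y \<in> D" for x y
  proof -
    have "norm (x - y) \<le> 2 * R"
      using subsetD[OF assms(3) that(1)] subsetD[OF assms(3) that(2)] dist_triangle[of x y x0]
      by (simp add: dist_norm[symmetric] dist_commute)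
    hence "2 * pi\<^sup>2 * (norm (x - y))\<^sup>2 \<le> ?c"
      using power_mono[of "norm (x - y)" "2 * R" 2] by (simp add: power_mult_distrib)
    hence "inverse (ennreal ?c) \<le> newton_kernel x y"
      unfolding newton_kernel_def by (intro ennreal_inverse_antimono ennreal_leI)
    thus ?thesis using assms by (simp add: inverse_ennreal inverse_eq_divide)
  qed
  have "ennreal (1 / ?c) * (emeasure \<nu> UNIV)\<^sup>2 = (\<integral>\<^sup>+x. \<integral>\<^sup>+y. ennreal (1 / ?c) \<partial>\<nu> \<partial>\<nu>)"
    by (simp add: power2_eq_square sp mult.assoc)
  also have "\<dots> \<le> (\<integral>\<^sup>+x. \<integral>\<^sup>+y. newton_kernel x y \<partial>\<nu> \<partial>\<nu>)"
    using AE
  proof (intro nn_integral_mono_AE, eventually_elim)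
    case (elim x)
    show ?case using AE by (intro nn_integral_mono_AE, eventually_elim) (use elim k in auto)
  qed
  finally have "ennreal ?c * (ennreal (1 / ?c) * (emeasure \<nu> UNIV)\<^sup>2) \<le> ennreal ?c * (\<integral>\<^sup>+x. \<integral>\<^sup>+y. newton_kernel x y \<partial>\<nu> \<partial>\<nu>)"
    by (rule mult_left_mono) simp
  moreover have "ennreal ?c * ennreal (1 / ?c) = 1"
    using assms by (simp flip: ennreal_mult)
  ultimately show "(emeasure \<nu> UNIV)\<^sup>2 \<le> ennreal ?c * (\<integral>\<^sup>+x. \<integral>\<^sup>+y. newton_kernel x y \<partial>\<nu> \<partial>\<nu>)"
    by (simp flip: mult.assoc)
qed

lemma cut_kernel_pos: "\<rho> > 0 \<Longrightarrow> cut_kernel \<rho> x y > 0"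
  by (simp add: cut_kernel_def add_pos_nonneg)

lemma cut_kernel_le_newton_kernel:
  assumes "\<rho> > 0"
  shows "ennreal (cut_kernel \<rho> x y) \<le> ennreal (2 * pi\<^sup>2) * newton_kernel x y"
proof (cases "x = y")
  case True
  thus ?thesis by (simp add: newton_kernel_def ennreal_mult_top)
next
  case False
  hence "cut_kernel \<rho> x y \<le> 1 / (norm (x - y))\<^sup>2"
    unfolding cut_kernel_def by (intro divide_left_mono) (auto simp: add_nonneg_pos intro!: mult_pos_pos)
  also have "\<dots> = 2 * pi\<^sup>2 * (1 / (2 * pi\<^sup>2 * (norm (x - y))\<^sup>2))" by simp
  finally have "ennreal (cut_kernel \<rho> x y) \<le> ennreal (2 * pi\<^sup>2 * (1 / (2 * pi\<^sup>2 * (norm (x - y))\<^sup>2)))"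
    by (rule ennreal_leI)
  also have "\<dots> = ennreal (2 * pi\<^sup>2) * newton_kernel x y"
    using False by (subst ennreal_mult) (auto simp: newton_kernel_def inverse_ennreal inverse_eq_divide)
  finally show ?thesis .
qed

text \<open>The dual estimate: \<open>\<nu>\<close> is tested against \<open>u\<close> times the
  discrete measure with mass \<open>\<eta>\<close> at each \<open>x l\<close>. With \<open>v\<close>
  the mass and \<open>E\<close> the Newtonian energy of \<open>\<nu>\<close>, the cross-energy
  inequality reads 2 u P v \<le> 2 pi^2 E + u^2 W.\<close>

lemma energy_bound_potential:
  fixes x :: "'i \<Rightarrow> real ^ 4"
  assumes "\<rho> > 0" "P > 0" "\<eta> > 0" "finite L" "L \<noteq> {}" "D \<in> sets borel"
    and pot: "\<And>a. a \<in> D \<Longrightarrow> P \<le> (\<Sum>l\<in>L. \<eta> * cut_kernel \<rho> a (x l))"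
  defines "W \<equiv> \<Sum>k\<in>L. \<Sum>l\<in>L. \<eta>\<^sup>2 * cut_kernel \<rho> (x k) (x l)"
  shows "energy_bound D (2 * pi\<^sup>2 * W / P\<^sup>2)"
  unfolding energy_bound_def
proof (intro conjI allI impI)
  have W: "W > 0" unfolding W_def using assms by (intro sum_pos) (auto simp: cut_kernel_pos)
  show c: "0 < 2 * pi\<^sup>2 * W / P\<^sup>2" using assms W by simp
  show "D \<in> sets borel" by fact
  have [measurable]: "D \<in> sets borel" by fact
  fix \<nu> :: "(real ^ 4) measure"
  assume fin: "finite_measure \<nu>" and s[measurable_cong]: "sets \<nu> = sets borel" and null: "emeasure \<nu> (- D) = 0"
  interpret finite_measure \<nu> by fact
  have sp: "space \<nu> = UNIV" using sets_eq_imp_space_eq[OF s] by simp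
  have AE: "AE x in \<nu>. x \<in> D" by (rule AE_I[OF _ null]) (auto simp: s)
  have [measurable]: "(\<lambda>a. cut_kernel \<rho> a y) \<in> borel_measurable borel" for y
    unfolding cut_kernel_def by measurable
  define E where "E = (\<integral>\<^sup>+x. \<integral>\<^sup>+y. newton_kernel x y \<partial>\<nu> \<partial>\<nu>)"
  obtain v where v: "emeasure \<nu> UNIV = ennreal v" "v \<ge> 0"
    by (metis ennreal_cases emeasure_finite infinity_ennreal_def)
  \<comment> \<open>The maximiser of 2 u P v - u^2 W; its value there is P^2 v^2 / W.\<close>
  define u where "u = P * v / W"
  have u: "u \<ge> 0" using assms W v by (simp add: u_def)
  have "ennreal (2 * u * P * v) = 2 * (ennreal u * (\<integral>\<^sup>+a. ennreal P \<partial>\<nu>))"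
    using u v assms by (simp add: sp numeral_mult_ennreal mult.assoc flip: ennreal_mult)
  also have "\<dots> \<le> 2 * (ennreal u * (\<integral>\<^sup>+a. ennreal (\<Sum>l\<in>L. \<eta> * cut_kernel \<rho> a (x l)) \<partial>\<nu>))"
    using AE by (intro mult_left_mono nn_integral_mono_AE) (auto intro!: ennreal_leI pot)
  also have "(\<integral>\<^sup>+a. ennreal (\<Sum>l\<in>L. \<eta> * cut_kernel \<rho> a (x l)) \<partial>\<nu>)
     = (\<Sum>l\<in>L. ennreal \<eta> * (\<integral>\<^sup>+a. ennreal (cut_kernel \<rho> a (x l)) \<partial>\<nu>))"
    using assms cut_kernel_pos[OF \<open>\<rho> > 0\<close>]
    by (simp add: ennreal_mult less_imp_le nn_integral_sum nn_integral_cmult flip: sum_ennreal)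
  also have "ennreal u * \<dots> = (\<Sum>l\<in>L. ennreal (u * \<eta>) * (\<integral>\<^sup>+a. ennreal (cut_kernel \<rho> a (x l)) \<partial>\<nu>))"
    using u assms by (simp add: sum_distrib_left ennreal_mult mult.assoc)
  also have "2 * \<dots> \<le> (\<integral>\<^sup>+a. \<integral>\<^sup>+b. ennreal (cut_kernel \<rho> a b) \<partial>\<nu> \<partial>\<nu>)
      + (\<Sum>k\<in>L. \<Sum>l\<in>L. ennreal (u * \<eta>) * ennreal (u * \<eta>) * ennreal (cut_kernel \<rho> (x k) (x l)))"
    using u assms fin s by (intro cut_kernel_cross_energy) auto
  also have "(\<Sum>k\<in>L. \<Sum>l\<in>L. ennreal (u * \<eta>) * ennreal (u * \<eta>) * ennreal (cut_kernel \<rho> (x k) (x l))) = ennreal (u\<^sup>2 * W)"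
    using u assms cut_kernel_pos[OF \<open>\<rho> > 0\<close>] unfolding W_def
    by (simp add: less_imp_le sum_ennreal sum_nonneg sum_distrib_left power2_eq_square mult_ac flip: ennreal_mult)
  also have "(\<integral>\<^sup>+a. \<integral>\<^sup>+b. ennreal (cut_kernel \<rho> a b) \<partial>\<nu> \<partial>\<nu>) \<le> (\<integral>\<^sup>+a. \<integral>\<^sup>+b. ennreal (2 * pi\<^sup>2) * newton_kernel a b \<partial>\<nu> \<partial>\<nu>)"
    by (intro nn_integral_mono cut_kernel_le_newton_kernel assms(1))
  also have "\<dots> = ennreal (2 * pi\<^sup>2) * E"
    by (simp add: E_def nn_integral_cmult)
  finally have main: "ennreal (2 * u * P * v) \<le> ennreal (2 * pi\<^sup>2) * E + ennreal (u\<^sup>2 * W)" by simp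
  show "(emeasure \<nu> UNIV)\<^sup>2 \<le> ennreal (2 * pi\<^sup>2 * W / P\<^sup>2) * (\<integral>\<^sup>+x. \<integral>\<^sup>+y. newton_kernel x y \<partial>\<nu> \<partial>\<nu>)"
  proof (cases "E = top")
    case True thus ?thesis using c W assms(2) by (simp add: E_def[symmetric] ennreal_mult_top)
  next
    case False
    then obtain r where r: "E = ennreal r" "r \<ge> 0" by (metis ennreal_cases)
    have "2 * u * P * v \<le> 2 * pi\<^sup>2 * r + u\<^sup>2 * W"
      using main r W u by (simp flip: ennreal_plus ennreal_mult)
    hence "P\<^sup>2 * v\<^sup>2 / W \<le> 2 * pi\<^sup>2 * r"
      using W by (simp add: u_def power2_eq_square field_simps)
    hence "v\<^sup>2 \<le> 2 * pi\<^sup>2 * W / P\<^sup>2 * r"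
      using W assms by (simp add: field_simps)
    thus ?thesis using r c v unfolding E_def[symmetric]
      by (simp add: ennreal_power ennreal_leI flip: ennreal_mult)
  qed
qed

section \<open>Gaussian random walks\<close>

text \<open>The supermartingale inequality without filtrations: the joint law of the steps is a
  product measure, and the steps are integrated out one at a time, the last one first.
  \<open>G l\<close> is the value of the process at time \<open>l\<close> as a function of the first
  \<open>l\<close> steps.\<close>

lemma (in prob_space) nn_integral_indep_gauss_le:
  fixes X :: "nat \<Rightarrow> 'a \<Rightarrow> real ^ 4" and G :: "nat \<Rightarrow> (nat \<Rightarrow> real ^ 4) \<Rightarrow> ennreal"
  assumes \<tau>: "\<tau> > 0" and ind: "indep_vars (\<lambda>_. borel) X {..<N}"
    and law: "\<And>i. i < N \<Longrightarrow> distr M borel (X i) = gauss \<tau>"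
    and G: "\<And>l. l \<le> N \<Longrightarrow> G l \<in> borel_measurable (PiM {..<l} (\<lambda>_. borel))"
    and step: "\<And>l x. l < N \<Longrightarrow> (\<integral>\<^sup>+y. G (Suc l) (x(l := y)) \<partial>gauss \<tau>) \<le> G l x"
  shows "(\<integral>\<^sup>+\<omega>. G N (\<lambda>i\<in>{..<N}. X i \<omega>) \<partial>M) \<le> G 0 (\<lambda>_. undefined)"
\<comment> \<open>The characterisation of independence by product laws is for nonempty index
  sets.\<close>
proof (cases "N = 0")
  case True thus ?thesis by (simp add: restrict_def emeasure_space_1)
next
  case False
  have X[measurable]: "X i \<in> borel_measurable M" if "i < N" for i
    using ind that by (auto simp: indep_vars_def)
  interpret g: prob_space "gauss \<tau>" by (rule prob_space_gauss) fact
  interpret product_sigma_finite "\<lambda>_::nat. gauss \<tau>"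
    by standard
  have sets: "sets (PiM I (\<lambda>_. gauss \<tau>)) = sets (PiM I (\<lambda>_. borel))" for I :: "nat set"
    by (intro sets_PiM_cong) auto
  have *: "(\<integral>\<^sup>+x. G l x \<partial>PiM {..<l} (\<lambda>_. gauss \<tau>)) \<le> G 0 (\<lambda>_. undefined)" if "l \<le> N" for l
    using that
  proof (induction l)
    \<comment> \<open>The product over the empty index set is the point mass at
      \<open>\<lambda>_. undefined\<close>, the only point of its space.\<close>
    case 0 thus ?case by (simp add: PiM_empty nn_integral_count_space_finite)
  next
    case (Suc l)
    have "G (Suc l) \<in> borel_measurable (PiM (insert l {..<l}) (\<lambda>_. borel))"
      using G[OF Suc.prems] by (simp add: lessThan_Suc)
    hence "G (Suc l) \<in> borel_measurable (PiM (insert l {..<l}) (\<lambda>_. gauss \<tau>))"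
      using measurable_cong_sets[OF sets refl] by blast
    hence "(\<integral>\<^sup>+x. G (Suc l) x \<partial>PiM {..<Suc l} (\<lambda>_. gauss \<tau>))
        = (\<integral>\<^sup>+x. \<integral>\<^sup>+y. G (Suc l) (x(l := y)) \<partial>gauss \<tau> \<partial>PiM {..<l} (\<lambda>_. gauss \<tau>))"
      unfolding lessThan_Suc by (intro product_nn_integral_insert) auto
    also have "\<dots> \<le> (\<integral>\<^sup>+x. G l x \<partial>PiM {..<l} (\<lambda>_. gauss \<tau>))"
      using Suc.prems by (intro nn_integral_mono step) auto
    finally show ?case using Suc by simp
  qed
  have "(\<integral>\<^sup>+\<omega>. G N (\<lambda>i\<in>{..<N}. X i \<omega>) \<partial>M)
      = (\<integral>\<^sup>+x. G N x \<partial>distr M (PiM {..<N} (\<lambda>_. borel)) (\<lambda>\<omega>. \<lambda>i\<in>{..<N}. X i \<omega>))"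
    using G[of N] by (subst nn_integral_distr) auto
  also have "distr M (PiM {..<N} (\<lambda>_. borel)) (\<lambda>\<omega>. \<lambda>i\<in>{..<N}. X i \<omega>) = PiM {..<N} (\<lambda>i. distr M borel (X i))"
    using ind False X by (subst indep_vars_iff_distr_eq_PiM'[symmetric]) auto
  also have "\<dots> = PiM {..<N} (\<lambda>_. gauss \<tau>)"
    using law by (intro PiM_cong) auto
  finally show ?thesis using *[OF order_refl] by (simp only:)
qed

lemma sum_fun_upd_lessThan:
  "(\<Sum>i<k. (x(l := y)) i) = (\<Sum>i<k. x i) + (if l < k then y - x l else 0)"
  for x :: "nat \<Rightarrow> 'b::ab_group_add"
proof (induction k)
  case (Suc k) thus ?case by (cases "l < k"; cases "l = k") (auto simp: algebra_simps)
qed simp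

lemma measurable_partial_sum [measurable]:
  fixes k l :: nat
  assumes "k \<le> l"
  shows "(\<lambda>x. \<Sum>i<k. x i) \<in> borel_measurable (PiM {..<l} (\<lambda>_. borel :: (real ^ 4) measure))"
  using assms by (intro borel_measurable_sum measurable_component_singleton) auto

text \<open>A maximal inequality by stopping: \<open>G\<close> follows the martingale
  \<open>v\<close> along the walk until the first exit from the ball of radius \<open>R\<close>, and
  from then on is frozen at the level exp (\<kappa> R^2). Freezing can only lower the value, so
  \<open>G\<close> is a supermartingale, and Markov's inequality is applied to its terminal
  value.\<close>

lemma (in prob_space) gaussian_walk_maximal:
  fixes X :: "nat \<Rightarrow> 'a \<Rightarrow> real ^ 4"
  assumes \<tau>: "\<tau> > 0" and ind: "indep_vars (\<lambda>_. borel) X {..<N}"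
    and law: "\<And>i. i < N \<Longrightarrow> distr M borel (X i) = gauss \<tau>" and "N > 0" "R > 0"
  shows "emeasure M {\<omega> \<in> space M. \<exists>k\<le>N. R \<le> norm (\<Sum>i<k. X i \<omega>)} \<le> ennreal (4 * exp (- R\<^sup>2 / (4 * real N * \<tau>)))"
proof -
  \<comment> \<open>Half of the critical value 1 / (2 N \<tau>), at which the exponential moment of
    the squared norm of the final position becomes infinite.\<close>
  define \<kappa> where "\<kappa> = 1 / (4 * real N * \<tau>)"
  define v where "v l s = ennreal ((2 * N / (N + l))\<^sup>2 * exp (1 / (2 * \<tau> * (N + l)) * (norm s)\<^sup>2))" for l :: nat and s :: "real ^ 4"
  \<comment> \<open>\<open>v\<close> is the space-time harmonic function of the walk with terminal value \<open>exp (\<kappa> * (norm s)\<^sup>2)\<close>.\<close>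
  define G where "G l x = (if \<exists>k\<le>l. R \<le> norm (\<Sum>i<k. x i) then ennreal (exp (\<kappa> * R\<^sup>2)) else v l (\<Sum>i<l. x i))"
    for l and x :: "nat \<Rightarrow> real ^ 4"
  interpret g: prob_space "gauss \<tau>" by (rule prob_space_gauss) fact
  have X[measurable]: "X i \<in> borel_measurable M" if "i < N" for i
    using ind that by (auto simp: indep_vars_def)
  have "(\<integral>\<^sup>+\<omega>. G N (\<lambda>i\<in>{..<N}. X i \<omega>) \<partial>M) \<le> G 0 (\<lambda>_. undefined)"
  proof (rule nn_integral_indep_gauss_le[OF \<tau> ind law])
    fix l assume l: "l \<le> N"
    have [measurable]: "v l \<in> borel_measurable borel" unfolding v_def by measurable
    have "Measurable.pred (PiM {..<l} (\<lambda>_. borel :: (real ^ 4) measure)) (\<lambda>x. \<exists>k\<in>{..l}. R \<le> norm (\<Sum>i<k. x i))"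
      by (rule pred_intros_finite) (auto intro!: borel_measurable_le borel_measurable_norm measurable_partial_sum simp: pred_def)
    hence [measurable]: "Measurable.pred (PiM {..<l} (\<lambda>_. borel :: (real ^ 4) measure)) (\<lambda>x. \<exists>k\<le>l. R \<le> norm (\<Sum>i<k. x i))"
      by (simp add: Bex_def)
    show "G l \<in> borel_measurable (PiM {..<l} (\<lambda>_. borel))"
      unfolding G_def by measurable
  next
    fix l and x :: "nat \<Rightarrow> real ^ 4" assume l: "l < N"
    have pre: "(\<Sum>i<k. (x(l := y)) i) = (\<Sum>i<k. x i)" if "k \<le> l" for k y
      using that by (simp only: sum_fun_upd_lessThan) auto
    have last: "(\<Sum>i<Suc l. (x(l := y)) i) = (\<Sum>i<l. x i) + y" for y
      by (simp only: sum_fun_upd_lessThan) simp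
    show "(\<integral>\<^sup>+y. G (Suc l) (x(l := y)) \<partial>gauss \<tau>) \<le> G l x"
    proof (cases "\<exists>k\<le>l. R \<le> norm (\<Sum>i<k. x i)")
      case True
      then obtain k where k: "k \<le> l" "R \<le> norm (\<Sum>i<k. x i)" by blast
      have "\<exists>k\<le>Suc l. R \<le> norm (\<Sum>i<k. (x(l := y)) i)" for y
        using k pre by (intro exI[of _ k]) auto
      hence "G (Suc l) (x(l := y)) = ennreal (exp (\<kappa> * R\<^sup>2))" for y
        unfolding G_def by presburger
      thus ?thesis using True by (simp add: G_def g.emeasure_space_1[simplified])
    next
      case False
      have "G (Suc l) (x(l := y)) \<le> v (Suc l) ((\<Sum>i<l. x i) + y)" for y
      proof (cases "\<exists>k\<le>Suc l. R \<le> norm (\<Sum>i<k. (x(l := y)) i)")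
        case hit: True
        then obtain k where k: "k \<le> Suc l" "R \<le> norm (\<Sum>i<k. (x(l := y)) i)" by blast
        with False pre have "k = Suc l" by (metis le_SucE)
        hence R: "R\<^sup>2 \<le> (norm ((\<Sum>i<l. x i) + y))\<^sup>2"
          using k(2) \<open>R > 0\<close> unfolding last by (intro power_mono) auto
        have "\<kappa> \<le> 1 / (2 * \<tau> * (N + Suc l))"
          unfolding \<kappa>_def using l \<tau> by (intro divide_left_mono) auto
        hence "\<kappa> * R\<^sup>2 \<le> 1 / (2 * \<tau> * (N + Suc l)) * (norm ((\<Sum>i<l. x i) + y))\<^sup>2"
          using R \<tau> by (intro mult_mono) auto
        moreover have "1 \<le> (2 * N / (N + Suc l))\<^sup>2"
          using l by (intro one_le_power) auto
        ultimately have "1 * exp (\<kappa> * R\<^sup>2) \<le> (2 * N / (N + Suc l))\<^sup>2 * exp (1 / (2 * \<tau> * (N + Suc l)) * (norm ((\<Sum>i<l. x i) + y))\<^sup>2)"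
          by (intro mult_mono) auto
        thus ?thesis using hit unfolding G_def v_def by (simp add: ennreal_leI)
      next
        case False
        hence "G (Suc l) (x(l := y)) = v (Suc l) (\<Sum>i<Suc l. (x(l := y)) i)"
          unfolding G_def by (simp only: if_False)
        thus ?thesis by (simp only: last order_refl)
      qed
      hence "(\<integral>\<^sup>+y. G (Suc l) (x(l := y)) \<partial>gauss \<tau>) \<le> (\<integral>\<^sup>+y. v (Suc l) ((\<Sum>i<l. x i) + y) \<partial>gauss \<tau>)"
        by (intro nn_integral_mono)
      also have "\<dots> = v l (\<Sum>i<l. x i)"
      proof -
        define b where "b = 1 / (2 * \<tau> * (N + Suc l))"
        have "2 * b * \<tau> = 1 / (N + Suc l)" using \<tau> by (simp add: b_def)
        hence q: "1 - 2 * b * \<tau> = (N + l) / (N + Suc l)" by (simp add: field_simps)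
        have bq: "b * u / (1 - 2 * b * \<tau>) = 1 / (2 * \<tau> * (N + l)) * u" for u
        proof -
          have "1 / (2 * \<tau> * A) * u / (C / A) = 1 / (2 * \<tau> * C) * u" if "A > 0" "C > 0" for A C :: real
            using that \<tau> by (simp add: field_simps)
          from this[of "real (N + Suc l)" "real (N + l)"] show ?thesis
            unfolding q unfolding b_def using \<open>N > 0\<close> by simp
        qed
        have "0 < (N + l) / (N + Suc l)" using \<open>N > 0\<close> by simp
        hence less: "2 * b * \<tau> < 1" using q by linarith
        have "(\<integral>\<^sup>+y. v (Suc l) ((\<Sum>i<l. x i) + y) \<partial>gauss \<tau>)
          = ennreal ((2 * N / (N + Suc l))\<^sup>2) * (\<integral>\<^sup>+y. ennreal (exp (b * (norm ((\<Sum>i<l. x i) + y))\<^sup>2)) \<partial>gauss \<tau>)"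
          unfolding v_def b_def[symmetric] by (simp add: ennreal_mult nn_integral_cmult)
        also have "\<dots> = v l (\<Sum>i<l. x i)"
          unfolding nn_integral_exp_square_gauss[OF \<tau> less] bq unfolding q v_def using \<open>N > 0\<close>
          by (simp add: power_divide field_simps flip: ennreal_mult)
        finally show ?thesis .
      qed
      also have "v l (\<Sum>i<l. x i) = G l x"
        using False unfolding G_def by (simp only: if_False)
      finally show ?thesis .
    qed
  qed auto
  \<comment> \<open>Since \<open>R > 0\<close>, the walk has not exited at time 0, so this is v 0 0
    = (2 N / N)^2.\<close>
  also have "G 0 (\<lambda>_. undefined) = 4" using assms by (simp add: G_def v_def)
  finally have 1: "(\<integral>\<^sup>+\<omega>. G N (\<lambda>i\<in>{..<N}. X i \<omega>) \<partial>M) \<le> 4" .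
  let ?A = "{\<omega> \<in> space M. \<exists>k\<le>N. R \<le> norm (\<Sum>i<k. X i \<omega>)}"
  have "?A = (\<Union>k\<in>{..N}. {\<omega> \<in> space M. R \<le> norm (\<Sum>i<k. X i \<omega>)})" by auto
  also have "\<dots> \<in> sets M"
    by (intro sets.finite_UN borel_measurable_le borel_measurable_norm borel_measurable_sum) auto
  finally have [measurable]: "?A \<in> sets M" .
  have "ennreal (exp (\<kappa> * R\<^sup>2)) * emeasure M ?A = (\<integral>\<^sup>+\<omega>. ennreal (exp (\<kappa> * R\<^sup>2)) * indicator ?A \<omega> \<partial>M)"
    by (simp add: nn_integral_cmult_indicator)
  also have "\<dots> \<le> (\<integral>\<^sup>+\<omega>. G N (\<lambda>i\<in>{..<N}. X i \<omega>) \<partial>M)"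
  proof (intro nn_integral_mono)
    fix \<omega>
    have "(\<Sum>i<k. (\<lambda>i\<in>{..<N}. X i \<omega>) i) = (\<Sum>i<k. X i \<omega>)" if "k \<le> N" for k
      using that by (intro sum.cong) auto
    thus "ennreal (exp (\<kappa> * R\<^sup>2)) * indicator ?A \<omega> \<le> G N (\<lambda>i\<in>{..<N}. X i \<omega>)"
      unfolding G_def by (auto simp: indicator_def)
  qed
  finally have "ennreal (exp (\<kappa> * R\<^sup>2)) * emeasure M ?A \<le> 4" using 1 by simp
  hence "ennreal (exp (- (\<kappa> * R\<^sup>2))) * (ennreal (exp (\<kappa> * R\<^sup>2)) * emeasure M ?A) \<le> ennreal (exp (- (\<kappa> * R\<^sup>2))) * 4"
    by (intro mult_left_mono) auto
  also have "ennreal (exp (- (\<kappa> * R\<^sup>2))) * (ennreal (exp (\<kappa> * R\<^sup>2)) * emeasure M ?A) = emeasure M ?A"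
    by (simp add: mult.assoc[symmetric] flip: ennreal_mult exp_add)
  also have "ennreal (exp (- (\<kappa> * R\<^sup>2))) * 4 = ennreal (4 * exp (- R\<^sup>2 / (4 * real N * \<tau>)))"
    by (subst mult.commute) (simp add: \<kappa>_def ennreal_mult)
  finally show ?thesis .
qed

text \<open>The quadratic exponent \<open>b\<close> has to solve a discrete Riccati recursion, in
  the continuum - b' = a + 2 \<tau> b^2. Trying b = c / w with w = z + k gives a = (c - 2 \<tau>
  c^2) / w^2, which is largest at c = 1 / (4 \<tau>); hence the constants 4 and 8. The half-integer
  shift makes the discrete recursion exact. The normalising factor then grows only linearly in w, so
  the exponential moment is polynomial in the number of steps.\<close>

lemma (in prob_space) gaussian_walk_exp_occupation:
  fixes X :: "nat \<Rightarrow> 'a \<Rightarrow> real ^ 4"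
  assumes \<tau>: "\<tau> > 0" and ind: "indep_vars (\<lambda>_. borel) X {..<N}"
    and law: "\<And>i. i < N \<Longrightarrow> distr M borel (X i) = gauss \<tau>" and z: "z > 0"
  shows "(\<integral>\<^sup>+\<omega>. ennreal (exp (\<Sum>k\<le>N. (norm (\<Sum>i<k. X i \<omega>))\<^sup>2 / (8 * \<tau> * (z + k) * (z + k + 1/2)))) \<partial>M)
    \<le> ennreal ((z + N) / z)"
proof -
  \<comment> \<open>The weights satisfy \<open>b k = a k + b (Suc k) / (1 - 2 * b (Suc k) * \<tau>)\<close>, which makes \<open>G\<close> a supermartingale.\<close>
  define a where "a k = 1 / (8 * \<tau> * (z + real k) * (z + k + 1/2))" for k :: nat
  define b where "b k = 1 / (4 * \<tau> * (z + real k))" for k :: nat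
  define S where "S k x = (\<Sum>i<k. x i)" for k and x :: "nat \<Rightarrow> real ^ 4"
  define G where "G l x = ennreal (exp ((\<Sum>k<l. a k * (norm (S k x))\<^sup>2) + b l * (norm (S l x))\<^sup>2) / (z + l))"
    for l and x :: "nat \<Rightarrow> real ^ 4"
  have X[measurable]: "X i \<in> borel_measurable M" if "i < N" for i
    using ind that by (auto simp: indep_vars_def)
  have G: "G l \<in> borel_measurable (PiM {..<l} (\<lambda>_. borel))" for l
  proof -
    have [measurable]: "S k \<in> borel_measurable (PiM {..<l} (\<lambda>_. borel))" if "k \<le> l" for k
      unfolding S_def using that by measurable
    show ?thesis unfolding G_def by measurable
  qed
  have "(\<integral>\<^sup>+\<omega>. G N (\<lambda>i\<in>{..<N}. X i \<omega>) \<partial>M) \<le> G 0 (\<lambda>_. undefined)"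
  proof (rule nn_integral_indep_gauss_le[OF \<tau> ind law G])
    fix l and x :: "nat \<Rightarrow> real ^ 4" assume l: "l < N"
    have pre: "S k (x(l := y)) = S k x" if "k \<le> l" for k y
      using that unfolding S_def by (simp only: sum_fun_upd_lessThan) auto
    have last: "S (Suc l) (x(l := y)) = S l x + y" for y
      unfolding S_def by (simp only: sum_fun_upd_lessThan) simp
    define T where "T = (\<Sum>k<Suc l. a k * (norm (S k x))\<^sup>2)"
    have "(\<Sum>k<Suc l. a k * (norm (S k (x(l := y))))\<^sup>2) = T" for y
      unfolding T_def by (intro sum.cong) (auto simp: pre)
    hence "(\<integral>\<^sup>+y. G (Suc l) (x(l := y)) \<partial>gauss \<tau>)
      = (\<integral>\<^sup>+y. ennreal (exp T / (z + Suc l)) * ennreal (exp (b (Suc l) * (norm (S l x + y))\<^sup>2)) \<partial>gauss \<tau>)"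
      using z unfolding G_def last by (simp add: exp_add flip: ennreal_mult del: sum.lessThan_Suc)
    also have "\<dots> = ennreal (exp T / (z + Suc l)) * (\<integral>\<^sup>+y. ennreal (exp (b (Suc l) * (norm (S l x + y))\<^sup>2)) \<partial>gauss \<tau>)"
      by (rule nn_integral_cmult) measurable
    also have "(\<integral>\<^sup>+y. ennreal (exp (b (Suc l) * (norm (S l x + y))\<^sup>2)) \<partial>gauss \<tau>)
      = ennreal (exp (b (Suc l) * (norm (S l x))\<^sup>2 / (1 - 2 * b (Suc l) * \<tau>)) / (1 - 2 * b (Suc l) * \<tau>)\<^sup>2)"
    proof (intro nn_integral_exp_square_gauss)
      have "2 * b (Suc l) * \<tau> = 1 / (2 * (z + Suc l))" using \<tau> by (simp add: b_def)
      also have "\<dots> < 1" using z by simp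
      finally show "2 * b (Suc l) * \<tau> < 1" .
    qed fact
    also have "ennreal (exp T / (z + Suc l)) * \<dots>
      = ennreal (exp (T + b (Suc l) * (norm (S l x))\<^sup>2 / (1 - 2 * b (Suc l) * \<tau>)) * (1 / (z + Suc l) / (1 - 2 * b (Suc l) * \<tau>)\<^sup>2))"
      using z by (simp add: exp_add flip: ennreal_mult)
    also have "\<dots> \<le> G l x"
      unfolding G_def divide_inverse[of "exp _" "z + real l"]
    proof (intro ennreal_leI mult_mono)
      have "b (Suc l) / (1 - 2 * b (Suc l) * \<tau>) = 1 / (4 * \<tau> * (z + l + 1/2))"
      proof -
        have "2 * b (Suc l) * \<tau> = 1 / (2 * (z + l + 1))" using \<tau> by (simp add: b_def add.commute add.left_commute)
        hence "1 - 2 * b (Suc l) * \<tau> = (z + l + 1/2) / (z + l + 1)" using z by (simp add: field_simps)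
        moreover have "1 / (4 * \<tau> * A) / (C / A) = 1 / (4 * \<tau> * C)" if "A > 0" "C > 0" for A C :: real
          using that \<tau> by (simp add: field_simps)
        moreover have "b (Suc l) = 1 / (4 * \<tau> * (z + l + 1))" by (simp add: b_def add.commute add.left_commute)
        ultimately show ?thesis using z by simp
      qed
      moreover have "a l + 1 / (4 * \<tau> * (z + l + 1/2)) = b l"
      proof -
        have "z + l > 0" "z + l + 1/2 > 0" using z by auto
        thus ?thesis using \<tau> unfolding a_def b_def by (simp add: divide_simps) (simp add: algebra_simps)
      qed
      ultimately have "a l * u + b (Suc l) * u / (1 - 2 * b (Suc l) * \<tau>) = b l * u" for u
        by (metis distrib_right times_divide_eq_left)
      thus "exp (T + b (Suc l) * (norm (S l x))\<^sup>2 / (1 - 2 * b (Suc l) * \<tau>)) \<le> exp ((\<Sum>k<l. a k * (norm (S k x))\<^sup>2) + b l * (norm (S l x))\<^sup>2)"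
        by (simp add: T_def add.assoc)
      define w where "w = z + l"
      have w: "w > 0" using z by (simp add: w_def)
      have D: "1 - 2 * b (Suc l) * \<tau> = (w + 1/2) / (w + 1)"
      proof -
        have "2 * b (Suc l) * \<tau> = 1 / (2 * (w + 1))" using \<tau> by (simp add: b_def w_def add.commute add.left_commute)
        thus ?thesis using w by (simp add: field_simps)
      qed
      have "z + Suc l = w + 1" by (simp add: w_def)
      hence "1 / (z + Suc l) / (1 - 2 * b (Suc l) * \<tau>)\<^sup>2 = (w + 1) / (w + 1/2)\<^sup>2"
        unfolding D using w by (simp only:) (simp add: power_divide power2_eq_square)
      also have "\<dots> \<le> inverse w"
      proof -
        \<comment> \<open>The only loss in the supermartingale step; the exponents match
          exactly.\<close>
        have "(w + 1) * w \<le> (w + 1/2)\<^sup>2" by (simp add: power2_eq_square algebra_simps)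
        hence "(w + 1) * w / (w + 1/2)\<^sup>2 \<le> 1" using w by simp
        hence "(w + 1) * w / (w + 1/2)\<^sup>2 * inverse w \<le> 1 * inverse w" using w by (intro mult_right_mono) auto
        thus ?thesis using w by (simp add: mult.assoc)
      qed
      finally show "1 / (z + Suc l) / (1 - 2 * b (Suc l) * \<tau>)\<^sup>2 \<le> inverse (z + l)" by (simp add: w_def)
    qed (use z in auto)
    finally show "(\<integral>\<^sup>+y. G (Suc l) (x(l := y)) \<partial>gauss \<tau>) \<le> G l x" .
  qed auto
  also have "G 0 (\<lambda>_. undefined) = ennreal (1 / z)" using z by (simp add: G_def S_def)
  finally have 1: "(\<integral>\<^sup>+\<omega>. G N (\<lambda>i\<in>{..<N}. X i \<omega>) \<partial>M) \<le> ennreal (1 / z)" .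
  have "(\<integral>\<^sup>+\<omega>. ennreal (exp (\<Sum>k\<le>N. (norm (\<Sum>i<k. X i \<omega>))\<^sup>2 / (8 * \<tau> * (z + k) * (z + k + 1/2)))) \<partial>M)
     \<le> (\<integral>\<^sup>+\<omega>. ennreal (z + N) * G N (\<lambda>i\<in>{..<N}. X i \<omega>) \<partial>M)"
  proof (intro nn_integral_mono)
    fix \<omega>
    have S: "S k (\<lambda>i\<in>{..<N}. X i \<omega>) = (\<Sum>i<k. X i \<omega>)" if "k \<le> N" for k
      unfolding S_def using that by (intro sum.cong) auto
    have "(norm (\<Sum>i<k. X i \<omega>))\<^sup>2 / (8 * \<tau> * (z + k) * (z + k + 1/2)) = a k * (norm (\<Sum>i<k. X i \<omega>))\<^sup>2" for k
      by (simp add: a_def)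
    hence "(\<Sum>k\<le>N. (norm (\<Sum>i<k. X i \<omega>))\<^sup>2 / (8 * \<tau> * (z + k) * (z + k + 1/2)))
      = (\<Sum>k<N. a k * (norm (\<Sum>i<k. X i \<omega>))\<^sup>2) + a N * (norm (\<Sum>i<N. X i \<omega>))\<^sup>2"
      by (simp add: lessThan_Suc_atMost[symmetric])
    \<comment> \<open>The claimed sum contains the term k = N, while \<open>G N\<close> stops at N -
      1 and carries \<open>b N\<close> instead; \<open>b N\<close> dominates
      \<open>a N\<close>.\<close>
    also have "\<dots> \<le> (\<Sum>k<N. a k * (norm (\<Sum>i<k. X i \<omega>))\<^sup>2) + b N * (norm (\<Sum>i<N. X i \<omega>))\<^sup>2"
    proof -
      have "1 \<le> 2 * (z + N + 1/2)" using z by simp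
      moreover have "b N \<ge> 0" using z \<tau> by (simp add: b_def)
      ultimately have "b N / (2 * (z + N + 1/2)) \<le> b N / 1"
        by (intro divide_left_mono) auto
      moreover have "a N = b N / (2 * (z + N + 1/2))" by (simp add: a_def b_def)
      ultimately have "a N \<le> b N" by simp
      thus ?thesis by (simp add: mult_right_mono)
    qed
    also have "\<dots> = (\<Sum>k<N. a k * (norm (S k (\<lambda>i\<in>{..<N}. X i \<omega>)))\<^sup>2) + b N * (norm (S N (\<lambda>i\<in>{..<N}. X i \<omega>)))\<^sup>2"
      by (simp add: S)
    finally show "ennreal (exp (\<Sum>k\<le>N. (norm (\<Sum>i<k. X i \<omega>))\<^sup>2 / (8 * \<tau> * (z + k) * (z + k + 1/2))))
      \<le> ennreal (z + N) * G N (\<lambda>i\<in>{..<N}. X i \<omega>)"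
      unfolding G_def using z by (subst ennreal_mult[symmetric]) (auto intro!: ennreal_leI)
  qed
  also have "\<dots> = ennreal (z + N) * (\<integral>\<^sup>+\<omega>. G N (\<lambda>i\<in>{..<N}. X i \<omega>) \<partial>M)"
    by (intro nn_integral_cmult measurable_compose[OF _ G] measurable_restrict) auto
  also have "\<dots> \<le> ennreal (z + N) * ennreal (1 / z)"
    by (intro mult_left_mono 1) auto
  also have "\<dots> = ennreal ((z + N) / z)" using z by (subst ennreal_mult[symmetric]) auto
  finally show ?thesis .
qed

section \<open>Brownian motion on a time grid\<close>

text \<open>An instance of grouping independent variables into disjoint sets of indices, here the
  singletons \<open>{f j}\<close>.\<close>

lemma (in prob_space) indep_vars_reindex_inj:
  assumes "indep_vars M' X I" "inj_on f J" "f ` J \<subseteq> I"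
  shows "indep_vars (\<lambda>j. M' (f j)) (\<lambda>j. X (f j)) J"
proof -
  have "indep_vars (\<lambda>j. PiM {f j} M') (\<lambda>j \<omega>. restrict (\<lambda>i. X i \<omega>) {f j}) J"
    using assms by (intro indep_vars_restrict) (auto simp: disjoint_family_on_def inj_on_def)
  from indep_vars_compose2[OF this, of "\<lambda>j x. x (f j)" "\<lambda>j. M' (f j)"]
  show ?thesis by simp
qed

locale brownian_motion_4 = standard_brownian_motion M B
  for M :: "'w measure" and B :: "real \<Rightarrow> 'w \<Rightarrow> real ^ 4"
begin

lemma measurable_B [measurable (raw)]: "0 \<le> t \<Longrightarrow> B t \<in> borel_measurable M"
  by (rule measurable_at)

lemma distr_increment:
  assumes "0 \<le> s" "s < t"
  shows "distr M borel (\<lambda>\<omega>. B t \<omega> - B s \<omega>) = gauss (t - s)"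
proof -
  have "distr M lborel (\<lambda>\<omega>. B t \<omega> - B s \<omega>) = gauss (t - s)"
    using gaussian_increments[OF assms] unfolding distributed_def gauss_def by blast
  moreover have "distr M lborel (\<lambda>\<omega>. B t \<omega> - B s \<omega>) = distr M borel (\<lambda>\<omega>. B t \<omega> - B s \<omega>)"
    by (rule distr_cong) auto
  ultimately show ?thesis by simp
qed

lemma indep_forward_increments:
  fixes a \<tau> :: real and N :: nat
  assumes "0 \<le> a" "0 < \<tau>"
  shows "indep_vars (\<lambda>_. borel) (\<lambda>i \<omega>. B (a + Suc i * \<tau>) \<omega> - B (a + i * \<tau>) \<omega>) {..<N}"
  using assms by (intro indep_increments[of "\<lambda>i. a + real i * \<tau>"]) auto

text \<open>Time reversal: these are the forward increments started at
  \<open>a - N * \<tau>\<close>, listed in reverse order.\<close>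

lemma indep_backward_increments:
  fixes a \<tau> :: real and N :: nat
  assumes "real N * \<tau> \<le> a" "0 < \<tau>"
  shows "indep_vars (\<lambda>_. borel) (\<lambda>i \<omega>. B (a - i * \<tau>) \<omega> - B (a - Suc i * \<tau>) \<omega>) {..<N}"
proof -
  have "indep_vars (\<lambda>_. borel) (\<lambda>i \<omega>. B ((a - N * \<tau>) + Suc i * \<tau>) \<omega> - B ((a - N * \<tau>) + i * \<tau>) \<omega>) {..<N}"
    using assms by (intro indep_forward_increments) auto
  hence "indep_vars (\<lambda>_. borel) (\<lambda>i \<omega>. B ((a - N * \<tau>) + Suc (N - Suc i) * \<tau>) \<omega> - B ((a - N * \<tau>) + (N - Suc i) * \<tau>) \<omega>) {..<N}"
    by (rule indep_vars_reindex_inj[of _ _ _ "\<lambda>i. N - Suc i"]) (auto simp: inj_on_def)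
  moreover have "(a - N * \<tau>) + Suc (N - Suc i) * \<tau> = a - i * \<tau>" "(a - N * \<tau>) + (N - Suc i) * \<tau> = a - Suc i * \<tau>"
    if "i \<in> {..<N}" for i
    using that by (auto simp: algebra_simps of_nat_diff)
  ultimately show ?thesis
    by (subst indep_vars_cong[OF refl _ refl, where Y = "\<lambda>i \<omega>. B ((a - N * \<tau>) + Suc (N - Suc i) * \<tau>) \<omega> - B ((a - N * \<tau>) + (N - Suc i) * \<tau>) \<omega>"])
       (simp_all only:)
qed

lemma prob_grid_maximal:
  fixes a \<tau> R :: real and N :: nat
  assumes "0 \<le> a" "0 < \<tau>" "0 < N" "0 < R"
  shows "prob {\<omega> \<in> space M. \<exists>k\<le>N. R \<le> norm (B (a + real k * \<tau>) \<omega> - B a \<omega>)} \<le> 4 * exp (- R\<^sup>2 / (4 * real N * \<tau>))"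
proof -
  let ?X = "\<lambda>i \<omega>. B (a + Suc i * \<tau>) \<omega> - B (a + i * \<tau>) \<omega>"
  have sum: "(\<Sum>i<k. ?X i \<omega>) = B (a + real k * \<tau>) \<omega> - B a \<omega>" for k \<omega>
    using sum_lessThan_telescope[of "\<lambda>i. B (a + real i * \<tau>) \<omega>" k] by simp
  have "distr M borel (?X i) = gauss \<tau>" for i
    using distr_increment[of "a + i * \<tau>" "a + Suc i * \<tau>"] assms by (simp add: algebra_simps)
  from gaussian_walk_maximal[OF assms(2) indep_forward_increments[OF assms(1,2)] this assms(3,4)]
  show ?thesis unfolding sum by (simp add: measure_def enn2real_leI)
qed

lemma exp_occupation_forward:
  fixes a \<tau> z :: real and N :: nat
  assumes "0 \<le> a" "0 < \<tau>" "0 < z"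
  shows "(\<integral>\<^sup>+\<omega>. ennreal (exp (\<Sum>k\<le>N. (norm (B (a + real k * \<tau>) \<omega> - B a \<omega>))\<^sup>2 / (8 * \<tau> * (z + real k) * (z + real k + 1/2)))) \<partial>M)
    \<le> ennreal ((z + N) / z)"
proof -
  let ?X = "\<lambda>i \<omega>. B (a + Suc i * \<tau>) \<omega> - B (a + i * \<tau>) \<omega>"
  have sum: "(\<Sum>i<k. ?X i \<omega>) = B (a + real k * \<tau>) \<omega> - B a \<omega>" for k \<omega>
    using sum_lessThan_telescope[of "\<lambda>i. B (a + real i * \<tau>) \<omega>" k] by simp
  have "distr M borel (?X i) = gauss \<tau>" for i
    using distr_increment[of "a + i * \<tau>" "a + Suc i * \<tau>"] assms by (simp add: algebra_simps)
  from gaussian_walk_exp_occupation[OF assms(2) indep_forward_increments[OF assms(1,2)] this assms(3)]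
  show ?thesis unfolding sum .
qed

lemma exp_occupation_backward:
  fixes a \<tau> z :: real and N :: nat
  assumes "real N * \<tau> \<le> a" "0 < \<tau>" "0 < z"
  shows "(\<integral>\<^sup>+\<omega>. ennreal (exp (\<Sum>k\<le>N. (norm (B (a - real k * \<tau>) \<omega> - B a \<omega>))\<^sup>2 / (8 * \<tau> * (z + real k) * (z + real k + 1/2)))) \<partial>M)
    \<le> ennreal ((z + N) / z)"
proof -
  let ?X = "\<lambda>i \<omega>. B (a - i * \<tau>) \<omega> - B (a - Suc i * \<tau>) \<omega>"
  have sum: "(\<Sum>i<k. ?X i \<omega>) = B a \<omega> - B (a - real k * \<tau>) \<omega>" for k \<omega>
    using sum_lessThan_telescope'[of "\<lambda>i. B (a - real i * \<tau>) \<omega>" k] by simp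
  have law: "distr M borel (?X i) = gauss \<tau>" if "i < N" for i
  proof -
    have "Suc i * \<tau> \<le> N * \<tau>" using that assms by (intro mult_right_mono) auto
    thus ?thesis
      using distr_increment[of "a - Suc i * \<tau>" "a - i * \<tau>"] assms by (simp add: algebra_simps)
  qed
  from gaussian_walk_exp_occupation[OF assms(2) indep_backward_increments[OF assms(1,2)] law assms(3)]
  show ?thesis unfolding sum by (subst norm_minus_commute)
qed

lemma nn_integral_inverse_square:
  assumes "s > (0::real)"
  shows "(\<integral>\<^sup>+\<beta>. ennreal (1 / (1 + 2 * \<beta> * s)\<^sup>2) * indicator {0..} \<beta> \<partial>lborel) = ennreal (1 / (2 * s))"
proof -
  have "(\<integral>\<^sup>+\<beta>. ennreal (1 / (1 + 2 * \<beta> * s)\<^sup>2) * indicator {0..} \<beta> \<partial>lborel)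
    = ennreal (0 - (- 1 / (2 * s * (1 + 2 * 0 * s))))"
  proof (rule nn_integral_FTC_atLeast)
    show "((\<lambda>\<beta>. - 1 / (2 * s * (1 + 2 * \<beta> * s))) \<longlongrightarrow> 0) at_top" using assms by real_asymp
    fix x :: real assume "0 \<le> x"
    hence pos: "1 + 2 * x * s > 0" using assms by (simp add: add_pos_nonneg)
    show "((\<lambda>\<beta>. - 1 / (2 * s * (1 + 2 * \<beta> * s))) has_real_derivative 1 / (1 + 2 * x * s)\<^sup>2) (at x)"
      using assms pos
      by (auto intro!: derivative_eq_intros simp: power2_eq_square)
  qed auto
  thus ?thesis by simp
qed

text \<open>Dropping the factor exp (- \<beta> \<rho>^2) removes the cut-off. The Laplace transform
  of the squared increment is (1 + 2 \<beta> (t - s))^(-2) in dimension four, and its integral over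
  \<open>\<beta>\<close> is the mean of the inverse squared distance.\<close>

lemma expectation_cut_kernel_le:
  assumes "0 \<le> s" "s < t" "\<rho> > 0"
  shows "(\<integral>\<^sup>+\<omega>. ennreal (cut_kernel \<rho> (B t \<omega>) (B s \<omega>)) \<partial>M) \<le> ennreal (1 / (2 * (t - s)))"
proof -
  have [measurable]: "B t \<in> borel_measurable M" "B s \<in> borel_measurable M" using assms by auto
  interpret P: pair_sigma_finite lborel M
    by (simp add: lborel.sigma_finite_measure_axioms sigma_finite_measure_axioms pair_sigma_finite.intro)
  have *: "ennreal (exp (- \<beta> * \<rho>\<^sup>2)) * indicator {0<..} \<beta> * ennreal (exp (- \<beta> * u))
      \<le> ennreal (exp (- \<beta> * u)) * indicator {0..} \<beta>" for \<beta> u :: real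
  proof (cases "\<beta> > 0")
    case True
    hence "ennreal (exp (- \<beta> * \<rho>\<^sup>2)) \<le> 1" by simp
    hence "ennreal (exp (- \<beta> * \<rho>\<^sup>2)) * ennreal (exp (- \<beta> * u)) \<le> 1 * ennreal (exp (- \<beta> * u))"
      by (intro mult_right_mono) auto
    thus ?thesis using True by simp
  qed simp
  have "(\<integral>\<^sup>+\<omega>. ennreal (cut_kernel \<rho> (B t \<omega>) (B s \<omega>)) \<partial>M)
    \<le> (\<integral>\<^sup>+\<omega>. \<integral>\<^sup>+\<beta>. ennreal (exp (- \<beta> * (norm (B t \<omega> - B s \<omega>))\<^sup>2)) * indicator {0..} \<beta> \<partial>lborel \<partial>M)"
    unfolding cut_kernel_integral[OF \<open>\<rho> > 0\<close>] by (intro nn_integral_mono *)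
  also have "\<dots> = (\<integral>\<^sup>+\<beta>. \<integral>\<^sup>+\<omega>. ennreal (exp (- \<beta> * (norm (B t \<omega> - B s \<omega>))\<^sup>2)) * indicator {0..} \<beta> \<partial>M \<partial>lborel)"
    by (rule P.Fubini') measurable
  also have "\<dots> = (\<integral>\<^sup>+\<beta>. ennreal (1 / (1 + 2 * \<beta> * (t - s))\<^sup>2) * indicator {0..} \<beta> \<partial>lborel)"
  proof (intro nn_integral_cong)
    fix \<beta> :: real
    show "(\<integral>\<^sup>+\<omega>. ennreal (exp (- \<beta> * (norm (B t \<omega> - B s \<omega>))\<^sup>2)) * indicator {0..} \<beta> \<partial>M)
      = ennreal (1 / (1 + 2 * \<beta> * (t - s))\<^sup>2) * indicator {0..} \<beta>"
    proof (cases "\<beta> \<ge> 0")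
      case True
      have "(\<integral>\<^sup>+\<omega>. ennreal (exp (- \<beta> * (norm (B t \<omega> - B s \<omega>))\<^sup>2)) \<partial>M)
        = (\<integral>\<^sup>+y. ennreal (exp (- \<beta> * (norm y)\<^sup>2)) \<partial>distr M borel (\<lambda>\<omega>. B t \<omega> - B s \<omega>))"
        by (subst nn_integral_distr) auto
      also have "\<dots> = (\<integral>\<^sup>+y. ennreal (exp (- \<beta> * (norm (0 + y))\<^sup>2)) \<partial>gauss (t - s))"
        using assms by (simp add: distr_increment)
      also have "\<dots> = ennreal (1 / (1 + 2 * \<beta> * (t - s))\<^sup>2)"
        using True assms mult_nonneg_nonneg[of \<beta> "t - s"]
        by (subst nn_integral_exp_square_gauss) (auto simp: algebra_simps)
      finally show ?thesis using True by simp
    qed simp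
  qed
  also have "\<dots> = ennreal (1 / (2 * (t - s)))"
    using assms by (intro nn_integral_inverse_square) auto
  finally show ?thesis .
qed

end

section \<open>Capacity bound for one block of the path\<close>

lemma ln_le_sum_inverse:
  fixes z :: real
  assumes "z \<ge> 0"
  shows "ln ((z + N + 1) / (z + 1)) \<le> (\<Sum>l\<in>{1..N}. 1 / (z + real l))"
proof (induction N)
  case 0 thus ?case using assms by simp
next
  case (Suc N)
  define x where "x = z + real (Suc N)"
  have x: "x > 0" using assms by (simp add: x_def)
  have "ln ((x + 1) / x) \<le> (x + 1) / x - 1" using x by (intro ln_le_minus_one) auto
  also have "\<dots> = 1 / x" using x by (simp add: field_simps)
  finally have "ln (x + 1) - ln x \<le> 1 / x" using x by (simp add: ln_div)
  moreover have "ln ((z + N + 1) / (z + 1)) = ln x - ln (z + 1)"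
    using x assms by (simp add: x_def ln_div add_ac)
  moreover have "ln ((z + Suc N + 1) / (z + 1)) = ln (x + 1) - ln (z + 1)"
    using x assms by (simp add: x_def ln_div add_ac)
  ultimately show ?case using Suc by (simp add: x_def)
qed

lemma sum_inverse_squares_le:
  fixes z :: real
  assumes "z > 0"
  shows "(\<Sum>l\<in>{1..N}. 1 / (z + real l)\<^sup>2) \<le> 1 / z"
proof -
  have "(\<Sum>l\<in>{1..N}. 1 / (z + real l)\<^sup>2) \<le> 1 / z - 1 / (z + N)"
  proof (induction N)
    case (Suc N)
    define x where "x = z + N"
    have x: "x > 0" using assms by (simp add: x_def)
    have "1 / (x + 1)\<^sup>2 \<le> 1 / (x * (x + 1))"
      using x by (intro divide_left_mono) (auto simp: power2_eq_square intro!: mult_right_mono)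
    also have "\<dots> = 1 / x - 1 / (x + 1)" using x by (simp add: field_simps)
    finally show ?case using Suc by (simp add: x_def add_ac)
  qed simp
  also have "\<dots> \<le> 1 / z" using assms by simp
  finally show ?thesis .
qed

text \<open>A block consists of \<open>2 * m\<^sup>2\<close> pieces of duration \<open>\<eta>\<close>, each sampled at \<open>p\<close> points: \<open>b (k * p + j)\<close> is
  the position at time \<open>k * \<eta> + j * \<eta> / p\<close>. From piece \<open>k\<close> one looks forward in the first half of the block and
  backward in the second half, so that \<open>m\<^sup>2\<close> steps never leave the block.\<close>

definition partner :: "nat \<Rightarrow> nat \<Rightarrow> nat \<Rightarrow> nat" where
  "partner m k l = (if k < m\<^sup>2 then k + l else k - l)"

text \<open>The exponent of \<open>gaussian_walk_exp_occupation\<close> for steps of duration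
  \<open>\<eta>\<close> and z = m, the number of steps in the cut-off time m \<eta>. It is large
  when the path strays far from \<open>b (k * p)\<close> over many scales, which is when the
  potential there is small.\<close>

definition occupation_defect :: "nat \<Rightarrow> real \<Rightarrow> nat \<Rightarrow> (nat \<Rightarrow> real ^ 4) \<Rightarrow> nat \<Rightarrow> real" where
  "occupation_defect m \<eta> p b k
    = (\<Sum>l\<le>m\<^sup>2. (norm (b (partner m k l * p) - b (k * p)))\<^sup>2 / (8 * \<eta> * (real m + real l) * (real m + real l + 1/2)))"

text \<open>The first condition puts every sample within half the cut-off distance of the start of
  its piece. The other half leaves room for the radius of the balls.\<close>

definition good_block :: "nat \<Rightarrow> real \<Rightarrow> real \<Rightarrow> nat \<Rightarrow> (nat \<Rightarrow> real ^ 4) \<Rightarrow> bool" where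
  "good_block m \<eta> y p b \<longleftrightarrow> (\<forall>k<2 * m\<^sup>2.
     (\<forall>j<p. norm (b (k * p + j) - b (k * p)) < sqrt (m * \<eta>) / 2) \<and> occupation_defect m \<eta> p b k < y)"

definition block_energy :: "nat \<Rightarrow> real \<Rightarrow> nat \<Rightarrow> (nat \<Rightarrow> real ^ 4) \<Rightarrow> real" where
  "block_energy m \<eta> p b
    = (\<Sum>k<2 * m\<^sup>2. \<Sum>l<2 * m\<^sup>2. \<eta>\<^sup>2 * cut_kernel (sqrt (m * \<eta>)) (b (k * p)) (b (l * p)))"

definition block_radius :: "nat \<Rightarrow> nat \<Rightarrow> (nat \<Rightarrow> real ^ 4) \<Rightarrow> real" where
  "block_radius m p b = Max ((\<lambda>l. norm (b l - b 0)) ` {..<2 * m\<^sup>2 * p})"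

text \<open>What Cauchy-Schwarz yields: the harmonic sum is at least ln m, the cut-off costs 3 and
  the defect 24 y. For \<open>y\<close> of order ln m this is again of order ln m.\<close>

definition block_potential :: "nat \<Rightarrow> real \<Rightarrow> real" where
  "block_potential m y = (ln m)\<^sup>2 / (3 + 24 * y)"

definition block_cap :: "real \<Rightarrow> nat \<Rightarrow> real \<Rightarrow> real \<Rightarrow> nat \<Rightarrow> (nat \<Rightarrow> real ^ 4) \<Rightarrow> real" where
  "block_cap r m \<eta> y p b = (if good_block m \<eta> y p b
     then 2 * pi\<^sup>2 * block_energy m \<eta> p b / (block_potential m y)\<^sup>2
     else 8 * pi\<^sup>2 * (2 * r + block_radius m p b)\<^sup>2)"

lemma partner_less: "k < 2 * m\<^sup>2 \<Longrightarrow> l \<le> m\<^sup>2 \<Longrightarrow> partner m k l < 2 * m\<^sup>2"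
  by (auto simp: partner_def)

lemma inj_on_partner: "inj_on (partner m k) {..m\<^sup>2}"
  by (auto simp: partner_def inj_on_def)

lemma block_radius_ge: "l < 2 * m\<^sup>2 * p \<Longrightarrow> norm (b l - b 0) \<le> block_radius m p b"
  unfolding block_radius_def by (intro Max_ge) auto

text \<open>Moves the observation point from anywhere in the \<open>\<rho>\<close>-ball about
  \<open>x\<close> to \<open>x\<close> itself, at the price of constants, by (u + v)^2 \<le> 2 u^2 +
  2 v^2.\<close>

lemma cut_kernel_ge:
  assumes "norm (a - x) \<le> \<rho>" "\<rho> > 0"
  shows "1 / (3 * \<rho>\<^sup>2 + 2 * (norm (w - x))\<^sup>2) \<le> cut_kernel \<rho> a w"
proof -
  have "norm (a - w) \<le> norm (a - x) + norm (w - x)"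
    using norm_triangle_ineq4[of "a - x" "w - x"] by simp
  hence "(norm (a - w))\<^sup>2 \<le> (norm (a - x) + norm (w - x))\<^sup>2"
    by (intro power_mono) auto
  also have "\<dots> \<le> 2 * (norm (a - x))\<^sup>2 + 2 * (norm (w - x))\<^sup>2"
    using sum_squares_bound[of "norm (a - x)" "norm (w - x)"] by (simp add: power2_sum)
  also have "(norm (a - x))\<^sup>2 \<le> \<rho>\<^sup>2" using assms by (intro power_mono) auto
  finally have "\<rho>\<^sup>2 + (norm (a - w))\<^sup>2 \<le> 3 * \<rho>\<^sup>2 + 2 * (norm (w - x))\<^sup>2" by simp
  moreover have "\<rho>\<^sup>2 + (norm (a - w))\<^sup>2 > 0" using assms by (simp add: add_pos_nonneg)
  ultimately show ?thesis unfolding cut_kernel_def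
    by (intro divide_left_mono) (auto intro!: mult_pos_pos)
qed

text \<open>The Cauchy--Schwarz step: a large potential is forced by a small value of
  \<open>\<Sum> u l / (\<eta> * (z + l)\<^sup>2)\<close>, whose exponential moments are explicit.\<close>

lemma harmonic_square_le:
  fixes u :: "nat \<Rightarrow> real" and z \<eta> :: real
  assumes "\<eta> > 0" "z > 0" "\<And>l. l \<in> A \<Longrightarrow> u l > 0"
  shows "(\<Sum>l\<in>A. 1 / (z + real l))\<^sup>2 \<le> (\<Sum>l\<in>A. \<eta> / u l) * (\<Sum>l\<in>A. u l / (\<eta> * (z + real l)\<^sup>2))"
proof -
  have "(\<Sum>l\<in>A. sqrt (\<eta> / u l) * (sqrt (u l / \<eta>) / (z + real l)))\<^sup>2
     \<le> (\<Sum>l\<in>A. (sqrt (\<eta> / u l))\<^sup>2) * (\<Sum>l\<in>A. (sqrt (u l / \<eta>) / (z + real l))\<^sup>2)"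
    by (rule Cauchy_Schwarz_ineq_sum)
  also have "(\<Sum>l\<in>A. sqrt (\<eta> / u l) * (sqrt (u l / \<eta>) / (z + real l))) = (\<Sum>l\<in>A. 1 / (z + real l))"
    using assms(1,3) by (intro sum.cong refl) (simp add: real_sqrt_divide less_imp_neq[THEN not_sym])
  also have "(\<Sum>l\<in>A. (sqrt (\<eta> / u l))\<^sup>2) = (\<Sum>l\<in>A. \<eta> / u l)"
    using assms by (intro sum.cong refl) (simp add: less_imp_le)
  also have "(\<Sum>l\<in>A. (sqrt (u l / \<eta>) / (z + real l))\<^sup>2) = (\<Sum>l\<in>A. u l / (\<eta> * (z + real l)\<^sup>2))"
    using assms by (intro sum.cong refl) (simp add: less_imp_le power_divide)
  finally show ?thesis .
qed

text \<open>Only the partners of \<open>k\<close> at distances 1 to m^2 are kept. Their kernels are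
  at least 1 / u l, and \<open>harmonic_square_le\<close> is applied to these \<open>u\<close>. In
  the weighted sum, the cut-off part contributes 3 m times the tail of the inverse squares beyond m,
  hence at most 3, and the displacements contribute a multiple of the defect.\<close>

lemma block_potential_le:
  assumes m: "m \<ge> 2" and \<eta>: "\<eta> > 0" and k: "k < 2 * m\<^sup>2"
    and occ: "occupation_defect m \<eta> p b k < y" and a: "norm (a - b (k * p)) \<le> sqrt (m * \<eta>)"
  shows "block_potential m y \<le> (\<Sum>l<2 * m\<^sup>2. \<eta> * cut_kernel (sqrt (m * \<eta>)) a (b (l * p)))"
proof -
  define d where "d l = norm (b (partner m k l * p) - b (k * p))" for l
  define u where "u l = 3 * (m * \<eta>) + 2 * (d l)\<^sup>2" for l
  define \<rho> where "\<rho> = sqrt (m * \<eta>)"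
  have \<rho>: "\<rho> > 0" "\<rho>\<^sup>2 = m * \<eta>" using m \<eta> by (auto simp: \<rho>_def)
  have u: "u l > 0" for l using m \<eta> unfolding u_def by (intro add_pos_nonneg) auto
  have occ': "occupation_defect m \<eta> p b k = (\<Sum>l\<le>m\<^sup>2. (d l)\<^sup>2 / (8 * \<eta> * (real m + real l) * (real m + real l + 1/2)))"
    by (simp add: occupation_defect_def d_def)
  have occ0: "0 \<le> occupation_defect m \<eta> p b k"
    unfolding occ' using \<eta> by (intro sum_nonneg) auto
  have "(\<Sum>l\<in>{1..m\<^sup>2}. \<eta> / u l) \<le> (\<Sum>l\<in>{1..m\<^sup>2}. \<eta> * cut_kernel \<rho> a (b (partner m k l * p)))"
  proof (intro sum_mono)
    fix l
    have "1 / u l \<le> cut_kernel \<rho> a (b (partner m k l * p))"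
      using cut_kernel_ge[OF a[folded \<rho>_def] \<rho>(1), of "b (partner m k l * p)"] by (simp add: u_def d_def \<rho>)
    thus "\<eta> / u l \<le> \<eta> * cut_kernel \<rho> a (b (partner m k l * p))"
      using \<eta> mult_left_mono[of "1 / u l" _ \<eta>] by simp
  qed
  also have "\<dots> = (\<Sum>l\<in>partner m k ` {1..m\<^sup>2}. \<eta> * cut_kernel \<rho> a (b (l * p)))"
    by (subst sum.reindex) (auto intro: inj_on_subset[OF inj_on_partner])
  also have "\<dots> \<le> (\<Sum>l<2 * m\<^sup>2. \<eta> * cut_kernel \<rho> a (b (l * p)))"
    using partner_less[OF k] \<eta> cut_kernel_pos[OF \<rho>(1)]
    by (intro sum_mono2) (auto simp: less_imp_le)
  finally have 1: "(\<Sum>l\<in>{1..m\<^sup>2}. \<eta> / u l) \<le> (\<Sum>l<2 * m\<^sup>2. \<eta> * cut_kernel \<rho> a (b (l * p)))" .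
  have "(\<Sum>l\<in>{1..m\<^sup>2}. u l / (\<eta> * (real m + real l)\<^sup>2))
     \<le> (\<Sum>l\<in>{1..m\<^sup>2}. 3 * m * (1 / (real m + real l)\<^sup>2) + 24 * ((d l)\<^sup>2 / (8 * \<eta> * (real m + real l) * (real m + real l + 1/2))))"
  proof (intro sum_mono)
    fix l
    define z where "z = real m + real l"
    have z: "z \<ge> 1" using m by (simp add: z_def)
    \<comment> \<open>As z \<ge> 1, z + 1/2 \<le> 3/2 z: this is the origin of 24 = 2 * 12 with 12 =
      8 * 3/2.\<close>
    have "2 / (\<eta> * z\<^sup>2) \<le> 24 / (8 * \<eta> * z * (z + 1/2))"
    proof -
      have "2 / (\<eta> * z\<^sup>2) = 24 / (12 * \<eta> * z * z)" by (simp add: power2_eq_square)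
      also have "8 * \<eta> * z * (z + 1/2) \<le> 8 * \<eta> * z * (3/2 * z)" using z \<eta> by (intro mult_left_mono) auto
      hence "24 / (12 * \<eta> * z * z) \<le> 24 / (8 * \<eta> * z * (z + 1/2))"
        using z \<eta> by (intro divide_left_mono) auto
      finally show ?thesis .
    qed
    hence "2 / (\<eta> * z\<^sup>2) * (d l)\<^sup>2 \<le> 24 / (8 * \<eta> * z * (z + 1/2)) * (d l)\<^sup>2"
      by (intro mult_right_mono) auto
    moreover have "u l / (\<eta> * z\<^sup>2) = 3 * m * (1 / z\<^sup>2) + 2 / (\<eta> * z\<^sup>2) * (d l)\<^sup>2"
      using \<eta> z by (simp add: u_def field_simps)
    ultimately show "u l / (\<eta> * (real m + real l)\<^sup>2) \<le> 3 * m * (1 / (real m + real l)\<^sup>2)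
      + 24 * ((d l)\<^sup>2 / (8 * \<eta> * (real m + real l) * (real m + real l + 1/2)))"
      by (simp add: z_def)
  qed
  also have "\<dots> = 3 * m * (\<Sum>l\<in>{1..m\<^sup>2}. 1 / (real m + real l)\<^sup>2)
      + 24 * (\<Sum>l\<in>{1..m\<^sup>2}. (d l)\<^sup>2 / (8 * \<eta> * (real m + real l) * (real m + real l + 1/2)))"
    by (simp add: sum.distrib sum_distrib_left)
  also have "\<dots> \<le> 3 * m * (1 / m) + 24 * occupation_defect m \<eta> p b k"
    unfolding occ' using m \<eta>
    by (intro add_mono mult_left_mono sum_inverse_squares_le sum_mono2) auto
  also have "\<dots> \<le> 3 + 24 * y" using occ m by simp
  finally have 2: "(\<Sum>l\<in>{1..m\<^sup>2}. u l / (\<eta> * (real m + real l)\<^sup>2)) \<le> 3 + 24 * y" .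
  \<comment> \<open>Summing 1 / (m + l) over m^2 steps covers a full factor m of time scales, hence
    a logarithm ln m.\<close>
  have "real m \<le> (real m + m\<^sup>2 + 1) / (real m + 1)"
    by (simp add: field_simps power2_eq_square)
  hence "ln m \<le> ln ((real m + m\<^sup>2 + 1) / (real m + 1))"
    using m by (subst ln_le_cancel_iff) (auto intro!: divide_pos_pos add_nonneg_pos)
  also have "\<dots> \<le> (\<Sum>l\<in>{1..m\<^sup>2}. 1 / (real m + real l))"
    using ln_le_sum_inverse[of "real m" "m\<^sup>2"] by simp
  finally have "(ln m)\<^sup>2 \<le> (\<Sum>l\<in>{1..m\<^sup>2}. 1 / (real m + real l))\<^sup>2"
    using m by (intro power_mono) auto
  also have "\<dots> \<le> (\<Sum>l\<in>{1..m\<^sup>2}. \<eta> / u l) * (\<Sum>l\<in>{1..m\<^sup>2}. u l / (\<eta> * (real m + real l)\<^sup>2))"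
    using m \<eta> u by (intro harmonic_square_le) auto
  also have "\<dots> \<le> (\<Sum>l\<in>{1..m\<^sup>2}. \<eta> / u l) * (3 + 24 * y)"
    using 2 u \<eta> by (intro mult_left_mono sum_nonneg) (auto simp: less_imp_le)
  finally have "block_potential m y \<le> (\<Sum>l\<in>{1..m\<^sup>2}. \<eta> / u l)"
    unfolding block_potential_def using occ occ0 by (simp add: divide_le_eq)
  thus ?thesis using 1 by (simp add: \<rho>_def)
qed

text \<open>The radius is 2 r rather than r to absorb the error of sampling the path. On a good
  block, 2 r and the displacement within a piece are each at most half the cut-off distance, so the
  potential bound holds on all the balls; otherwise a ball about the first sample is used.\<close>

lemma energy_bound_block:
  assumes m: "m \<ge> 2" and \<eta>: "\<eta> > 0" and p: "p > 0" and r: "r > 0" "4 * r \<le> sqrt (m * \<eta>)" and y: "y \<ge> 0"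
  shows "energy_bound (\<Union>l<2 * m\<^sup>2 * p. ball (b l) (2 * r)) (block_cap r m \<eta> y p b)"
proof (cases "good_block m \<eta> y p b")
  case True
  have ln: "ln m > 0" using m by simp
  have "energy_bound (\<Union>l<2 * m\<^sup>2 * p. ball (b l) (2 * r))
    (2 * pi\<^sup>2 * (\<Sum>k\<in>{..<2 * m\<^sup>2}. \<Sum>l\<in>{..<2 * m\<^sup>2}. \<eta>\<^sup>2 * cut_kernel (sqrt (m * \<eta>)) (b (k * p)) (b (l * p))) / (block_potential m y)\<^sup>2)"
  proof (rule energy_bound_potential)
    show "sqrt (m * \<eta>) > 0" "\<eta> > 0" using m \<eta> by auto
    show "block_potential m y > 0" using ln y by (simp add: block_potential_def)
    show "finite {..<2 * m\<^sup>2}" by simp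
    show "{..<2 * m\<^sup>2} \<noteq> {}" using m by (auto simp: lessThan_empty_iff)
    show "(\<Union>l<2 * m\<^sup>2 * p. ball (b l) (2 * r)) \<in> sets borel" by (intro borel_open open_UN) auto
    fix a assume "a \<in> (\<Union>l<2 * m\<^sup>2 * p. ball (b l) (2 * r))"
    then obtain q where q: "q < 2 * m\<^sup>2 * p" "dist (b q) a < 2 * r" by auto
    define k j where "k = q div p" and "j = q mod p"
    have kj: "q = k * p + j" "j < p" "k < 2 * m\<^sup>2"
      using p q(1) by (auto simp: k_def j_def less_mult_imp_div_less)
    have g: "norm (b (k * p + j) - b (k * p)) < sqrt (m * \<eta>) / 2" "occupation_defect m \<eta> p b k < y"
      using True kj by (auto simp: good_block_def)
    have "norm (a - b (k * p)) \<le> dist (b q) a + norm (b (k * p + j) - b (k * p))"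
      using norm_triangle_ineq[of "a - b q" "b q - b (k * p)"] by (simp add: dist_norm norm_minus_commute flip: kj(1))
    hence "norm (a - b (k * p)) \<le> sqrt (m * \<eta>)" using q(2) g(1) r(2) by linarith
    from block_potential_le[OF m \<eta> kj(3) g(2) this]
    show "block_potential m y \<le> (\<Sum>l<2 * m\<^sup>2. \<eta> * cut_kernel (sqrt (m * \<eta>)) a (b (l * p)))" .
  qed
  thus ?thesis using True by (simp add: block_cap_def block_energy_def)
next
  case False
  have "0 < 2 * m\<^sup>2 * p" using m p by simp
  from block_radius_ge[OF this, of b] have "block_radius m p b \<ge> 0" by simp
  hence "energy_bound (\<Union>l<2 * m\<^sup>2 * p. ball (b l) (2 * r)) (8 * pi\<^sup>2 * (2 * r + block_radius m p b)\<^sup>2)"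
  proof (intro energy_bound_ball)
    show "0 < 2 * r + block_radius m p b" using r \<open>block_radius m p b \<ge> 0\<close> by simp
    show "(\<Union>l<2 * m\<^sup>2 * p. ball (b l) (2 * r)) \<in> sets borel" by (intro borel_open open_UN) auto
    show "(\<Union>l<2 * m\<^sup>2 * p. ball (b l) (2 * r)) \<subseteq> ball (b 0) (2 * r + block_radius m p b)"
    proof
      fix a assume "a \<in> (\<Union>l<2 * m\<^sup>2 * p. ball (b l) (2 * r))"
      then obtain q where q: "q < 2 * m\<^sup>2 * p" "dist (b q) a < 2 * r" by auto
      have "dist (b 0) a \<le> norm (b q - b 0) + dist (b q) a"
        using dist_triangle[of "b 0" a "b q"] by (simp add: dist_norm norm_minus_commute)
      thus "a \<in> ball (b 0) (2 * r + block_radius m p b)" using block_radius_ge[OF q(1), of b] q(2) by simp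
    qed
  qed
  thus ?thesis using False by (simp add: block_cap_def)
qed

text \<open>Makes the bound of a block a function of increments, on which independence of the blocks
  rests.\<close>

lemma block_cap_translate:
  "block_cap r m \<eta> y p (\<lambda>l. b l - c) = block_cap r m \<eta> y p b"
proof -
  have "good_block m \<eta> y p (\<lambda>l. b l - c) = good_block m \<eta> y p b"
    by (simp add: good_block_def occupation_defect_def)
  moreover have "block_energy m \<eta> p (\<lambda>l. b l - c) = block_energy m \<eta> p b"
    by (simp add: block_energy_def cut_kernel_def)
  moreover have "block_radius m p (\<lambda>l. b l - c) = block_radius m p b"
    by (simp add: block_radius_def)
  ultimately show ?thesis by (simp add: block_cap_def)
qed

text \<open>Permits arbitrary values beyond the samples of the block, so that its bound depends on
  its own increments alone.\<close>

lemma block_cap_cong: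
  assumes "\<And>l. l < 2 * m\<^sup>2 * p \<Longrightarrow> b l = b' l" "p > 0" "m > 0"
  shows "block_cap r m \<eta> y p b = block_cap r m \<eta> y p b'"
proof -
  have 1: "b (k * p + j) = b' (k * p + j)" if "k < 2 * m\<^sup>2" "j < p" for k j
  proof -
    have "Suc k * p \<le> 2 * m\<^sup>2 * p" using that by (intro mult_right_mono) auto
    thus ?thesis using that by (intro assms(1)) simp
  qed
  have 2: "b (k * p) = b' (k * p)" if "k < 2 * m\<^sup>2" for k
    using 1[OF that, of 0] assms by simp
  have "occupation_defect m \<eta> p b k = occupation_defect m \<eta> p b' k" if "k < 2 * m\<^sup>2" for k
    unfolding occupation_defect_def using that by (intro sum.cong) (auto simp: 2 partner_less)
  moreover have "block_energy m \<eta> p b = block_energy m \<eta> p b'"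
    unfolding block_energy_def by (intro sum.cong) (auto simp: 2)
  moreover have "block_radius m p b = block_radius m p b'"
    unfolding block_radius_def using assms(1)[of 0] assms
    by (intro arg_cong[where f=Max] image_cong) auto
  ultimately show ?thesis by (auto simp: block_cap_def good_block_def 1 2)
qed

section \<open>Exponential moments of the block bound\<close>

lemma sum_inverse_le_ln:
  assumes "n > 0"
  shows "(\<Sum>d\<in>{1..n}. 1 / real d) \<le> 1 + ln n"
  using assms
proof (induction n rule: nat_induct_non_zero)
  case (Suc n)
  have "ln (real n / Suc n) \<le> real n / Suc n - 1"
    using Suc by (intro ln_le_minus_one) auto
  also have "\<dots> = - 1 / Suc n" by (simp add: field_simps)
  finally have "1 / Suc n \<le> ln (Suc n) - ln n" using Suc by (simp add: ln_div)
  thus ?case using Suc by simp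
qed simp

lemma sum_inverse_distance_le:
  assumes "k < n"
  shows "(\<Sum>l\<in>{..<n} - {k}. 1 / \<bar>real k - real l\<bar>) \<le> 2 * (1 + ln n)"
proof -
  have H: "(\<Sum>d\<in>D. 1 / real d) \<le> 1 + ln n" if "D \<subseteq> {1..n}" for D
    using sum_mono2[OF _ that, of "\<lambda>d. 1 / real d"] sum_inverse_le_ln[of n] assms by force
  have eq: "{..<n} - {k} = {..<k} \<union> {Suc k..<n}" using assms by auto
  have "(\<Sum>l\<in>{..<n} - {k}. 1 / \<bar>real k - real l\<bar>)
     = (\<Sum>l\<in>{..<k}. 1 / \<bar>real k - real l\<bar>) + (\<Sum>l\<in>{Suc k..<n}. 1 / \<bar>real k - real l\<bar>)"
    unfolding eq by (rule sum.union_disjoint) auto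
  also have "(\<Sum>l\<in>{..<k}. 1 / \<bar>real k - real l\<bar>) = (\<Sum>d\<in>(\<lambda>l. k - l) ` {..<k}. 1 / real d)"
    by (subst sum.reindex) (auto simp: inj_on_def of_nat_diff intro!: sum.cong)
  also have "(\<Sum>l\<in>{Suc k..<n}. 1 / \<bar>real k - real l\<bar>) = (\<Sum>d\<in>(\<lambda>l. l - k) ` {Suc k..<n}. 1 / real d)"
    by (subst sum.reindex) (auto simp: inj_on_def of_nat_diff intro!: sum.cong)
  also have "(\<Sum>d\<in>(\<lambda>l. k - l) ` {..<k}. 1 / real d) + (\<Sum>d\<in>(\<lambda>l. l - k) ` {Suc k..<n}. 1 / real d)
     \<le> (1 + ln n) + (1 + ln n)"
    using assms by (intro add_mono H) auto
  finally show ?thesis by simp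
qed

lemma measurable_good_block:
  assumes [measurable]: "\<And>l. f l \<in> borel_measurable N"
  shows "Measurable.pred N (\<lambda>\<omega>. good_block m \<eta> y p (\<lambda>l. f l \<omega>))"
  unfolding good_block_def occupation_defect_def by measurable

lemma measurable_block_energy:
  assumes [measurable]: "\<And>l. f l \<in> borel_measurable N"
  shows "(\<lambda>\<omega>. block_energy m \<eta> p (\<lambda>l. f l \<omega>)) \<in> borel_measurable N"
  unfolding block_energy_def cut_kernel_def by measurable

lemma measurable_block_radius:
  assumes [measurable]: "\<And>l. f l \<in> borel_measurable N"
  shows "(\<lambda>\<omega>. block_radius m p (\<lambda>l. f l \<omega>)) \<in> borel_measurable N"
  unfolding block_radius_def by measurable

lemma measurable_block_cap:
  assumes "\<And>l. f l \<in> borel_measurable N"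
  shows "(\<lambda>\<omega>. block_cap r m \<eta> y p (\<lambda>l. f l \<omega>)) \<in> borel_measurable N"
proof -
  note [measurable] = measurable_good_block[of f N, OF assms] measurable_block_energy[of f N, OF assms]
    measurable_block_radius[of f N, OF assms]
  show ?thesis unfolding block_cap_def by measurable
qed

lemma block_energy_nonneg: "m > 0 \<Longrightarrow> \<eta> > 0 \<Longrightarrow> 0 \<le> block_energy m \<eta> p b"
  unfolding block_energy_def by (intro sum_nonneg mult_nonneg_nonneg less_imp_le[OF cut_kernel_pos]) auto

text \<open>A deterministic bound, from kernel \<le> 1 / (m \<eta>). It keeps the exponent at most 1
  on good blocks, where the exponential can then be replaced by a linear function.\<close>

lemma block_energy_le:
  assumes "m > 0" "\<eta> > 0"
  shows "block_energy m \<eta> p b \<le> 4 * real m ^ 3 * \<eta>"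
proof -
  have "cut_kernel (sqrt (m * \<eta>)) u v \<le> 1 / (m * \<eta>)" for u v
    unfolding cut_kernel_def using assms by (intro divide_left_mono) (auto intro!: mult_pos_pos add_pos_nonneg)
  hence "\<eta>\<^sup>2 * cut_kernel (sqrt (m * \<eta>)) u v \<le> \<eta>\<^sup>2 * (1 / (m * \<eta>))" for u v
    by (intro mult_left_mono) auto
  hence "block_energy m \<eta> p b \<le> (\<Sum>k<2 * m\<^sup>2. \<Sum>l<2 * m\<^sup>2. \<eta>\<^sup>2 * (1 / (m * \<eta>)))"
    unfolding block_energy_def by (intro sum_mono)
  also have "\<dots> = 4 * real m ^ 3 * \<eta>"
    using assms by (simp add: power2_eq_square power3_eq_cube)
  finally show ?thesis .
qed

lemma term_le_suminf: "f i \<le> (\<Sum>i. f i)" for f :: "nat \<Rightarrow> ennreal"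
  using sum_le_suminf[of f "{i}"] by simp

lemma exp_le_linear:
  assumes "0 \<le> x" "x \<le> (1::real)"
  shows "exp x \<le> 1 + 2 * x"
proof -
  have "x\<^sup>2 \<le> x" using assms by (simp add: power2_eq_square mult_left_le)
  thus ?thesis using exp_bound[OF assms] by simp
qed

context brownian_motion_4
begin

lemma markov_exp:
  assumes [measurable]: "f \<in> borel_measurable M" and "(\<integral>\<^sup>+\<omega>. ennreal (exp (f \<omega>)) \<partial>M) \<le> ennreal c" "c \<ge> 0"
  shows "prob {\<omega> \<in> space M. y \<le> f \<omega>} \<le> c * exp (- y)"
proof -
  have "emeasure M {\<omega> \<in> space M. y \<le> f \<omega>} = (\<integral>\<^sup>+\<omega>. indicator {\<omega> \<in> space M. y \<le> f \<omega>} \<omega> \<partial>M)"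
    by (rule nn_integral_indicator[symmetric]) measurable
  also have "\<dots> \<le> (\<integral>\<^sup>+\<omega>. ennreal (exp (- y)) * ennreal (exp (f \<omega>)) \<partial>M)"
    by (intro nn_integral_mono) (auto simp: indicator_def simp flip: ennreal_mult exp_add)
  also have "\<dots> \<le> ennreal (exp (- y)) * ennreal c"
    using assms by (auto simp: nn_integral_cmult intro!: mult_left_mono)
  also have "\<dots> = ennreal (c * exp (- y))" using assms by (simp add: mult.commute flip: ennreal_mult)
  finally show ?thesis using assms by (simp add: measure_def enn2real_leI)
qed

lemma measurable_grid:
  assumes "0 \<le> a" "0 \<le> \<tau>"
  shows "B (a + real l * \<tau>) \<in> borel_measurable M"
  using assms by (intro measurable_at) auto

text \<open>A union bound over the pieces. The maximal inequality for one piece at level sqrt (m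
  \<eta>) / 2 gives the rate m / 16, uniformly in \<open>p\<close>; the factor m + 1 is (z + N) / z
  with z = m and N = m^2.\<close>

lemma prob_not_good_block:
  fixes a \<eta> y :: real and p m :: nat
  assumes a: "0 \<le> a" and \<eta>: "0 < \<eta>" and p: "0 < p" and m: "0 < m"
  defines "b \<equiv> \<lambda>\<omega> l. B (a + real l * (\<eta> / p)) \<omega>"
  shows "prob {\<omega> \<in> space M. \<not> good_block m \<eta> y p (b \<omega>)} \<le> 2 * real (m\<^sup>2) * (4 * exp (- real m / 16) + (m + 1) * exp (- y))"
proof -
  have [measurable]: "(\<lambda>\<omega>. b \<omega> l) \<in> borel_measurable M" for l
    unfolding b_def using a \<eta> by (intro measurable_grid) auto
  define E1 where "E1 k = {\<omega> \<in> space M. \<exists>j\<le>p. sqrt (m * \<eta>) / 2 \<le> norm (b \<omega> (k * p + j) - b \<omega> (k * p))}" for k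
  define E2 where "E2 k = {\<omega> \<in> space M. y \<le> occupation_defect m \<eta> p (b \<omega>) k}" for k
  have [measurable]: "E1 k \<in> sets M" "E2 k \<in> sets M" for k
    unfolding E1_def E2_def occupation_defect_def by measurable
  have time: "a + real (k * p + j) * (\<eta> / p) = (a + k * \<eta>) + j * (\<eta> / p)" for k j
    using p by (simp add: field_simps)
  have timek: "a + real (k * p) * (\<eta> / p) = a + k * \<eta>" for k
    using p by (simp add: field_simps)
  have 1: "prob (E1 k) \<le> 4 * exp (- real m / 16)" for k
  proof -
    have "prob (E1 k) \<le> 4 * exp (- (sqrt (m * \<eta>) / 2)\<^sup>2 / (4 * real p * (\<eta> / p)))"
      unfolding E1_def b_def time timek using a \<eta> p m by (intro prob_grid_maximal) auto
    also have "- (sqrt (m * \<eta>) / 2)\<^sup>2 / (4 * real p * (\<eta> / p)) = - real m / 16"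
      using p \<eta> by (simp add: power_divide)
    finally show ?thesis .
  qed
  have 2: "prob (E2 k) \<le> (m + 1) * exp (- y)" if k: "k < 2 * m\<^sup>2" for k
    unfolding E2_def
  proof (rule markov_exp)
    show "(\<lambda>\<omega>. occupation_defect m \<eta> p (b \<omega>) k) \<in> borel_measurable M"
      unfolding occupation_defect_def by measurable
    have "(real m + real (m\<^sup>2)) / m = m + 1" using m by (simp add: field_simps power2_eq_square)
    moreover have "(\<integral>\<^sup>+\<omega>. ennreal (exp (occupation_defect m \<eta> p (b \<omega>) k)) \<partial>M) \<le> ennreal ((real m + real (m\<^sup>2)) / m)"
    proof (cases "k < m\<^sup>2")
      case True
      have "b \<omega> (partner m k l * p) = B ((a + k * \<eta>) + l * \<eta>) \<omega>" for l \<omega>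
        unfolding b_def timek using True by (simp add: partner_def algebra_simps)
      moreover have "b \<omega> (k * p) = B (a + k * \<eta>) \<omega>" for \<omega> unfolding b_def timek ..
      ultimately show ?thesis
        unfolding occupation_defect_def using a \<eta> m by (simp only:) (intro exp_occupation_forward, auto)
    next
      case False
      have "b \<omega> (partner m k l * p) = B ((a + k * \<eta>) - l * \<eta>) \<omega>" if "l \<in> {..m\<^sup>2}" for l \<omega>
        unfolding b_def timek using False that by (simp add: partner_def of_nat_diff algebra_simps)
      moreover have "b \<omega> (k * p) = B (a + k * \<eta>) \<omega>" for \<omega> unfolding b_def timek ..
      moreover have "real (m\<^sup>2) * \<eta> \<le> a + real k * \<eta>"
        using False \<eta> a by (intro add_increasing mult_right_mono of_nat_mono) auto
      ultimately show ?thesis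
        unfolding occupation_defect_def using \<eta> m
        by (simp only: cong: sum.cong) (intro exp_occupation_backward, simp_all only: of_nat_0_less_iff)
    qed
    ultimately show "(\<integral>\<^sup>+\<omega>. ennreal (exp (occupation_defect m \<eta> p (b \<omega>) k)) \<partial>M) \<le> ennreal (m + 1)" by simp
  qed simp
  have "{\<omega> \<in> space M. \<not> good_block m \<eta> y p (b \<omega>)} \<subseteq> (\<Union>k<2 * m\<^sup>2. E1 k \<union> E2 k)"
  proof safe
    fix \<omega> assume \<omega>: "\<omega> \<in> space M" and "\<not> good_block m \<eta> y p (b \<omega>)"
    then obtain k where k: "k < 2 * m\<^sup>2"
      "(\<exists>j<p. sqrt (m * \<eta>) / 2 \<le> norm (b \<omega> (k * p + j) - b \<omega> (k * p))) \<or> y \<le> occupation_defect m \<eta> p (b \<omega>) k"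
      unfolding good_block_def not_less[symmetric] by blast
    from k(2) have "\<omega> \<in> E1 k \<union> E2 k"
      unfolding E1_def E2_def using \<omega> by (auto intro: less_imp_le)
    thus "\<omega> \<in> (\<Union>k<2 * m\<^sup>2. E1 k \<union> E2 k)" using k(1) by blast
  qed
  hence "prob {\<omega> \<in> space M. \<not> good_block m \<eta> y p (b \<omega>)} \<le> prob (\<Union>k<2 * m\<^sup>2. E1 k \<union> E2 k)"
    by (intro finite_measure_mono) auto
  also have "\<dots> \<le> (\<Sum>k<2 * m\<^sup>2. prob (E1 k \<union> E2 k))"
    by (intro measure_UNION_le) auto
  also have "\<dots> \<le> (\<Sum>k<2 * m\<^sup>2. 4 * exp (- real m / 16) + (m + 1) * exp (- y))"
    by (intro sum_mono order.trans[OF measure_Un_le] add_mono 1 2) auto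
  finally show ?thesis by simp
qed

text \<open>Pieces at distance d interact with mean at most \<eta> / (2 d), so every row sums to at
  most \<eta> times a harmonic sum; the cut-off bounds the diagonal terms by \<eta> / m. The factor
  n \<eta> is the duration of the block.\<close>

lemma expectation_block_energy_le:
  fixes a \<eta> :: real and p m :: nat
  assumes a: "0 \<le> a" and \<eta>: "0 < \<eta>" and p: "0 < p" and m: "0 < m"
  defines "b \<equiv> \<lambda>\<omega> l. B (a + real l * (\<eta> / p)) \<omega>" and "n \<equiv> 2 * m\<^sup>2 :: nat"
  shows "(\<integral>\<^sup>+\<omega>. ennreal (block_energy m \<eta> p (b \<omega>)) \<partial>M) \<le> ennreal (n * \<eta> * (2 + ln n))"
proof -
  have n: "n > 0" using m by (simp add: n_def)
  have [measurable]: "(\<lambda>\<omega>. b \<omega> l) \<in> borel_measurable M" for l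
    unfolding b_def using a \<eta> by (intro measurable_grid) auto
  have timek: "a + real (k * p) * (\<eta> / p) = a + k * \<eta>" for k
    using p by (simp add: field_simps)
  define g where "g k l = (if k = l then 1 / (m * \<eta>) else 1 / (2 * \<eta>) * (1 / \<bar>real k - real l\<bar>))" for k l :: nat
  have g0: "g k l \<ge> 0" for k l using \<eta> by (simp add: g_def)
  have pos: "sqrt (m * \<eta>) > 0" using m \<eta> by simp
  have g: "(\<integral>\<^sup>+\<omega>. ennreal (cut_kernel (sqrt (m * \<eta>)) (b \<omega> (k * p)) (b \<omega> (l * p))) \<partial>M) \<le> ennreal (g k l)" for k l
  proof -
    consider "k = l" | "k < l" | "l < k" by linarith
    thus ?thesis
    proof cases
      case 1
      thus ?thesis using m \<eta> by (simp add: cut_kernel_def g_def emeasure_space_1)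
    next
      case 2
      hence "real k * \<eta> < real l * \<eta>" using \<eta> by simp
      hence "(\<integral>\<^sup>+\<omega>. ennreal (cut_kernel (sqrt (m * \<eta>)) (B (a + l * \<eta>) \<omega>) (B (a + k * \<eta>) \<omega>)) \<partial>M)
        \<le> ennreal (1 / (2 * ((a + l * \<eta>) - (a + k * \<eta>))))"
        using a \<eta> pos by (intro expectation_cut_kernel_le) auto
      also have "1 / (2 * ((a + l * \<eta>) - (a + k * \<eta>))) = g k l"
        using 2 \<eta> by (simp add: g_def algebra_simps abs_if)
      finally show ?thesis unfolding b_def timek by (simp add: cut_kernel_def norm_minus_commute)
    next
      case 3
      hence "real l * \<eta> < real k * \<eta>" using \<eta> by simp
      hence "(\<integral>\<^sup>+\<omega>. ennreal (cut_kernel (sqrt (m * \<eta>)) (B (a + k * \<eta>) \<omega>) (B (a + l * \<eta>) \<omega>)) \<partial>M)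
        \<le> ennreal (1 / (2 * ((a + k * \<eta>) - (a + l * \<eta>))))"
        using a \<eta> pos by (intro expectation_cut_kernel_le) auto
      also have "1 / (2 * ((a + k * \<eta>) - (a + l * \<eta>))) = g k l"
        using 3 \<eta> by (simp add: g_def algebra_simps abs_if)
      finally show ?thesis unfolding b_def timek .
    qed
  qed
  have [measurable]: "(\<lambda>\<omega>. cut_kernel \<rho> (b \<omega> k) (b \<omega> l)) \<in> borel_measurable M" for \<rho> k l
    unfolding cut_kernel_def by measurable
  have "(\<integral>\<^sup>+\<omega>. ennreal (block_energy m \<eta> p (b \<omega>)) \<partial>M)
    = (\<Sum>k<n. \<Sum>l<n. ennreal (\<eta>\<^sup>2) * (\<integral>\<^sup>+\<omega>. ennreal (cut_kernel (sqrt (m * \<eta>)) (b \<omega> (k * p)) (b \<omega> (l * p))) \<partial>M))"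
    unfolding block_energy_def n_def[symmetric] using cut_kernel_pos[OF pos]
    by (simp add: less_imp_le sum_nonneg ennreal_mult nn_integral_sum nn_integral_cmult flip: sum_ennreal)
  also have "\<dots> \<le> (\<Sum>k<n. \<Sum>l<n. ennreal (\<eta>\<^sup>2) * ennreal (g k l))"
    by (intro sum_mono mult_left_mono g) auto
  also have "\<dots> = ennreal (\<Sum>k<n. \<Sum>l<n. \<eta>\<^sup>2 * g k l)"
    using g0 by (simp add: sum_nonneg flip: sum_ennreal ennreal_mult)
  also have "(\<Sum>k<n. \<Sum>l<n. \<eta>\<^sup>2 * g k l) \<le> (\<Sum>k<n. \<eta> * (2 + ln n))"
  proof (intro sum_mono)
    fix k assume "k \<in> {..<n}" hence k: "k < n" by simp
    have "(\<Sum>l<n. \<eta>\<^sup>2 * g k l) = \<eta>\<^sup>2 * g k k + (\<Sum>l\<in>{..<n} - {k}. \<eta>\<^sup>2 * g k l)"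
      using k by (subst sum.remove[of _ k]) auto
    also have "(\<Sum>l\<in>{..<n} - {k}. \<eta>\<^sup>2 * g k l) = (\<Sum>l\<in>{..<n} - {k}. \<eta> / 2 * (1 / \<bar>real k - real l\<bar>))"
      using \<eta> by (intro sum.cong) (auto simp: g_def power2_eq_square)
    also have "\<dots> = \<eta> / 2 * (\<Sum>l\<in>{..<n} - {k}. 1 / \<bar>real k - real l\<bar>)"
      by (rule sum_distrib_left[symmetric])
    also have "\<dots> \<le> \<eta> / 2 * (2 * (1 + ln n))"
      using \<eta> by (intro mult_left_mono sum_inverse_distance_le k) auto
    also have "\<eta>\<^sup>2 * g k k = \<eta> / m" using \<eta> by (simp add: g_def power2_eq_square)
    also have "\<eta> / m \<le> \<eta> / 1" using m \<eta> by (intro divide_left_mono) auto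
    finally show "(\<Sum>l<n. \<eta>\<^sup>2 * g k l) \<le> \<eta> * (2 + ln n)" by (simp add: algebra_simps)
  qed
  finally show ?thesis by (simp add: ennreal_leI mult.assoc)
qed

lemma prob_block_radius_ge:
  fixes a \<eta> x :: real and p m :: nat
  assumes a: "0 \<le> a" and \<eta>: "0 < \<eta>" and p: "0 < p" and m: "0 < m" and x: "0 < x"
  defines "b \<equiv> \<lambda>\<omega> l. B (a + real l * (\<eta> / p)) \<omega>"
  shows "prob {\<omega> \<in> space M. x \<le> block_radius m p (b \<omega>)} \<le> 4 * exp (- x\<^sup>2 / (8 * m\<^sup>2 * \<eta>))"
proof -
  have [measurable]: "(\<lambda>\<omega>. b \<omega> l) \<in> borel_measurable M" for l
    unfolding b_def using a \<eta> by (intro measurable_grid) auto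
  let ?N = "2 * m\<^sup>2 * p"
  have N: "?N > 0" using m p by simp
  have "{\<omega> \<in> space M. x \<le> block_radius m p (b \<omega>)} \<subseteq> {\<omega> \<in> space M. \<exists>k\<le>?N. x \<le> norm (b \<omega> k - B a \<omega>)}"
  proof safe
    fix \<omega> assume x: "x \<le> block_radius m p (b \<omega>)"
    have "block_radius m p (b \<omega>) \<in> (\<lambda>l. norm (b \<omega> l - b \<omega> 0)) ` {..<?N}"
      unfolding block_radius_def using N by (intro Max_in) (auto simp: lessThan_empty_iff)
    then obtain l where "l < ?N" "block_radius m p (b \<omega>) = norm (b \<omega> l - b \<omega> 0)" by auto
    thus "\<exists>k\<le>?N. x \<le> norm (b \<omega> k - B a \<omega>)" using x by (intro exI[of _ l]) (auto simp: b_def)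
  qed
  moreover have "{\<omega> \<in> space M. \<exists>k\<le>?N. x \<le> norm (b \<omega> k - B a \<omega>)} \<in> sets M"
    using a by measurable
  ultimately have "prob {\<omega> \<in> space M. x \<le> block_radius m p (b \<omega>)}
     \<le> prob {\<omega> \<in> space M. \<exists>k\<le>?N. x \<le> norm (b \<omega> k - B a \<omega>)}"
    by (rule finite_measure_mono)
  also have "\<dots> \<le> 4 * exp (- x\<^sup>2 / (4 * real ?N * (\<eta> / p)))"
    unfolding b_def using a \<eta> p N x by (intro prob_grid_maximal) auto
  also have "4 * real ?N * (\<eta> / p) = 8 * m\<^sup>2 * \<eta>" using p by simp
  finally show ?thesis .
qed

text \<open>Three contributions. On good blocks \<open>h1\<close> keeps the exponent below 1 and the
  mean energy gives the linear term. On bad blocks with Y < 1 the exponential is at most 3. The rest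
  is sliced by the integer part of \<open>Y\<close>: by \<open>h2\<close> and \<open>h3\<close>, Y
  \<ge> i + 1 forces a displacement so large that its probability, at most 4 exp (- (i + 1) m),
  beats the growth exp (i + 2).\<close>

lemma expectation_exp_block_cap_le:
  fixes a \<eta> \<theta> r y :: real and p m :: nat
  assumes a: "0 \<le> a" and \<eta>: "0 < \<eta>" and p: "0 < p" and m: "2 \<le> m" and \<theta>: "0 < \<theta>" and r: "0 < r" and y: "0 \<le> y"
    and h1: "8 * pi\<^sup>2 * \<theta> * m ^ 3 * \<eta> \<le> (block_potential m y)\<^sup>2"
    and h2: "128 * pi\<^sup>2 * \<theta> * r\<^sup>2 \<le> 1"
    and h3: "256 * pi\<^sup>2 * \<theta> * m ^ 3 * \<eta> \<le> 1"
  defines "b \<equiv> \<lambda>\<omega> l. B (a + real l * (\<eta> / p)) \<omega>"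
  shows "(\<integral>\<^sup>+\<omega>. ennreal (exp (\<theta> * block_cap r m \<eta> y p (b \<omega>))) \<partial>M)
    \<le> ennreal (1 + 8 * pi\<^sup>2 * \<theta> * m\<^sup>2 * \<eta> * (2 + ln (2 * m\<^sup>2)) / (block_potential m y)\<^sup>2
        + 6 * m\<^sup>2 * (4 * exp (- real m / 16) + (m + 1) * exp (- y)) + 72 * exp (- real m))"
proof -
  have [measurable]: "(\<lambda>\<omega>. b \<omega> l) \<in> borel_measurable M" for l
    unfolding b_def using a \<eta> by (intro measurable_grid) auto
  define P where "P = block_potential m y"
  define W where "W \<omega> = block_energy m \<eta> p (b \<omega>)" for \<omega>
  define Y where "Y \<omega> = 8 * pi\<^sup>2 * \<theta> * (2 * r + block_radius m p (b \<omega>))\<^sup>2" for \<omega>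
  define bad where "bad = {\<omega> \<in> space M. \<not> good_block m \<eta> y p (b \<omega>)}"
  define F where "F i = {\<omega> \<in> space M. real (Suc i) \<le> Y \<omega>}" for i
  have P: "P > 0" using m y by (simp add: P_def block_potential_def)
  have m0: "m > 0" using m by simp
  have [measurable]: "W \<in> borel_measurable M" unfolding W_def by (intro measurable_block_energy) measurable
  have [measurable]: "Y \<in> borel_measurable M" unfolding Y_def
    using measurable_block_radius[of "\<lambda>l \<omega>. b \<omega> l" M m p] by measurable
  have [measurable]: "bad \<in> sets M" unfolding bad_def
    using measurable_good_block[of "\<lambda>l \<omega>. b \<omega> l" M m \<eta> y p] by measurable
  have [measurable]: "F i \<in> sets M" for i unfolding F_def by measurable
  have W0: "W \<omega> \<ge> 0" for \<omega> unfolding W_def using m0 \<eta> by (rule block_energy_nonneg)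
  define c1 where "c1 = 4 * pi\<^sup>2 * \<theta> / P\<^sup>2"
  have c1: "c1 \<ge> 0" using \<theta> by (simp add: c1_def)
  have pw: "ennreal (exp (\<theta> * block_cap r m \<eta> y p (b \<omega>)))
     \<le> 1 + ennreal c1 * ennreal (W \<omega>) + 3 * indicator bad \<omega> + (\<Sum>i. ennreal (exp (i + 2)) * indicator (F i) \<omega>)"
    if \<omega>: "\<omega> \<in> space M" for \<omega>
  proof (cases "good_block m \<eta> y p (b \<omega>)")
    case True
    define x where "x = \<theta> * (2 * pi\<^sup>2 * W \<omega> / P\<^sup>2)"
    have "W \<omega> \<le> 4 * m ^ 3 * \<eta>" unfolding W_def using block_energy_le[OF m0 \<eta>] by simp
    hence "\<theta> * (2 * pi\<^sup>2 * W \<omega>) \<le> \<theta> * (2 * pi\<^sup>2 * (4 * m ^ 3 * \<eta>))" using \<theta> by (intro mult_left_mono) auto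
    also have "\<dots> \<le> P\<^sup>2" using h1 by (simp add: P_def mult_ac)
    finally have "x \<le> 1" using P by (simp add: x_def divide_le_eq)
    moreover have "x \<ge> 0" using W0 \<theta> by (simp add: x_def)
    ultimately have "exp x \<le> 1 + 2 * x" by (intro exp_le_linear)
    also have "2 * x = c1 * W \<omega>" by (simp add: x_def c1_def)
    finally have "ennreal (exp x) \<le> ennreal (1 + c1 * W \<omega>)" by (rule ennreal_leI)
    also have "\<dots> = 1 + ennreal c1 * ennreal (W \<omega>)" using c1 W0 by (simp add: ennreal_mult)
    finally have "ennreal (exp x) + 0 \<le> 1 + ennreal c1 * ennreal (W \<omega>) + (3 * indicator bad \<omega> + (\<Sum>i. ennreal (exp (i + 2)) * indicator (F i) \<omega>))"
      by (intro add_mono) auto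
    thus ?thesis using True by (simp add: block_cap_def x_def W_def P_def add.assoc)
  next
    case False
    hence eq: "\<theta> * block_cap r m \<eta> y p (b \<omega>) = Y \<omega>" by (simp add: block_cap_def Y_def)
    have Y0: "Y \<omega> \<ge> 0" using \<theta> by (simp add: Y_def)
    have "ennreal (exp (Y \<omega>)) \<le> 3 * indicator bad \<omega> + (\<Sum>i. ennreal (exp (i + 2)) * indicator (F i) \<omega>)"
    proof (cases "Y \<omega> < 1")
      case True
      hence "exp (Y \<omega>) \<le> exp 1" by simp
      also have "\<dots> \<le> 3" by (rule exp_le)
      finally have "ennreal (exp (Y \<omega>)) \<le> ennreal 3" by (rule ennreal_leI)
      hence "ennreal (exp (Y \<omega>)) + 0 \<le> 3 * indicator bad \<omega> + (\<Sum>i. ennreal (exp (i + 2)) * indicator (F i) \<omega>)"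
        using False \<omega> by (intro add_mono) (auto simp: bad_def)
      thus ?thesis by simp
    next
      case F: False
      \<comment> \<open>Chosen so that i + 1 \<le> Y \<le> i + 2.\<close>
      define i where "i = nat \<lfloor>Y \<omega>\<rfloor> - 1"
      have i: "real (Suc i) \<le> Y \<omega>" "Y \<omega> \<le> i + 2" using F unfolding i_def by linarith+
      have "ennreal (exp (Y \<omega>)) \<le> ennreal (exp (i + 2)) * indicator (F i) \<omega>"
        using i \<omega> by (auto simp: F_def intro!: ennreal_leI)
      also have "\<dots> \<le> (\<Sum>i. ennreal (exp (i + 2)) * indicator (F i) \<omega>)"
        by (rule term_le_suminf)
      finally show ?thesis by (simp add: add_increasing)
    qed
    thus ?thesis unfolding eq by (simp add: add.assoc add_increasing)
  qed
  have PF: "prob (F i) \<le> 4 * exp (- (real (Suc i) * m))" for i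
  proof -
    \<comment> \<open>The displacement forced by Y \<ge> i + 1: since (2 r + R)^2 \<le> 8 r^2 + 2
      R^2, and \<open>h2\<close> bounds the part with r by 1/2, what remains is 32 pi^2 \<theta> R^2
      \<ge> i + 1.\<close>
    define x where "x = sqrt (real (Suc i) / (32 * pi\<^sup>2 * \<theta>))"
    have x: "x > 0" "x\<^sup>2 = real (Suc i) / (32 * pi\<^sup>2 * \<theta>)" using \<theta> by (auto simp: x_def)
    have "F i \<subseteq> {\<omega> \<in> space M. x \<le> block_radius m p (b \<omega>)}"
    proof safe
      fix \<omega> assume "\<omega> \<in> F i"
      hence Y: "real (Suc i) \<le> Y \<omega>" and \<omega>: "\<omega> \<in> space M" by (auto simp: F_def)
      show "\<omega> \<in> space M" by fact
      define R where "R = block_radius m p (b \<omega>)"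
      have "0 < 2 * m\<^sup>2 * p" using m p by simp
      from block_radius_ge[OF this, of "b \<omega>"] have R: "R \<ge> 0" by (simp add: R_def)
      have "(2 * r + R)\<^sup>2 \<le> 8 * r\<^sup>2 + 2 * R\<^sup>2"
        using sum_squares_bound[of "2 * r" R] by (simp add: power2_sum power_mult_distrib)
      hence "8 * pi\<^sup>2 * \<theta> * (2 * r + R)\<^sup>2 \<le> 8 * pi\<^sup>2 * \<theta> * (8 * r\<^sup>2 + 2 * R\<^sup>2)"
        using \<theta> by (intro mult_left_mono) auto
      hence "real (Suc i) \<le> 64 * pi\<^sup>2 * \<theta> * r\<^sup>2 + 16 * pi\<^sup>2 * \<theta> * R\<^sup>2"
        using Y unfolding Y_def R_def[symmetric] by (simp add: algebra_simps)
      moreover have "64 * pi\<^sup>2 * \<theta> * r\<^sup>2 \<le> real (Suc i) / 2" using h2 by simp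
      ultimately have "real (Suc i) \<le> 32 * pi\<^sup>2 * \<theta> * R\<^sup>2" by simp
      hence "x\<^sup>2 \<le> R\<^sup>2" unfolding x(2) using \<theta> by (simp add: divide_le_eq mult_ac)
      hence "x \<le> R" using R by (rule power2_le_imp_le)
      thus "x \<le> block_radius m p (b \<omega>)" by (simp add: R_def)
    qed
    moreover have "{\<omega> \<in> space M. x \<le> block_radius m p (b \<omega>)} \<in> sets M"
      using measurable_block_radius[of "\<lambda>l \<omega>. b \<omega> l" M m p] by measurable
    ultimately have "prob (F i) \<le> prob {\<omega> \<in> space M. x \<le> block_radius m p (b \<omega>)}"
      by (rule finite_measure_mono)
    also have "\<dots> \<le> 4 * exp (- x\<^sup>2 / (8 * m\<^sup>2 * \<eta>))"
      unfolding b_def using a \<eta> p m0 x by (intro prob_block_radius_ge) auto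
    also have "- x\<^sup>2 / (8 * m\<^sup>2 * \<eta>) \<le> - (real (Suc i) * m)"
    proof -
      have "256 * pi\<^sup>2 * \<theta> * m ^ 3 * \<eta> = m * (256 * pi\<^sup>2 * \<theta> * m\<^sup>2 * \<eta>)"
        by (simp add: power2_eq_square power3_eq_cube)
      hence "m \<le> 1 / (256 * pi\<^sup>2 * \<theta> * m\<^sup>2 * \<eta>)"
        using h3 \<theta> m0 \<eta> by (simp add: le_divide_eq mult_ac)
      hence "real (Suc i) * m \<le> real (Suc i) * (1 / (256 * pi\<^sup>2 * \<theta> * m\<^sup>2 * \<eta>))"
        by (intro mult_left_mono) auto
      also have "\<dots> = x\<^sup>2 / (8 * m\<^sup>2 * \<eta>)" unfolding x(2) by simp
      finally show ?thesis by simp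
    qed
    finally show ?thesis by simp
  qed
  have sumF: "(\<Sum>i. ennreal (exp (real i + 2)) * emeasure M (F i)) \<le> ennreal (72 * exp (- real m))"
  proof -
    \<comment> \<open>The ratio of consecutive slices: the exponential gains a factor exp 1 and the
      probability loses exp (- m).\<close>
    define q where "q = exp (1 - real m)"
    have "1 - real m \<le> - 1" using m by simp
    hence "q \<le> exp (- 1)" by (simp add: q_def)
    also have "exp (- 1 :: real) \<le> 1 / 2"
      using exp_ge_add_one_self[of "1::real"] by (simp add: exp_minus field_simps)
    finally have q: "q \<le> 1 / 2" "q \<ge> 0" by (auto simp: q_def)
    have "(\<Sum>i. ennreal (exp (real i + 2)) * emeasure M (F i)) \<le> (\<Sum>i. ennreal (4 * exp (2 - real m) * q ^ i))"
    proof (intro suminf_le)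
      fix i
      have "exp (real i + 2) * prob (F i) \<le> exp (real i + 2) * (4 * exp (- (real (Suc i) * m)))"
        by (intro mult_left_mono PF) auto
      also have "\<dots> = 4 * exp (2 - real m) * q ^ i"
        unfolding q_def by (simp add: algebra_simps flip: exp_add exp_of_nat_mult)
      finally show "ennreal (exp (real i + 2)) * emeasure M (F i) \<le> ennreal (4 * exp (2 - real m) * q ^ i)"
        by (simp add: emeasure_eq_measure ennreal_leI flip: ennreal_mult)
    qed auto
    also have "\<dots> = ennreal (4 * exp (2 - real m) * (1 / (1 - q)))"
      using q by (intro suminf_ennreal_eq sums_mult geometric_sums) auto
    also have "\<dots> \<le> ennreal (72 * exp (- real m))"
    proof (intro ennreal_leI)
      \<comment> \<open>72 = 4 * 9 * 2, from the maximal inequality, exp 2 \<le> 9 and the geometric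
        series.\<close>
      have "1 / (1 - q) \<le> 1 / (1/2)" using q by (intro divide_left_mono) auto
      hence "4 * exp (2 - real m) * (1 / (1 - q)) \<le> 4 * exp (2 - real m) * 2" by (intro mult_left_mono) auto
      moreover have "(exp 1)\<^sup>2 * exp (- real m) \<le> 9 * exp (- real m)"
        using power_mono[OF exp_le, of 2] by (intro mult_right_mono) auto
      moreover have "exp (2 - real m) = (exp 1)\<^sup>2 * exp (- real m)"
        by (simp add: exp_diff exp_minus field_simps flip: exp_of_nat_mult)
      ultimately show "4 * exp (2 - real m) * (1 / (1 - q)) \<le> 72 * exp (- real m)" by linarith
    qed
    finally show ?thesis .
  qed
  define c2 where "c2 = 2 * real (m\<^sup>2) * (4 * exp (- real m / 16) + (m + 1) * exp (- y))"
  define c3 where "c3 = real (2 * m\<^sup>2) * \<eta> * (2 + ln (2 * m\<^sup>2))"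
  have "1 \<le> 2 * m\<^sup>2" using m0 by (simp add: Suc_le_eq)
  hence "1 \<le> real (2 * m\<^sup>2)" by (metis of_nat_1 of_nat_le_iff)
  hence "ln (real (2 * m\<^sup>2)) \<ge> 0" by (rule ln_ge_zero)
  hence c23: "c2 \<ge> 0" "c3 \<ge> 0" using \<eta> by (auto simp: c2_def c3_def)
  have "(\<integral>\<^sup>+\<omega>. ennreal (exp (\<theta> * block_cap r m \<eta> y p (b \<omega>))) \<partial>M)
    \<le> (\<integral>\<^sup>+\<omega>. 1 + ennreal c1 * ennreal (W \<omega>) + 3 * indicator bad \<omega> + (\<Sum>i. ennreal (exp (i + 2)) * indicator (F i) \<omega>) \<partial>M)"
    by (intro nn_integral_mono pw)
  also have "\<dots> = 1 + ennreal c1 * (\<integral>\<^sup>+\<omega>. ennreal (W \<omega>) \<partial>M) + 3 * emeasure M bad + (\<Sum>i. ennreal (exp (real i + 2)) * emeasure M (F i))"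
    by (simp add: nn_integral_add nn_integral_suminf nn_integral_cmult emeasure_space_1 add.commute)
  also have "\<dots> \<le> 1 + ennreal c1 * ennreal c3 + 3 * ennreal c2 + ennreal (72 * exp (- real m))"
  proof (intro add_mono mult_left_mono sumF)
    show "(\<integral>\<^sup>+\<omega>. ennreal (W \<omega>) \<partial>M) \<le> ennreal c3"
      unfolding W_def b_def c3_def using a \<eta> p m0 by (intro expectation_block_energy_le) auto
    have "prob bad \<le> c2" unfolding bad_def b_def c2_def
      using a \<eta> p m0 by (intro prob_not_good_block) auto
    thus "emeasure M bad \<le> ennreal c2" by (simp add: emeasure_eq_measure ennreal_leI)
  qed auto
  also have "\<dots> = ennreal (1 + c1 * c3 + 3 * c2 + 72 * exp (- real m))"
    using c1 c23 by (simp add: ennreal_mult)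
  also have "1 + c1 * c3 + 3 * c2 + 72 * exp (- real m) = 1 + 8 * pi\<^sup>2 * \<theta> * m\<^sup>2 * \<eta> * (2 + ln (2 * m\<^sup>2)) / (block_potential m y)\<^sup>2
        + 6 * m\<^sup>2 * (4 * exp (- real m / 16) + (m + 1) * exp (- y)) + 72 * exp (- real m)"
    by (simp add: c1_def c2_def c3_def P_def)
  finally show ?thesis .
qed

end

section \<open>Chernoff bound over the blocks\<close>

context brownian_motion_4
begin

text \<open>Each bound is a function of the fine increments in its own index set \<open>J i\<close>,
  and these sets are disjoint.\<close>

lemma indep_block_caps:
  fixes \<eta> r y :: real and p m N :: nat
  assumes \<eta>: "0 < \<eta>" and p: "0 < p" and m: "0 < m"
  shows "indep_vars (\<lambda>_. borel)
    (\<lambda>i \<omega>. block_cap r m \<eta> y p (\<lambda>l. B (real i * (2 * m\<^sup>2 * \<eta>) + real l * (\<eta> / p)) \<omega>)) {..<N}"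
proof -
  define L where "L = 2 * m\<^sup>2 * p"
  define \<tau> where "\<tau> = \<eta> / p"
  define X where "X q \<omega> = B (0 + real (Suc q) * \<tau>) \<omega> - B (0 + real q * \<tau>) \<omega>" for q \<omega>
  define J where "J i = {i * L..<Suc i * L}" for i
  \<comment> \<open>Positions relative to the start of the block, rebuilt from its increments. The
    value 0 past the end keeps \<open>F i\<close> from depending on increments outside
    \<open>J i\<close>.\<close>
  define F where "F i x = block_cap r m \<eta> y p (\<lambda>l. if l < L then \<Sum>q\<in>{i * L..<i * L + l}. x q else 0)"
    for i and x :: "nat \<Rightarrow> real ^ 4"
  have \<tau>: "\<tau> > 0" using \<eta> p by (simp add: \<tau>_def)
  have disj: "disjoint_family_on J {..<N}"
    unfolding disjoint_family_on_def
  proof (intro ballI impI)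
    have J: "q div L = i" if "q \<in> J i" for q i
      using that by (intro div_nat_eqI) (auto simp: J_def mult.commute)
    show "J i \<inter> J i' = {}" if "i \<noteq> i'" for i i' using J that by blast
  qed
  have "indep_vars (\<lambda>_. borel) X {..<N * L}"
    unfolding X_def using \<tau> by (intro indep_forward_increments) auto
  hence "indep_vars (\<lambda>i. PiM (J i) (\<lambda>_. borel)) (\<lambda>i \<omega>. restrict (\<lambda>q. X q \<omega>) (J i)) {..<N}"
  proof (rule indep_vars_restrict[OF _ _ disj])
    fix i assume "i \<in> {..<N}"
    hence "Suc i * L \<le> N * L" by (intro mult_right_mono) auto
    thus "J i \<subseteq> {..<N * L}" by (auto simp: J_def)
  qed
  hence "indep_vars (\<lambda>_. borel) (\<lambda>i \<omega>. F i (restrict (\<lambda>q. X q \<omega>) (J i))) {..<N}"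
  proof (rule indep_vars_compose2)
    fix i
    have "(\<lambda>x. if l < L then \<Sum>q\<in>{i * L..<i * L + l}. x q else 0) \<in> borel_measurable (PiM (J i) (\<lambda>_. borel :: (real ^ 4) measure))" for l
    proof (cases "l < L")
      case True
      thus ?thesis by (auto intro!: borel_measurable_sum measurable_component_singleton simp: J_def)
    qed simp
    thus "F i \<in> borel_measurable (PiM (J i) (\<lambda>_. borel))"
      unfolding F_def by (rule measurable_block_cap)
  qed
  moreover have "F i (restrict (\<lambda>q. X q \<omega>) (J i)) = block_cap r m \<eta> y p (\<lambda>l. B (real i * (2 * m\<^sup>2 * \<eta>) + real l * (\<eta> / p)) \<omega>)" for i \<omega>
  proof -
    have "(if l < L then \<Sum>q\<in>{i * L..<i * L + l}. restrict (\<lambda>q. X q \<omega>) (J i) q else 0)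
      = B (real i * (2 * m\<^sup>2 * \<eta>) + real l * (\<eta> / p)) \<omega> - B (real i * (2 * m\<^sup>2 * \<eta>)) \<omega>" if l: "l < L" for l
    proof -
      have "(\<Sum>q\<in>{i * L..<i * L + l}. restrict (\<lambda>q. X q \<omega>) (J i) q) = (\<Sum>q\<in>{i * L..<i * L + l}. B (real (Suc q) * \<tau>) \<omega> - B (real q * \<tau>) \<omega>)"
        using l by (intro sum.cong) (auto simp: J_def X_def)
      also have "\<dots> = B (real (i * L + l) * \<tau>) \<omega> - B (real (i * L) * \<tau>) \<omega>"
        by (subst sum_Suc_diff') auto
      also have "real (i * L) * \<tau> = real i * (2 * m\<^sup>2 * \<eta>)"
        using p by (simp add: L_def \<tau>_def)
      also have "real (i * L + l) * \<tau> = real i * (2 * m\<^sup>2 * \<eta>) + real l * (\<eta> / p)"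
        using p by (simp add: L_def \<tau>_def field_simps)
      finally show ?thesis using l by simp
    qed
    hence "F i (restrict (\<lambda>q. X q \<omega>) (J i))
      = block_cap r m \<eta> y p (\<lambda>l. B (real i * (2 * m\<^sup>2 * \<eta>) + real l * (\<eta> / p)) \<omega> - B (real i * (2 * m\<^sup>2 * \<eta>)) \<omega>)"
      unfolding F_def L_def using p m by (intro block_cap_cong) auto
    thus ?thesis by (simp only: block_cap_translate)
  qed
  ultimately show ?thesis by simp
qed

lemma prob_sum_block_caps_ge:
  fixes \<eta> \<theta> r y x K :: real and p m N :: nat
  assumes \<eta>: "0 < \<eta>" and p: "0 < p" and m: "0 < m" and \<theta>: "0 < \<theta>" and K: "0 \<le> K"
  defines "Z \<equiv> \<lambda>i \<omega>. block_cap r m \<eta> y p (\<lambda>l. B (real i * (2 * m\<^sup>2 * \<eta>) + real l * (\<eta> / p)) \<omega>)"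
  assumes mgf: "\<And>i. (\<integral>\<^sup>+\<omega>. ennreal (exp (\<theta> * Z i \<omega>)) \<partial>M) \<le> ennreal K"
  shows "prob {\<omega> \<in> space M. x \<le> (\<Sum>i<N. Z i \<omega>)} \<le> K ^ N * exp (- (\<theta> * x))"
proof -
  have ind: "indep_vars (\<lambda>_. borel) Z {..<N}"
    unfolding Z_def using \<eta> p m by (rule indep_block_caps)
  have [measurable]: "Z i \<in> borel_measurable M" for i
    unfolding Z_def using \<eta> by (intro measurable_block_cap measurable_grid) auto
  have "indep_vars (\<lambda>_. borel) (\<lambda>i \<omega>. ennreal (exp (\<theta> * Z i \<omega>))) {..<N}"
    by (rule indep_vars_compose2[OF ind, where Y="\<lambda>i z. ennreal (exp (\<theta> * z))"]) measurable
  hence "(\<integral>\<^sup>+\<omega>. (\<Prod>i<N. ennreal (exp (\<theta> * Z i \<omega>))) \<partial>M) = (\<Prod>i<N. \<integral>\<^sup>+\<omega>. ennreal (exp (\<theta> * Z i \<omega>)) \<partial>M)"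
    by (intro indep_vars_nn_integral) auto
  also have "\<dots> \<le> (\<Prod>i<N. ennreal K)" by (intro prod_mono_ennreal mgf)
  also have "\<dots> = ennreal (K ^ N)" using K by (simp add: ennreal_power)
  also have "(\<lambda>\<omega>. \<Prod>i<N. ennreal (exp (\<theta> * Z i \<omega>))) = (\<lambda>\<omega>. ennreal (exp (\<theta> * (\<Sum>i<N. Z i \<omega>))))"
    by (simp add: prod_ennreal exp_sum sum_distrib_left)
  finally have "(\<integral>\<^sup>+\<omega>. ennreal (exp (\<theta> * (\<Sum>i<N. Z i \<omega>))) \<partial>M) \<le> ennreal (K ^ N)" .
  hence "prob {\<omega> \<in> space M. \<theta> * x \<le> \<theta> * (\<Sum>i<N. Z i \<omega>)} \<le> K ^ N * exp (- (\<theta> * x))"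
    using K by (intro markov_exp) auto
  thus ?thesis using \<theta> by simp
qed

text \<open>Uniform continuity moves each time to the grid point on its left at a spatial cost below
  r, whence the radius 2 r. The modulus of continuity depends on \<open>\<omega>\<close>, and so
  does \<open>p0\<close>.\<close>

lemma wiener_sausage_subset_blocks:
  fixes \<eta> r t :: real and m N :: nat
  assumes \<omega>: "\<omega> \<in> space M" and \<eta>: "0 < \<eta>" and m: "0 < m" and r: "0 < r" and t: "t < real N * (2 * m\<^sup>2 * \<eta>)"
  shows "\<exists>p0. \<forall>p>p0. wiener_sausage B r t \<omega>
    \<subseteq> (\<Union>i<N. \<Union>l<2 * m\<^sup>2 * p. ball (B (real i * (2 * m\<^sup>2 * \<eta>) + real l * (\<eta> / p)) \<omega>) (2 * r))"
proof -
  define T where "T = real N * (2 * m\<^sup>2 * \<eta>)"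
  have "uniformly_continuous_on {0..T} (\<lambda>s. B s \<omega>)"
    by (intro compact_uniformly_continuous continuous_on_subset[OF continuous_paths[OF \<omega>]]) auto
  then obtain d where d: "d > 0" "\<And>s s'. s \<in> {0..T} \<Longrightarrow> s' \<in> {0..T} \<Longrightarrow> dist s' s < d \<Longrightarrow> dist (B s' \<omega>) (B s \<omega>) < r"
    using r unfolding uniformly_continuous_on_def by metis
  obtain p0 :: nat where p0: "\<eta> / d < p0" using reals_Archimedean2 by blast
  show ?thesis
  proof (intro exI[of _ p0] allI impI subsetI)
    fix p a assume p: "p0 < p" and "a \<in> wiener_sausage B r t \<omega>"
    then obtain s where s: "0 \<le> s" "s \<le> t" "dist (B s \<omega>) a < r"
      by (auto simp: wiener_sausage_def)
    have p': "p > 0" using p by simp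
    define \<tau> where "\<tau> = \<eta> / p"
    define L where "L = 2 * m\<^sup>2 * p"
    have \<tau>: "\<tau> > 0" using \<eta> p' by (simp add: \<tau>_def)
    have "\<eta> / d < p" using p0 p by simp
    hence "\<tau> < d" using d(1) p' by (simp add: \<tau>_def field_simps)
    define q where "q = nat \<lfloor>s / \<tau>\<rfloor>"
    have "0 \<le> s / \<tau>" using s \<tau> by simp
    hence "real q \<le> s / \<tau>" "s / \<tau> < real q + 1" unfolding q_def by linarith+
    hence q: "real q * \<tau> \<le> s" "s < real q * \<tau> + \<tau>" using \<tau> by (auto simp: field_simps)
    have TL: "T = real (N * L) * \<tau>" using p' by (simp add: T_def L_def \<tau>_def)
    \<comment> \<open>As t lies strictly before the end of the last block, even the grid point just
      before time t has an index inside one of the N blocks.\<close>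
    have "real q * \<tau> < real (N * L) * \<tau>" using q(1) s(2) t unfolding T_def[symmetric] TL by linarith
    hence qNL: "q < N * L" using \<tau> by (simp only: mult_less_cancel_right_pos of_nat_less_iff)
    have L: "L > 0" using m p' by (simp add: L_def)
    define i l where "i = q div L" and "l = q mod L"
    have il: "i < N" "l < L" "q = i * L + l"
      using qNL L by (auto simp: i_def l_def less_mult_imp_div_less)
    have time: "real i * (2 * m\<^sup>2 * \<eta>) + real l * (\<eta> / p) = real q * \<tau>"
      unfolding il(3) using p' by (simp add: L_def \<tau>_def field_simps)
    have "dist (B (real q * \<tau>) \<omega>) (B s \<omega>) < r"
    proof (rule d(2))
      show "s \<in> {0..T}" using s t by (simp add: T_def)
      show "real q * \<tau> \<in> {0..T}" using q(1) s t \<tau> by (simp add: T_def)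
      show "dist (real q * \<tau>) s < d" using q \<open>\<tau> < d\<close> by (simp add: dist_real_def abs_if)
    qed
    hence "dist (B (real q * \<tau>) \<omega>) a < 2 * r"
      using s(3) dist_triangle[of "B (real q * \<tau>) \<omega>" a "B s \<omega>"] by simp
    hence "a \<in> ball (B (real i * (2 * m\<^sup>2 * \<eta>) + real l * (\<eta> / p)) \<omega>) (2 * r)"
      unfolding time by simp
    thus "a \<in> (\<Union>i<N. \<Union>l<2 * m\<^sup>2 * p. ball (B (real i * (2 * m\<^sup>2 * \<eta>) + real l * (\<eta> / p)) \<omega>) (2 * r))"
      using il(1,2) unfolding L_def by (intro UN_I[of i] UN_I[of l]) simp_all
  qed
qed

text \<open>Fatou's lemma for events. It turns bounds uniform in \<open>p\<close> into a bound for
  an event that lies in \<open>E p\<close> only from a path-dependent \<open>p\<close> on.\<close>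

lemma prob_liminf_le:
  fixes E :: "nat \<Rightarrow> 'w set"
  assumes [measurable]: "\<And>p. E p \<in> sets M" and A: "A \<in> sets M"
    and "\<And>\<omega>. \<omega> \<in> A \<Longrightarrow> \<exists>p0. \<forall>p>p0. \<omega> \<in> E p" and le: "\<And>p. p > 0 \<Longrightarrow> prob (E p) \<le> c"
  shows "prob A \<le> c"
proof -
  define C where "C k = (\<Inter>p\<in>{k<..}. E p)" for k :: nat
  have C[measurable]: "C k \<in> sets M" for k unfolding C_def by (rule sets.countable_INT') auto
  have "(\<lambda>k. prob (C k)) \<longlonglongrightarrow> prob (\<Union>k. C k)"
    by (rule finite_Lim_measure_incseq) (auto simp: C_def incseq_def)
  moreover have "prob (C k) \<le> c" for k
    using finite_measure_mono[of "C k" "E (Suc k)"] le[of "Suc k"] by (force simp: C_def)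
  ultimately have "prob (\<Union>k. C k) \<le> c" by (intro LIMSEQ_le_const2) auto
  moreover have "A \<subseteq> (\<Union>k. C k)" using assms(3) by (fastforce simp: C_def)
  hence "prob A \<le> prob (\<Union>k. C k)" by (intro finite_measure_mono) auto
  ultimately show ?thesis by linarith
qed

text \<open>For each fine enough mesh, cap \<ge> x forces the sum of the block bounds above x; the
  bound on the probability of the latter is the same for every mesh.\<close>

lemma prob_newton_cap_ge:
  fixes \<eta> \<theta> r t y x K :: real and m N :: nat
  assumes \<eta>: "0 < \<eta>" and m: "2 \<le> m" and \<theta>: "0 < \<theta>" and K: "0 \<le> K" and r: "0 < r" "4 * r \<le> sqrt (m * \<eta>)"
    and y: "0 \<le> y" and N: "0 < N" "t < real N * (2 * m\<^sup>2 * \<eta>)"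
    and mgf: "\<And>i p. p > 0 \<Longrightarrow> (\<integral>\<^sup>+\<omega>. ennreal (exp (\<theta> * block_cap r m \<eta> y p
        (\<lambda>l. B (real i * (2 * m\<^sup>2 * \<eta>) + real l * (\<eta> / p)) \<omega>))) \<partial>M) \<le> ennreal K"
  shows "measure M {\<omega> \<in> space M. newton_cap (wiener_sausage B r t \<omega>) \<ge> ennreal x} \<le> K ^ N * exp (- (\<theta> * x))"
proof (cases "{\<omega> \<in> space M. newton_cap (wiener_sausage B r t \<omega>) \<ge> ennreal x} \<in> sets M")
  case False \<comment> \<open>\<open>measure\<close> is \<open>0\<close> on non-measurable sets\<close>
  thus ?thesis using K by (simp add: measure_notin_sets)
next
  case True
  define Z where "Z p i \<omega> = block_cap r m \<eta> y p (\<lambda>l. B (real i * (2 * m\<^sup>2 * \<eta>) + real l * (\<eta> / p)) \<omega>)" for p i \<omega>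
  have [measurable]: "Z p i \<in> borel_measurable M" for p i
    unfolding Z_def using \<eta> by (intro measurable_block_cap measurable_grid) auto
  show ?thesis
  proof (rule prob_liminf_le[OF _ True])
    show "{\<omega> \<in> space M. x \<le> (\<Sum>i<N. Z p i \<omega>)} \<in> sets M" for p by measurable
    show "prob {\<omega> \<in> space M. x \<le> (\<Sum>i<N. Z p i \<omega>)} \<le> K ^ N * exp (- (\<theta> * x))" if "p > 0" for p
      unfolding Z_def using \<eta> that m \<theta> K mgf by (intro prob_sum_block_caps_ge) auto
    fix \<omega> assume "\<omega> \<in> {\<omega> \<in> space M. newton_cap (wiener_sausage B r t \<omega>) \<ge> ennreal x}"
    hence \<omega>: "\<omega> \<in> space M" and x: "ennreal x \<le> newton_cap (wiener_sausage B r t \<omega>)" by auto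
    obtain p0 where p0: "\<And>p. p > p0 \<Longrightarrow> wiener_sausage B r t \<omega>
      \<subseteq> (\<Union>i<N. \<Union>l<2 * m\<^sup>2 * p. ball (B (real i * (2 * m\<^sup>2 * \<eta>) + real l * (\<eta> / p)) \<omega>) (2 * r))"
      using wiener_sausage_subset_blocks[OF \<omega> \<eta> _ r(1) N(2)] m by (meson less_le_trans pos2)
    show "\<exists>p0. \<forall>p>p0. \<omega> \<in> {\<omega> \<in> space M. x \<le> (\<Sum>i<N. Z p i \<omega>)}"
    proof (intro exI[of _ p0] allI impI)
      fix p assume p: "p0 < p"
      have eb: "energy_bound (\<Union>i<N. \<Union>l<2 * m\<^sup>2 * p. ball (B (real i * (2 * m\<^sup>2 * \<eta>) + real l * (\<eta> / p)) \<omega>) (2 * r)) (\<Sum>i<N. Z p i \<omega>)"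
        unfolding Z_def using N(1) m \<eta> p r y
        by (intro energy_bound_UN energy_bound_block) (auto simp: lessThan_empty_iff)
      hence "ennreal x \<le> ennreal (\<Sum>i<N. Z p i \<omega>)"
        using energy_bound_newton_cap[OF eb p0[OF p]] x by simp
      \<comment> \<open>\<open>ennreal\<close> sends negative reals to 0, so positivity of the right
        side is what allows the comparison to be pulled back to reals.\<close>
      moreover have "(\<Sum>i<N. Z p i \<omega>) > 0" using eb by (simp add: energy_bound_def)
      ultimately show "\<omega> \<in> {\<omega> \<in> space M. x \<le> (\<Sum>i<N. Z p i \<omega>)}" using \<omega> by simp
    qed
  qed
qed

end

section \<open>Choice of parameters and conclusion\<close>

text \<open>The excess over 1 in \<open>expectation_exp_block_cap_le\<close> for \<eta> = m^(-6) and
  y = 7 ln (m + 1), with \<open>\<theta>\<close> replaced by its upper bound 3 ln (m + 1). It thus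
  depends on m alone.\<close>

definition mgf_excess :: "nat \<Rightarrow> real" where
  "mgf_excess m = 8 * pi\<^sup>2 * (3 * ln (real m + 1)) * (real m)\<^sup>2 * (1 / real m ^ 6) * (2 + ln (2 * (real m)\<^sup>2)) / (block_potential m (7 * ln (real m + 1)))\<^sup>2
    + 6 * (real m)\<^sup>2 * (4 * exp (- real m / 16) + (real m + 1) * exp (- (7 * ln (real m + 1)))) + 72 * exp (- real m)"

text \<open>The comparison function is the block duration h = 2 m^(-4). In the energy term the
  logarithms cancel against the squared potential; the defect term is of order m^2 * m * m^(-7),
  which is where the 7 comes from; the other terms are exponentially small.\<close>

lemma mgf_excess_bigo: "mgf_excess \<in> O(\<lambda>m. 2 * (real m)\<^sup>2 * (1 / real m ^ 6))"
  unfolding mgf_excess_def[abs_def] block_potential_def by real_asymp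

text \<open>The hypotheses on a block with m^(-3) in place of r, which it bounds from above, and 3
  ln (m + 1) in place of \<open>\<theta>\<close>.\<close>

lemma block_parameters_eventually:
  "\<exists>C>0. \<forall>\<^sub>F m in sequentially. m \<ge> 2
    \<and> 8 * pi\<^sup>2 * (3 * ln (real m + 1)) * real m ^ 3 * (1 / real m ^ 6) \<le> (block_potential m (7 * ln (real m + 1)))\<^sup>2
    \<and> 256 * pi\<^sup>2 * (3 * ln (real m + 1)) * real m ^ 3 * (1 / real m ^ 6) \<le> 1
    \<and> 128 * pi\<^sup>2 * (3 * ln (real m + 1)) * (1 / real m ^ 3)\<^sup>2 \<le> 1
    \<and> 4 * (1 / real m ^ 3) \<le> sqrt (real m * (1 / real m ^ 6))
    \<and> mgf_excess m \<le> C * (2 * (real m)\<^sup>2 * (1 / real m ^ 6))"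
proof -
  obtain C where C: "C > 0" "\<forall>\<^sub>F m in sequentially. norm (mgf_excess m) \<le> C * norm (2 * (real m)\<^sup>2 * (1 / real m ^ 6))"
    by (rule landau_o.bigE[OF mgf_excess_bigo])
  have "\<forall>\<^sub>F m in sequentially. mgf_excess m \<le> C * (2 * (real m)\<^sup>2 * (1 / real m ^ 6))"
    using C(2)
  proof eventually_elim
    case (elim m)
    have "norm (2 * (real m)\<^sup>2 * (1 / real m ^ 6)) = 2 * (real m)\<^sup>2 * (1 / real m ^ 6)" by simp
    with elim show ?case unfolding real_norm_def by linarith
  qed
  moreover have "\<forall>\<^sub>F m in sequentially. 8 * pi\<^sup>2 * (3 * ln (real m + 1)) * real m ^ 3 * (1 / real m ^ 6) \<le> (block_potential m (7 * ln (real m + 1)))\<^sup>2"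
    unfolding block_potential_def by real_asymp
  moreover have "\<forall>\<^sub>F m in sequentially. 256 * pi\<^sup>2 * (3 * ln (real m + 1)) * real m ^ 3 * (1 / real m ^ 6) \<le> 1"
    by real_asymp
  moreover have "\<forall>\<^sub>F m in sequentially. 128 * pi\<^sup>2 * (3 * ln (real m + 1)) * (1 / real m ^ 3)\<^sup>2 \<le> 1"
    by real_asymp
  moreover have "\<forall>\<^sub>F m in sequentially. 4 * (1 / real m ^ 3) \<le> sqrt (real m * (1 / real m ^ 6))"
    by real_asymp
  moreover have "\<forall>\<^sub>F m::nat in sequentially. m \<ge> 2" by (rule eventually_ge_at_top)
  ultimately show ?thesis using C(1)
    by (intro exI[of _ C] conjI eventually_conj) assumption+
qed

theorem lemma3p7:
  fixes M :: "'w measure" and B :: "real \<Rightarrow> 'w \<Rightarrow> real ^ 4"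
  assumes "standard_brownian_motion M B"
  shows "\<exists>c::real. c > 0 \<and>
    (\<forall>\<epsilon>::real. \<epsilon> > 0 \<longrightarrow>
      (\<exists>(j0::real) r0::real. j0 > 0 \<and> 0 < r0 \<and> r0 < 1 \<and>
        (\<forall>(j::real) r::real. j \<ge> j0 \<longrightarrow> 0 < r \<longrightarrow> r \<le> r0 \<longrightarrow>
          (let t = \<epsilon> * sqrt \<bar>ln r\<bar> in
            measure M {\<omega> \<in> space M.
                newton_cap (wiener_sausage B r t \<omega>) \<ge> ennreal (j * (t / \<bar>ln r\<bar>))}
              \<le> t powr (- (c * j))))))"
proof -
  interpret brownian_motion_4 M B
    using assms by (simp add: brownian_motion_4_def)
  obtain C where C: "C > 0" and ev: "\<forall>\<^sub>F m in sequentially. m \<ge> 2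
    \<and> 8 * pi\<^sup>2 * (3 * ln (real m + 1)) * real m ^ 3 * (1 / real m ^ 6) \<le> (block_potential m (7 * ln (real m + 1)))\<^sup>2
    \<and> 256 * pi\<^sup>2 * (3 * ln (real m + 1)) * real m ^ 3 * (1 / real m ^ 6) \<le> 1
    \<and> 128 * pi\<^sup>2 * (3 * ln (real m + 1)) * (1 / real m ^ 3)\<^sup>2 \<le> 1
    \<and> 4 * (1 / real m ^ 3) \<le> sqrt (real m * (1 / real m ^ 6))
    \<and> mgf_excess m \<le> C * (2 * (real m)\<^sup>2 * (1 / real m ^ 6))"
    using block_parameters_eventually by (elim exE conjE) rule
  from ev[unfolded eventually_sequentially] obtain m0 where ev: "\<forall>m\<ge>m0. m \<ge> 2
    \<and> 8 * pi\<^sup>2 * (3 * ln (real m + 1)) * real m ^ 3 * (1 / real m ^ 6) \<le> (block_potential m (7 * ln (real m + 1)))\<^sup>2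
    \<and> 256 * pi\<^sup>2 * (3 * ln (real m + 1)) * real m ^ 3 * (1 / real m ^ 6) \<le> 1
    \<and> 128 * pi\<^sup>2 * (3 * ln (real m + 1)) * (1 / real m ^ 3)\<^sup>2 \<le> 1
    \<and> 4 * (1 / real m ^ 3) \<le> sqrt (real m * (1 / real m ^ 6))
    \<and> mgf_excess m \<le> C * (2 * (real m)\<^sup>2 * (1 / real m ^ 6))"
    by (elim exE) rule
  \<comment> \<open>All that is used about the relation of t to r is t \<ge> 2; the exponent
    constant is 1/2.\<close>
  have main: "measure M {\<omega> \<in> space M. newton_cap (wiener_sausage B r t \<omega>) \<ge> ennreal (j * (t / \<bar>ln r\<bar>))} \<le> t powr (- (1/2 * j))"
    if j: "j \<ge> 4 * C" and r: "0 < r" "r < 1" "r \<le> (1 / (real m0 + 1)) ^ 3" and t: "t \<ge> 2" for j r t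
  proof -
    define \<theta> where "\<theta> = \<bar>ln r\<bar>"
    have \<theta>: "\<theta> > 0" "\<theta> = ln (1 / r)" using r by (auto simp: \<theta>_def ln_div)
    \<comment> \<open>\<open>m\<close> is the integer part of r^(-1/3), so that 1 / r lies between
      m^3 and (m + 1)^3.\<close>
    define s where "s = root 3 (1 / r)"
    have s: "s ^ 3 = 1 / r" "s > 0" using r by (auto simp: s_def)
    define m where "m = nat \<lfloor>s\<rfloor>"
    have ms: "real m \<le> s" "s < real m + 1" using s(2) unfolding m_def by linarith+
    have "(real m0 + 1) ^ 3 \<le> s ^ 3"
      using r by (simp add: s power_one_over field_simps)
    hence "real m0 + 1 \<le> s" using s(2) by (subst (asm) power_mono_iff) auto
    hence "m \<ge> m0" using ms by linarith
    with ev have m2: "m \<ge> 2"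
      and ev1: "8 * pi\<^sup>2 * (3 * ln (real m + 1)) * real m ^ 3 * (1 / real m ^ 6) \<le> (block_potential m (7 * ln (real m + 1)))\<^sup>2"
      and ev2: "256 * pi\<^sup>2 * (3 * ln (real m + 1)) * real m ^ 3 * (1 / real m ^ 6) \<le> 1"
      and ev3: "128 * pi\<^sup>2 * (3 * ln (real m + 1)) * (1 / real m ^ 3)\<^sup>2 \<le> 1"
      and ev4: "4 * (1 / real m ^ 3) \<le> sqrt (real m * (1 / real m ^ 6))"
      and ev5: "mgf_excess m \<le> C * (2 * (real m)\<^sup>2 * (1 / real m ^ 6))"
      by (simp_all only:)
    hence m_pos: "real m > 0" by simp
    have "real m ^ 3 \<le> 1 / r" using ms s by (metis power_mono of_nat_0_le_iff)
    hence rm: "r \<le> 1 / real m ^ 3" using r m_pos by (simp add: field_simps)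
    have "1 / r \<le> (real m + 1) ^ 3" using ms s by (metis power_mono less_imp_le)
    hence "\<theta> \<le> ln ((real m + 1) ^ 3)" using r unfolding \<theta>(2) by (subst ln_le_cancel_iff) auto
    hence \<theta>m: "\<theta> \<le> 3 * ln (real m + 1)" by (simp add: ln_realpow)
    \<comment> \<open>The cut-off sqrt (m \<eta>) = m^(-5/2) is then of larger order than r, which
      is about m^(-3).\<close>
    define \<eta> where "\<eta> = 1 / real m ^ 6"
    have \<eta>: "\<eta> > 0" using m_pos by (simp add: \<eta>_def)
    define y where "y = 7 * ln (real m + 1)"
    have y: "y \<ge> 0" by (simp add: y_def)
    define h where "h = 2 * m\<^sup>2 * \<eta>"
    have h: "h > 0" using \<eta> m_pos by (simp add: h_def)
    have "h = 2 / real m ^ 4" using m_pos by (simp add: h_def \<eta>_def field_simps flip: power_add)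
    also have "\<dots> \<le> 2 / 1" using m2 by (intro divide_left_mono) (auto intro: one_le_power)
    finally have ht: "h \<le> t" using t by simp
    \<comment> \<open>Adding 1 makes the blocks reach strictly beyond t; as h \<le> t, their total
      duration is at most 2 t.\<close>
    define N where "N = nat \<lfloor>t / h\<rfloor> + 1"
    have "t / h \<ge> 0" using t h by simp
    hence "t / h < real N" "real N \<le> t / h + 1" unfolding N_def by linarith+
    hence N: "t < real N * h" "real N * h \<le> t + h" using h by (auto simp: field_simps)
    define K where "K = 1 + C * h"
    have K: "K \<ge> 0" using C h by (simp add: K_def)
    have P: "block_potential m y > 0" using m2 y by (simp add: block_potential_def)
    have ln0: "ln (2 * (real m)\<^sup>2) \<ge> 0"
      using m2 by (subst ln_ge_zero_iff) (auto intro!: order.trans[OF _ mult_mono[of 1 2 1 "(real m)\<^sup>2"]] one_le_power)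
    have "measure M {\<omega> \<in> space M. newton_cap (wiener_sausage B r t \<omega>) \<ge> ennreal (j * (t / \<bar>ln r\<bar>))}
      \<le> K ^ N * exp (- (\<theta> * (j * (t / \<bar>ln r\<bar>))))"
    proof (rule prob_newton_cap_ge[OF \<eta> m2 \<theta>(1) K r(1) _ y])
      show "4 * r \<le> sqrt (m * \<eta>)" using rm ev4 by (simp add: \<eta>_def)
      show "0 < N" by (simp add: N_def)
      show "t < real N * (2 * m\<^sup>2 * \<eta>)" using N(1) by (simp add: h_def)
      fix i p :: nat assume p: "p > 0"
      have "(\<integral>\<^sup>+\<omega>. ennreal (exp (\<theta> * block_cap r m \<eta> y p (\<lambda>l. B (real i * (2 * m\<^sup>2 * \<eta>) + real l * (\<eta> / p)) \<omega>))) \<partial>M)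
        \<le> ennreal (1 + 8 * pi\<^sup>2 * \<theta> * m\<^sup>2 * \<eta> * (2 + ln (2 * m\<^sup>2)) / (block_potential m y)\<^sup>2
          + 6 * m\<^sup>2 * (4 * exp (- real m / 16) + (m + 1) * exp (- y)) + 72 * exp (- real m))"
      proof (rule expectation_exp_block_cap_le[OF _ \<eta> p m2 \<theta>(1) r(1) y])
        show "0 \<le> real i * (2 * m\<^sup>2 * \<eta>)" using \<eta> by simp
        have "8 * pi\<^sup>2 * \<theta> * m ^ 3 * \<eta> \<le> 8 * pi\<^sup>2 * (3 * ln (real m + 1)) * m ^ 3 * \<eta>"
          using \<eta> by (intro mult_right_mono mult_left_mono \<theta>m) auto
        thus "8 * pi\<^sup>2 * \<theta> * m ^ 3 * \<eta> \<le> (block_potential m y)\<^sup>2" using ev1 by (simp add: \<eta>_def y_def)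
        have "256 * pi\<^sup>2 * \<theta> * m ^ 3 * \<eta> \<le> 256 * pi\<^sup>2 * (3 * ln (real m + 1)) * m ^ 3 * \<eta>"
          using \<eta> by (intro mult_right_mono mult_left_mono \<theta>m) auto
        thus "256 * pi\<^sup>2 * \<theta> * m ^ 3 * \<eta> \<le> 1" using ev2 by (simp add: \<eta>_def)
        have "128 * pi\<^sup>2 * \<theta> * r\<^sup>2 \<le> 128 * pi\<^sup>2 * (3 * ln (real m + 1)) * (1 / real m ^ 3)\<^sup>2"
          using r rm by (intro mult_mono mult_left_mono \<theta>m power_mono) auto
        thus "128 * pi\<^sup>2 * \<theta> * r\<^sup>2 \<le> 1" using ev3 by (rule order.trans)
      qed
      also have "\<dots> \<le> ennreal K"
      proof (rule ennreal_leI)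
        have "8 * pi\<^sup>2 * \<theta> * m\<^sup>2 * \<eta> * (2 + ln (2 * m\<^sup>2)) / (block_potential m y)\<^sup>2
          \<le> 8 * pi\<^sup>2 * (3 * ln (real m + 1)) * m\<^sup>2 * \<eta> * (2 + ln (2 * m\<^sup>2)) / (block_potential m y)\<^sup>2"
          using \<eta> ln0 by (intro divide_right_mono mult_right_mono mult_left_mono \<theta>m) auto
        thus "1 + 8 * pi\<^sup>2 * \<theta> * m\<^sup>2 * \<eta> * (2 + ln (2 * m\<^sup>2)) / (block_potential m y)\<^sup>2
          + 6 * m\<^sup>2 * (4 * exp (- real m / 16) + (m + 1) * exp (- y)) + 72 * exp (- real m) \<le> K"
          using ev5 unfolding mgf_excess_def K_def h_def \<eta>_def y_def
            of_nat_mult of_nat_power of_nat_numeral of_nat_add of_nat_1 by linarith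
      qed
      finally show "(\<integral>\<^sup>+\<omega>. ennreal (exp (\<theta> * block_cap r m \<eta> y p (\<lambda>l. B (real i * (2 * m\<^sup>2 * \<eta>) + real l * (\<eta> / p)) \<omega>))) \<partial>M) \<le> ennreal K" .
    qed
    \<comment> \<open>Here the choice of \<open>\<theta>\<close> cancels the logarithm in the level
      j t / \<bar>ln r\<bar>.\<close>
    also have "\<theta> * (j * (t / \<bar>ln r\<bar>)) = j * t" using \<theta> by (simp add: \<theta>_def)
    also have "K ^ N \<le> exp (C * h) ^ N"
      using K unfolding K_def by (intro power_mono exp_ge_add_one_self)
    also have "exp (C * h) ^ N = exp (C * (real N * h))" by (simp add: mult_ac flip: exp_of_nat_mult)
    also have "\<dots> \<le> exp (C * (2 * t))" using C N(2) ht by (intro iffD2[OF exp_le_cancel_iff] mult_left_mono) auto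
    also have "exp (C * (2 * t)) * exp (- (j * t)) = exp (2 * C * t - j * t)" by (simp add: exp_diff exp_minus field_simps)
    also have "\<dots> \<le> exp (- (1/2 * j) * ln t)"
    proof -
      \<comment> \<open>The threshold 4 C on j lets half of j t absorb the 2 C t from the moments;
        the other half exceeds j / 2 * ln t.\<close>
      have "4 * C * t \<le> j * t" using j t by (intro mult_right_mono) auto
      moreover have "1/2 * j * ln t \<le> 1/2 * j * t"
        using ln_le_minus_one[of t] t j C by (intro mult_left_mono) auto
      ultimately show ?thesis by simp
    qed
    also have "\<dots> = t powr (- (1/2 * j))" using t by (simp add: powr_def)
    finally show ?thesis by (simp add: mult_right_mono)
  qed
  show ?thesis
  proof (rule exI[of _ "1/2"], intro conjI allI impI)
    fix \<epsilon> :: real assume \<epsilon>: "\<epsilon> > 0"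
    \<comment> \<open>The three bounds ensure r < 1, m \<ge> m0 and t \<ge> 2, in this
      order.\<close>
    define r0 where "r0 = min (1/2) (min ((1 / (real m0 + 1)) ^ 3) (exp (- (2 / \<epsilon>)\<^sup>2)))"
    show "\<exists>j0 r0. j0 > 0 \<and> 0 < r0 \<and> r0 < 1 \<and>
        (\<forall>j r. j \<ge> j0 \<longrightarrow> 0 < r \<longrightarrow> r \<le> r0 \<longrightarrow>
          (let t = \<epsilon> * sqrt \<bar>ln r\<bar> in
            measure M {\<omega> \<in> space M. newton_cap (wiener_sausage B r t \<omega>) \<ge> ennreal (j * (t / \<bar>ln r\<bar>))}
              \<le> t powr (- (1/2 * j))))"
    proof (rule exI[of _ "4 * C"], rule exI[of _ r0], intro conjI allI impI)
      show "4 * C > 0" "0 < r0" "r0 < 1" using C by (auto simp: r0_def min_def)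
      fix j r :: real assume j: "j \<ge> 4 * C" and r: "0 < r" "r \<le> r0"
      have r': "r \<le> 1/2" "r \<le> (1 / (real m0 + 1)) ^ 3" "r \<le> exp (- (2 / \<epsilon>)\<^sup>2)" using r by (auto simp: r0_def)
      have "ln r \<le> - (2 / \<epsilon>)\<^sup>2" using r'(3) r(1) by (metis ln_exp ln_le_cancel_iff exp_gt_zero)
      hence "(2 / \<epsilon>)\<^sup>2 \<le> \<bar>ln r\<bar>" by linarith
      hence "2 / \<epsilon> \<le> sqrt \<bar>ln r\<bar>" by (rule real_le_rsqrt)
      hence "\<epsilon> * sqrt \<bar>ln r\<bar> \<ge> 2" using \<epsilon> by (simp add: field_simps)
      thus "let t = \<epsilon> * sqrt \<bar>ln r\<bar> in
            measure M {\<omega> \<in> space M. newton_cap (wiener_sausage B r t \<omega>) \<ge> ennreal (j * (t / \<bar>ln r\<bar>))}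
              \<le> t powr (- (1/2 * j))"
        unfolding Let_def using j r(1) r' by (intro main) auto
    qed
  qed simp
qed

end
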